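(* Let $r>4$ be an integer, and let $\Omega_r$, $\mathcal{I}_r$, $\mathcal{B}_r=\{B_1,\dots,B_{r-1},B_r^{\ast}\}$ and $\mathcal{B}'_r=\{B_1,\dots,B_{r-1},B_r\}$ be the set, the family of $r$-element subsets of $\Omega_r$, and the two families of partitions of $\Omega_r$ into $r$ blocks defined in the context (where the definition of the partitions depends on the parity of $r$). Then: (a) for the transformation monoid $M=M(\mathcal{B}_r,\mathcal{I}_r)$ on $\Omega_r$, the augmentation submodule $\operatorname{Aug}(\mathbb{C}\Omega_r)$ is a simple $\mathbb{C}M$-module; (b) for the transformation monoid $M'=M(\mathcal{B}'_r,\mathcal{I}_r)$ on $\Omega_r$, the augmentation submodule $\operatorname{Aug}(\mathbb{C}\Omega_r)$ is not a simple $\mathbb{C}M'$-module.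
   Context: **Monoid construction.** Let $\Omega$ be a finite set, $\mathcal{B}$ a set of partitions of $\Omega$ into exactly $r$ nonempty blocks, and $\mathcal{I}$ a set of $r$-element subsets of $\Omega$, such that for every $\pi\in\mathcal{B}$ and $I\in\mathcal{I}$, either $I$ is contained in a single block of $\pi$ or $I$ contains exactly one element of each block of $\pi$ (the "$\mathscr{J}$-minimal compatibility condition"; it holds for the families below). Then $M(\mathcal{B},\mathcal{I})$ is the monoid of self-maps of $\Omega$ (under composition, acting on the left) consisting of all maps $f$ whose kernel partition $\{f^{-1}(\omega)\mid\omega\in f(\Omega)\}$ is in $\mathcal{B}$ and whose image is in $\mathcal{I}$ (with every bijection from blocks to image points allowed), the identity map, and all constant maps. $\mathbb{C}\Omega$ is the complex vector space with basis $\Omega$, a left $\mathbb{C}M$-module by linear extension of the action; $\operatorname{Aug}(\mathbb{C}\Omega)$ is the submodule of combinations whose coefficients sum to $0$. **The set $\Omega_r$ and family $\mathcal{I}_r$.** $\Omega_r$ consists of the $r(r-1)$ distinct elements $\omega_{J_i}$, $\omega_{P_i}$ ($1\le i\le r$) and $\omega_{c_{i,s}}$ ($1\le i\le r$, $1\le s\le r-3$). The indices $i$ are read modulo $r$ (in $\{1,\dots,r\}$). Put $$E_i=\{\omega_{J_{i-1}},\omega_{c_{i,1}},\dots,\omega_{c_{i,r-3}},\omega_{P_i},\omega_{J_i}\}\ (1\le i\le r),\qquad C_s=\{\omega_{c_{1,s}},\dots,\omega_{c_{r,s}}\}\ (1\le s\le r-3),$$ and $\mathcal{I}_r=\{E_1,\dots,E_r,C_1,\dots,C_{r-3}\}$.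 **The partitions $B_j$, $1\le j\le r$.** Each $B_j$ has $r$ blocks: one "first block" $F_j$ and $r-1$ "diagonal" blocks. The diagonal blocks come from an $(r-1)\times(r-1)$ table $T_j$, with rows $q=1,\dots,r-1$ and columns $t=1,\dots,r-1$, some cells of which are blank. For $1\le q\le r-3$ the cell $(q,t)$ of $T_j$ contains $\omega_{c_{j+t,q}}$. The last two rows are: - *$r$ odd*: if $t$ is odd, cell $(r-2,t)$ contains $\omega_{P_{j+t}}$ and cell $(r-1,t)$ contains $\omega_{J_{j+t}}$; if $t$ is even, cell $(r-2,t)$ is blank and cell $(r-1,t)$ contains $\omega_{P_{j+t}}$. The first block is $F_j=E_j\cup\{\omega_{J_{j+2}},\omega_{J_{j+4}},\dots,\omega_{J_{j+r-3}}\}$. - *$r$ even*: if $t$ is odd and $1\le t\le r-3$, cell $(r-2,t)$ contains $\omega_{P_{j+t}}$ and cell $(r-1,t)$ contains $\omega_{J_{j+t}}$; if $t$ is even and $2\le t\le r-4$, cell $(r-2,t)$ is blank and cell $(r-1,t)$ contains $\omega_{P_{j+t}}$; for $t=r-2$, cell $(r-2,t)$ is blank and cell $(r-1,t)$ contains $\omega_{J_{j+r-2}}$; for $t=r-1$, cell $(r-2,t)$ is blank and cell $(r-1,t)$ contains $\omega_{P_{j+r-1}}$. The first block is $F_j=E_j\cup\{\omega_{J_{j+2}},\omega_{J_{j+4}},\dots,\omega_{J_{j+r-4}}\}\cup\{\omega_{P_{j+r-2}}\}$. In both cases, for each residue $d$ modulo $r-1$ there is one diagonal block, consisting of all (non-blank)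 entries of $T_j$ in cells $(q,t)$ with $q+t\equiv d \pmod{r-1}$. **The partition $B_r^{\ast}$.** Its blocks are $C_1,\dots,C_{r-3}$ together with three further blocks: - *$r$ odd*: $\{\omega_{J_r},\omega_{J_2},\omega_{J_4},\dots,\omega_{J_{r-3}},\omega_{P_{r-1}}\}$; $\{\omega_{J_1},\omega_{J_3},\dots,\omega_{J_{r-2}},\omega_{P_r}\}$; $\{\omega_{J_{r-1}},\omega_{P_1},\omega_{P_2},\dots,\omega_{P_{r-2}}\}$. - *$r$ even*: $\{\omega_{J_2},\omega_{P_1},\omega_{P_4}\}\cup\{\omega_{J_i}: i \text{ odd},\ 5\le i\le r-1\}$; $\{\omega_{J_3},\omega_{P_2},\omega_{P_5}\}\cup\{\omega_{J_i}: i\text{ even},\ 6\le i\le r\}$; $\{\omega_{J_1},\omega_{J_4},\omega_{P_3}\}\cup\{\omega_{P_i}: 6\le i\le r\}$. Finally $\mathcal{B}_r=\{B_1,\dots,B_{r-1},B_r^{\ast}\}$ and $\mathcal{B}'_r=\{B_1,\dots,B_{r-1},B_r\}$. *)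

theory Defs
  imports Complex_Main "HOL-Algebra.Module"
begin

section \<open>Left modules over a possibly noncommutative ring\<close>

text \<open>The library locale \<open>module\<close> requires a commutative ring of scalars. The following locale
  has the same axioms over an arbitrary ring; the library locale \<open>submodule\<close> does not refer to
  commutativity and is used unchanged.\<close>

locale left_module = R?: ring R + M?: abelian_group M for R (structure) and M (structure) +
  assumes smult_closed [simp, intro]:
      "\<lbrakk>a \<in> carrier R; x \<in> carrier M\<rbrakk> \<Longrightarrow> a \<odot>\<^bsub>M\<^esub> x \<in> carrier M"
    and smult_l_distr:
      "\<lbrakk>a \<in> carrier R; b \<in> carrier R; x \<in> carrier M\<rbrakk> \<Longrightarrow>
        (a \<oplus>\<^bsub>R\<^esub> b) \<odot>\<^bsub>M\<^esub> x = (a \<odot>\<^bsub>M\<^esub> x) \<oplus>\<^bsub>M\<^esub> (b \<odot>\<^bsub>M\<^esub> x)"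
    and smult_r_distr:
      "\<lbrakk>a \<in> carrier R; x \<in> carrier M; y \<in> carrier M\<rbrakk> \<Longrightarrow>
        a \<odot>\<^bsub>M\<^esub> (x \<oplus>\<^bsub>M\<^esub> y) = (a \<odot>\<^bsub>M\<^esub> x) \<oplus>\<^bsub>M\<^esub> (a \<odot>\<^bsub>M\<^esub> y)"
    and smult_assoc1:
      "\<lbrakk>a \<in> carrier R; b \<in> carrier R; x \<in> carrier M\<rbrakk> \<Longrightarrow>
        (a \<otimes>\<^bsub>R\<^esub> b) \<odot>\<^bsub>M\<^esub> x = a \<odot>\<^bsub>M\<^esub> (b \<odot>\<^bsub>M\<^esub> x)"
    and smult_one [simp]:
      "x \<in> carrier M \<Longrightarrow> \<one>\<^bsub>R\<^esub> \<odot>\<^bsub>M\<^esub> x = x"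

lemma (in left_module) left_module_submodule:
  assumes "submodule N R M"
  shows "left_module R (M\<lparr>carrier := N\<rparr>)"
proof -
  interpret N: submodule N R M by fact
  have sub: "N \<subseteq> carrier M" using N.subset by simp
  have "abelian_group (M\<lparr>carrier := N\<rparr>)"
  proof (intro abelian_group.intro abelian_group_axioms.intro)
    show mon: "abelian_monoid (M\<lparr>carrier := N\<rparr>)"
      using comm_monoid.submonoid_is_comm_monoid[OF M.a_comm_monoid N.subgroup_is_submonoid]
      by (simp add: abelian_monoid_def)
    show "comm_group (add_monoid (M\<lparr>carrier := N\<rparr>))"
      using N.subgroup_is_group[OF M.a_group] mon
      by (simp add: comm_group_def abelian_monoid_def)
  qed
  then show ?thesis
    by (intro left_module.intro left_module_axioms.intro R.ring_axioms)
       (use sub in \<open>auto simp: smult_l_distr smult_r_distr smult_assoc1 subset_iff\<close>)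
qed

definition simple_left_module :: "('a, 'c) ring_scheme \<Rightarrow> ('a, 'b, 'd) module_scheme \<Rightarrow> bool" where
  "simple_left_module R M \<longleftrightarrow>
     left_module R M \<and> carrier M \<noteq> {\<zero>\<^bsub>M\<^esub>} \<and>
     (\<forall>N. submodule N R M \<longrightarrow> N = {\<zero>\<^bsub>M\<^esub>} \<or> N = carrier M)"


section \<open>The monoid algebra and the transformation module\<close>

text \<open>Formal linear combinations over a finite set \<open>S\<close> are represented by their coefficient
  functions, which vanish outside \<open>S\<close>.\<close>

definition lin_comb :: "'a set \<Rightarrow> ('a \<Rightarrow> complex) set" where
  "lin_comb S = {x. \<forall>w. w \<notin> S \<longrightarrow> x w = 0}"

text \<open>The complex algebra of a finite monoid (there is no finite-support condition, so the
  definition is only meant for finite \<open>G\<close>).\<close>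

definition monoid_algebra :: "('m, 'c) monoid_scheme \<Rightarrow> ('m \<Rightarrow> complex) ring" where
  "monoid_algebra G =
     \<lparr>carrier = lin_comb (carrier G),
      mult = (\<lambda>a b h. \<Sum>(f, g) \<in> {(f, g) \<in> carrier G \<times> carrier G. f \<otimes>\<^bsub>G\<^esub> g = h}. a f * b g),
      one = (\<lambda>f. if f = \<one>\<^bsub>G\<^esub> then 1 else 0),
      zero = (\<lambda>_. 0),
      add = (\<lambda>a b f. a f + b f)\<rparr>"

text \<open>For a monoid \<open>G\<close> of self-maps of \<open>\<Omega>\<close>, the left module with basis \<open>\<Omega>\<close> on which \<open>f\<close> sends the
  basis vector at \<open>v\<close> to the one at \<open>f v\<close>; thus the coefficient of \<open>f x\<close> at \<open>w\<close> is the sum of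
  the coefficients of \<open>x\<close> over the fibre of \<open>f\<close> at \<open>w\<close>. The record type has ring multiplication
  fields, which play no role for modules.\<close>

definition trans_module ::
  "'a set \<Rightarrow> ('a \<Rightarrow> 'a, 'c) monoid_scheme \<Rightarrow> (('a \<Rightarrow> 'a) \<Rightarrow> complex, 'a \<Rightarrow> complex) module" where
  "trans_module \<Omega> G =
     \<lparr>carrier = lin_comb \<Omega>, mult = undefined, one = undefined,
      zero = (\<lambda>_. 0),
      add = (\<lambda>x y w. x w + y w),
      smult = (\<lambda>a x w. \<Sum>f\<in>carrier G. a f * (\<Sum>v\<in>{v \<in> \<Omega>. f v = w}. x v))\<rparr>"

definition augmentation :: "'a set \<Rightarrow> ('a \<Rightarrow> complex) set" where
  "augmentation \<Omega> = {x \<in> lin_comb \<Omega>. (\<Sum>w\<in>\<Omega>. x w) = 0}"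

definition aug_module ::
  "'a set \<Rightarrow> ('a \<Rightarrow> 'a, 'c) monoid_scheme \<Rightarrow> (('a \<Rightarrow> 'a) \<Rightarrow> complex, 'a \<Rightarrow> complex) module" where
  "aug_module \<Omega> G = (trans_module \<Omega> G)\<lparr>carrier := augmentation \<Omega>\<rparr>"

lemma sum_rot3:
  "(\<Sum>a\<in>A. \<Sum>b\<in>B. \<Sum>c\<in>C. F a b c) = (\<Sum>b\<in>B. \<Sum>c\<in>C. \<Sum>a\<in>A. F a b c)"
  by (rule trans[OF sum.swap]) (intro sum.cong refl sum.swap)

lemma sum_rot4:
  "(\<Sum>a\<in>A. \<Sum>b\<in>B. \<Sum>c\<in>C. \<Sum>d\<in>D. F a b c d) = (\<Sum>b\<in>B. \<Sum>c\<in>C. \<Sum>d\<in>D. \<Sum>a\<in>A. F a b c d)"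
  by (rule trans[OF sum.swap]) (intro sum.cong refl sum_rot3)

lemma ring_monoid_algebra:
  assumes "monoid G" and fin: "finite (carrier G)"
  shows "ring (monoid_algebra G)"
proof -
  interpret monoid G by fact
  let ?A = "monoid_algebra G"
  have alt: "(a \<otimes>\<^bsub>?A\<^esub> b) h = (\<Sum>f\<in>carrier G. \<Sum>g\<in>carrier G. if f \<otimes>\<^bsub>G\<^esub> g = h then a f * b g else 0)"
    for a b h
    unfolding monoid_algebra_def
    by (simp add: sum.cartesian_product fin)
       (rule sum.mono_neutral_cong_left, auto simp: fin split: if_splits)
  have car: "a \<in> carrier ?A \<longleftrightarrow> (\<forall>f. f \<notin> carrier G \<longrightarrow> a f = 0)" for a
    by (simp add: monoid_algebra_def lin_comb_def)
  have oneA: "\<one>\<^bsub>?A\<^esub> f = (if f = \<one>\<^bsub>G\<^esub> then 1 else 0)" for f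
    by (simp add: monoid_algebra_def)
  have closed: "a \<otimes>\<^bsub>?A\<^esub> b \<in> carrier ?A" for a b
    unfolding car alt by (auto intro!: sum.neutral)
  show ?thesis
  proof (rule ringI)
    show "abelian_group ?A"
    proof (rule abelian_groupI)
      fix x assume "x \<in> carrier ?A"
      then show "\<exists>y\<in>carrier ?A. y \<oplus>\<^bsub>?A\<^esub> x = \<zero>\<^bsub>?A\<^esub>"
        by (intro bexI[of _ "\<lambda>f. - x f"]) (auto simp: monoid_algebra_def lin_comb_def)
    qed (auto simp: monoid_algebra_def lin_comb_def fun_eq_iff algebra_simps)
    show "Group.monoid ?A"
    proof (rule monoidI)
      show "\<one>\<^bsub>?A\<^esub> \<in> carrier ?A"
        unfolding car by (auto simp: monoid_algebra_def)
      show "a \<otimes>\<^bsub>?A\<^esub> b \<in> carrier ?A" for a b by (rule closed)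
      fix a assume a: "a \<in> carrier ?A"
      show "\<one>\<^bsub>?A\<^esub> \<otimes>\<^bsub>?A\<^esub> a = a"
      proof
        fix h
        have "(\<one>\<^bsub>?A\<^esub> \<otimes>\<^bsub>?A\<^esub> a) h =
          (\<Sum>f\<in>carrier G. if f = \<one>\<^bsub>G\<^esub> then \<Sum>g\<in>carrier G. if g = h then a g else 0 else 0)"
          unfolding alt by (intro sum.cong) (auto simp: oneA intro!: sum.cong sum.neutral)
        also have "\<dots> = a h"
          using a by (auto simp: fin car)
        finally show "(\<one>\<^bsub>?A\<^esub> \<otimes>\<^bsub>?A\<^esub> a) h = a h" .
      qed
      show "a \<otimes>\<^bsub>?A\<^esub> \<one>\<^bsub>?A\<^esub> = a"
      proof
        fix h
        have "(a \<otimes>\<^bsub>?A\<^esub> \<one>\<^bsub>?A\<^esub>) h =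
          (\<Sum>f\<in>carrier G. \<Sum>g\<in>carrier G. if g = \<one>\<^bsub>G\<^esub> then (if f = h then a f else 0) else 0)"
          unfolding alt by (intro sum.cong) (auto simp: oneA)
        also have "\<dots> = a h"
          using a by (auto simp: fin car)
        finally show "(a \<otimes>\<^bsub>?A\<^esub> \<one>\<^bsub>?A\<^esub>) h = a h" .
      qed
    next
      fix a b c
      let ?S = "carrier G"
      show "a \<otimes>\<^bsub>?A\<^esub> b \<otimes>\<^bsub>?A\<^esub> c = a \<otimes>\<^bsub>?A\<^esub> (b \<otimes>\<^bsub>?A\<^esub> c)"
      proof
        fix h
        let ?t = "\<lambda>k l g. if k \<otimes>\<^bsub>G\<^esub> l \<otimes>\<^bsub>G\<^esub> g = h then a k * b l * c g else 0"
        have "(a \<otimes>\<^bsub>?A\<^esub> b \<otimes>\<^bsub>?A\<^esub> c) h =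
          (\<Sum>f\<in>?S. \<Sum>g\<in>?S. \<Sum>k\<in>?S. \<Sum>l\<in>?S. if k \<otimes>\<^bsub>G\<^esub> l = f then ?t k l g else 0)"
          unfolding alt[of "a \<otimes>\<^bsub>?A\<^esub> b" c]
          by (intro sum.cong refl) (auto simp: alt sum_distrib_right intro!: sum.cong sum.neutral)
        also have "\<dots> = (\<Sum>g\<in>?S. \<Sum>k\<in>?S. \<Sum>l\<in>?S. \<Sum>f\<in>?S. if k \<otimes>\<^bsub>G\<^esub> l = f then ?t k l g else 0)"
          by (rule sum_rot4)
        also have "\<dots> = (\<Sum>g\<in>?S. \<Sum>k\<in>?S. \<Sum>l\<in>?S. ?t k l g)"
          by (intro sum.cong refl) (simp add: fin)
        also have "\<dots> = (\<Sum>k\<in>?S. \<Sum>l\<in>?S. \<Sum>g\<in>?S. ?t k l g)"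
          by (rule sum_rot3)
        also have "\<dots> = (\<Sum>k\<in>?S. \<Sum>l\<in>?S. \<Sum>g\<in>?S. \<Sum>f\<in>?S. if l \<otimes>\<^bsub>G\<^esub> g = f then ?t k l g else 0)"
          by (intro sum.cong refl) (simp add: fin)
        also have "\<dots> = (\<Sum>k\<in>?S. \<Sum>f\<in>?S. \<Sum>l\<in>?S. \<Sum>g\<in>?S. if l \<otimes>\<^bsub>G\<^esub> g = f then ?t k l g else 0)"
          by (rule sum.cong[OF refl], rule sum_rot3[symmetric])
        also have "\<dots> = (a \<otimes>\<^bsub>?A\<^esub> (b \<otimes>\<^bsub>?A\<^esub> c)) h"
          unfolding alt[of a "b \<otimes>\<^bsub>?A\<^esub> c"]
          by (intro sum.cong refl)
             (auto simp: alt sum_distrib_left m_assoc mult.assoc intro!: sum.cong sum.neutral)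
        finally show "(a \<otimes>\<^bsub>?A\<^esub> b \<otimes>\<^bsub>?A\<^esub> c) h = (a \<otimes>\<^bsub>?A\<^esub> (b \<otimes>\<^bsub>?A\<^esub> c)) h" .
      qed
    qed
  next
    fix a b c
    have add: "(x \<oplus>\<^bsub>?A\<^esub> y) f = x f + y f" for x y f by (simp add: monoid_algebra_def)
    show "(a \<oplus>\<^bsub>?A\<^esub> b) \<otimes>\<^bsub>?A\<^esub> c = a \<otimes>\<^bsub>?A\<^esub> c \<oplus>\<^bsub>?A\<^esub> b \<otimes>\<^bsub>?A\<^esub> c"
      "c \<otimes>\<^bsub>?A\<^esub> (a \<oplus>\<^bsub>?A\<^esub> b) = c \<otimes>\<^bsub>?A\<^esub> a \<oplus>\<^bsub>?A\<^esub> c \<otimes>\<^bsub>?A\<^esub> b"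
      by (auto simp: fun_eq_iff alt add algebra_simps simp flip: sum.distrib intro!: sum.cong)
  qed
qed

lemma left_module_trans_module:
  assumes "monoid G" and fin: "finite (carrier G)" and fin\<Omega>: "finite \<Omega>"
    and maps: "carrier G \<subseteq> \<Omega> \<rightarrow>\<^sub>E \<Omega>"
    and mult: "\<And>f g. f \<in> carrier G \<Longrightarrow> g \<in> carrier G \<Longrightarrow> f \<otimes>\<^bsub>G\<^esub> g = compose \<Omega> f g"
    and one: "\<one>\<^bsub>G\<^esub> = (\<lambda>x\<in>\<Omega>. x)"
  shows "left_module (monoid_algebra G) (trans_module \<Omega> G)"
    and "submodule (augmentation \<Omega>) (monoid_algebra G) (trans_module \<Omega> G)"
    and "left_module (monoid_algebra G) (aug_module \<Omega> G)"
proof -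
  interpret monoid G by fact
  let ?A = "monoid_algebra G" and ?V = "trans_module \<Omega> G"
  interpret A: ring ?A by (rule ring_monoid_algebra[OF assms(1) fin])
  have act: "(a \<odot>\<^bsub>?V\<^esub> x) w = (\<Sum>f\<in>carrier G. \<Sum>v\<in>\<Omega>. if f v = w then a f * x v else 0)" for a x w
    by (simp add: trans_module_def sum_distrib_left fin\<Omega> sum.inter_filter
        if_distrib[where f = "(*) _"] cong: if_cong)
  have inO: "f v \<in> \<Omega>" if "f \<in> carrier G" "v \<in> \<Omega>" for f v
    using maps that by auto
  have car: "x \<in> carrier ?V \<longleftrightarrow> (\<forall>w. w \<notin> \<Omega> \<longrightarrow> x w = 0)" for x
    by (simp add: trans_module_def lin_comb_def)
  have closed: "a \<odot>\<^bsub>?V\<^esub> x \<in> carrier ?V" for a x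
    unfolding car act using inO by (auto intro!: sum.neutral)
  have ab: "abelian_group ?V"
  proof (rule abelian_groupI)
    fix x assume "x \<in> carrier ?V"
    then show "\<exists>y\<in>carrier ?V. y \<oplus>\<^bsub>?V\<^esub> x = \<zero>\<^bsub>?V\<^esub>"
      by (intro bexI[of _ "\<lambda>f. - x f"]) (auto simp: trans_module_def lin_comb_def)
  qed (auto simp: trans_module_def lin_comb_def fun_eq_iff algebra_simps)
  have add: "(x \<oplus>\<^bsub>?V\<^esub> y) w = x w + y w" for x y w by (simp add: trans_module_def)
  have oneA: "\<one>\<^bsub>?A\<^esub> f = (if f = \<one>\<^bsub>G\<^esub> then 1 else 0)" for f
    by (simp add: monoid_algebra_def)
  have addA: "(x \<oplus>\<^bsub>?A\<^esub> y) w = x w + y w" for x y w by (simp add: monoid_algebra_def)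
  have multA: "(a \<otimes>\<^bsub>?A\<^esub> b) h =
      (\<Sum>f\<in>carrier G. \<Sum>g\<in>carrier G. if f \<otimes>\<^bsub>G\<^esub> g = h then a f * b g else 0)" for a b h
    unfolding monoid_algebra_def
    by (simp add: sum.cartesian_product fin)
       (rule sum.mono_neutral_cong_left, auto simp: fin split: if_splits)
  show mod: "left_module ?A ?V"
  proof (intro left_module.intro left_module_axioms.intro ab A.ring_axioms closed)
    fix a b x y
    show "(a \<oplus>\<^bsub>?A\<^esub> b) \<odot>\<^bsub>?V\<^esub> x = a \<odot>\<^bsub>?V\<^esub> x \<oplus>\<^bsub>?V\<^esub> b \<odot>\<^bsub>?V\<^esub> x"
      "a \<odot>\<^bsub>?V\<^esub> (x \<oplus>\<^bsub>?V\<^esub> y) = a \<odot>\<^bsub>?V\<^esub> x \<oplus>\<^bsub>?V\<^esub> a \<odot>\<^bsub>?V\<^esub> y"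
      by (auto simp: fun_eq_iff act add addA algebra_simps simp flip: sum.distrib intro!: sum.cong)
  next
    fix a b x
    let ?S = "carrier G"
    show "(a \<otimes>\<^bsub>?A\<^esub> b) \<odot>\<^bsub>?V\<^esub> x = a \<odot>\<^bsub>?V\<^esub> (b \<odot>\<^bsub>?V\<^esub> x)"
    proof
      fix w
      let ?t = "\<lambda>f g v. if f (g v) = w then a f * b g * x v else 0"
      have "((a \<otimes>\<^bsub>?A\<^esub> b) \<odot>\<^bsub>?V\<^esub> x) w =
        (\<Sum>h\<in>?S. \<Sum>v\<in>\<Omega>. \<Sum>f\<in>?S. \<Sum>g\<in>?S. if f \<otimes>\<^bsub>G\<^esub> g = h then ?t f g v else 0)"
        unfolding act multA
        by (intro sum.cong refl)
           (auto simp: sum_distrib_right mult compose_def intro!: sum.cong sum.neutral)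
      also have "\<dots> = (\<Sum>v\<in>\<Omega>. \<Sum>f\<in>?S. \<Sum>g\<in>?S. \<Sum>h\<in>?S. if f \<otimes>\<^bsub>G\<^esub> g = h then ?t f g v else 0)"
        by (rule sum_rot4)
      also have "\<dots> = (\<Sum>v\<in>\<Omega>. \<Sum>f\<in>?S. \<Sum>g\<in>?S. ?t f g v)"
        by (intro sum.cong refl) (simp add: fin)
      also have "\<dots> = (\<Sum>f\<in>?S. \<Sum>g\<in>?S. \<Sum>v\<in>\<Omega>. ?t f g v)"
        by (rule sum_rot3)
      also have "\<dots> = (\<Sum>f\<in>?S. \<Sum>g\<in>?S. \<Sum>v\<in>\<Omega>. \<Sum>u\<in>\<Omega>. if g v = u then ?t f g v else 0)"
        by (intro sum.cong refl) (simp add: fin\<Omega> inO)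
      also have "\<dots> = (\<Sum>f\<in>?S. \<Sum>u\<in>\<Omega>. \<Sum>g\<in>?S. \<Sum>v\<in>\<Omega>. if g v = u then ?t f g v else 0)"
        by (rule sum.cong[OF refl], rule sum_rot3[symmetric])
      also have "\<dots> = (a \<odot>\<^bsub>?V\<^esub> (b \<odot>\<^bsub>?V\<^esub> x)) w"
        unfolding act
        by (intro sum.cong refl) (auto simp: sum_distrib_left mult.assoc intro!: sum.cong sum.neutral)
      finally show "((a \<otimes>\<^bsub>?A\<^esub> b) \<odot>\<^bsub>?V\<^esub> x) w = (a \<odot>\<^bsub>?V\<^esub> (b \<odot>\<^bsub>?V\<^esub> x)) w" .
    qed
  next
    fix x assume x: "x \<in> carrier ?V"
    show "\<one>\<^bsub>?A\<^esub> \<odot>\<^bsub>?V\<^esub> x = x"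
    proof
      fix w
      have "(\<one>\<^bsub>?A\<^esub> \<odot>\<^bsub>?V\<^esub> x) w =
        (\<Sum>f\<in>carrier G. if f = \<one>\<^bsub>G\<^esub> then \<Sum>v\<in>\<Omega>. if v = w then x v else 0 else 0)"
        unfolding act by (intro sum.cong refl) (auto simp: oneA one intro!: sum.cong sum.neutral)
      also have "\<dots> = x w"
        using x by (auto simp: fin fin\<Omega> car)
      finally show "(\<one>\<^bsub>?A\<^esub> \<odot>\<^bsub>?V\<^esub> x) w = x w" .
    qed
  qed
  have sum_act: "(\<Sum>w\<in>\<Omega>. (a \<odot>\<^bsub>?V\<^esub> x) w) = (\<Sum>f\<in>carrier G. a f) * (\<Sum>v\<in>\<Omega>. x v)" for a x
  proof -
    have "(\<Sum>w\<in>\<Omega>. (a \<odot>\<^bsub>?V\<^esub> x) w) =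
        (\<Sum>f\<in>carrier G. \<Sum>v\<in>\<Omega>. \<Sum>w\<in>\<Omega>. if f v = w then a f * x v else 0)"
      unfolding act
      by (rule sum_rot3)
    also have "\<dots> = (\<Sum>f\<in>carrier G. \<Sum>v\<in>\<Omega>. a f * x v)"
      by (intro sum.cong refl) (simp add: fin\<Omega> inO)
    finally show ?thesis by (simp add: sum_product)
  qed
  interpret V: abelian_group ?V by (rule ab)
  have aug_car: "augmentation \<Omega> \<subseteq> carrier ?V"
    by (auto simp: augmentation_def trans_module_def)
  have minus: "\<ominus>\<^bsub>?V\<^esub> x = (\<lambda>w. - x w)" if "x \<in> carrier ?V" for x
    by (rule V.minus_equality) (use that in \<open>auto simp: trans_module_def lin_comb_def\<close>)
  show aug: "submodule (augmentation \<Omega>) ?A ?V"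
  proof (intro submodule.intro submodule_axioms.intro group.subgroupI[OF V.a_group])
    show "augmentation \<Omega> \<subseteq> carrier (add_monoid ?V)" using aug_car by simp
    have "(\<lambda>_. 0) \<in> augmentation \<Omega>" by (simp add: augmentation_def lin_comb_def)
    then show "augmentation \<Omega> \<noteq> {}" by blast
  next
    fix x assume "x \<in> augmentation \<Omega>"
    then show "inv\<^bsub>add_monoid ?V\<^esub> x \<in> augmentation \<Omega>"
      using minus[of x] aug_car
      by (auto simp: a_inv_def[symmetric] augmentation_def lin_comb_def sum_negf)
  next
    fix x y assume "x \<in> augmentation \<Omega>" "y \<in> augmentation \<Omega>"
    then show "x \<otimes>\<^bsub>add_monoid ?V\<^esub> y \<in> augmentation \<Omega>"
      by (auto simp: augmentation_def lin_comb_def add sum.distrib)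
  next
    fix a x assume "x \<in> augmentation \<Omega>"
    then show "a \<odot>\<^bsub>?V\<^esub> x \<in> augmentation \<Omega>"
      using closed[of a x] sum_act[of a x] by (simp add: augmentation_def lin_comb_def car)
  qed
  show "left_module ?A (aug_module \<Omega> G)"
    unfolding aug_module_def by (rule left_module.left_module_submodule[OF mod aug])
qed


section \<open>The monoid construction\<close>

definition kernel_partition :: "'a set \<Rightarrow> ('a \<Rightarrow> 'b) \<Rightarrow> 'a set set" where
  "kernel_partition \<Omega> f = (\<lambda>w. {x \<in> \<Omega>. f x = w}) ` (f ` \<Omega>)"

text \<open>Self-maps of \<open>\<Omega>\<close> are extensional functions, so that distinct elements of the monoid are
  distinct maps on \<open>\<Omega>\<close>.\<close>

definition trans_monoid :: "'a set \<Rightarrow> 'a set set set \<Rightarrow> 'a set set \<Rightarrow> ('a \<Rightarrow> 'a) monoid" where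
  "trans_monoid \<Omega> \<B> \<I> =
     \<lparr>carrier = {f \<in> \<Omega> \<rightarrow>\<^sub>E \<Omega>. kernel_partition \<Omega> f \<in> \<B> \<and> f ` \<Omega> \<in> \<I>}
                \<union> {\<lambda>x\<in>\<Omega>. x} \<union> (\<lambda>c. \<lambda>x\<in>\<Omega>. c) ` \<Omega>,
      mult = compose \<Omega>,
      one = (\<lambda>x\<in>\<Omega>. x)\<rparr>"

definition J_minimal_compatible :: "'a set set set \<Rightarrow> 'a set set \<Rightarrow> bool" where
  "J_minimal_compatible \<B> \<I> \<longleftrightarrow>
     (\<forall>\<pi>\<in>\<B>. \<forall>I\<in>\<I>. (\<exists>b\<in>\<pi>. I \<subseteq> b) \<or> (\<forall>b\<in>\<pi>. card (I \<inter> b) = 1))"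

text \<open>The compatibility condition is what makes the set of maps closed under composition.\<close>

lemma trans_monoid_is_monoid:
  assumes part: "\<And>\<pi>. \<pi> \<in> \<B> \<Longrightarrow> \<Union>\<pi> = \<Omega>"
    and sub: "\<And>I. I \<in> \<I> \<Longrightarrow> I \<subseteq> \<Omega>"
    and compat: "J_minimal_compatible \<B> \<I>"
  shows "monoid (trans_monoid \<Omega> \<B> \<I>)"
proof -
  let ?A = "{f \<in> \<Omega> \<rightarrow>\<^sub>E \<Omega>. kernel_partition \<Omega> f \<in> \<B> \<and> f ` \<Omega> \<in> \<I>}"
  let ?K = "(\<lambda>c. \<lambda>x\<in>\<Omega>. c) ` \<Omega>"
  let ?M = "?A \<union> {\<lambda>x\<in>\<Omega>. x} \<union> ?K"
  have PiE: "f \<in> \<Omega> \<rightarrow>\<^sub>E \<Omega>" if "f \<in> ?M" for f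
    using that by auto
  have closed: "compose \<Omega> f g \<in> ?M" if f: "f \<in> ?M" and g: "g \<in> ?M" for f g
  proof -
    have fE: "f \<in> \<Omega> \<rightarrow>\<^sub>E \<Omega>" and gE: "g \<in> \<Omega> \<rightarrow>\<^sub>E \<Omega>"
      using PiE f g by blast+
    consider "f = (\<lambda>x\<in>\<Omega>. x)" | "g = (\<lambda>x\<in>\<Omega>. x)" | c where "c \<in> \<Omega>" "f = (\<lambda>x\<in>\<Omega>. c)"
      | c where "c \<in> \<Omega>" "g = (\<lambda>x\<in>\<Omega>. c)" | "f \<in> ?A" "g \<in> ?A"
      using f g by blast
    then show ?thesis
    proof cases
      case 1
      then have "compose \<Omega> f g = g"
        using gE by (auto intro: Id_compose simp: PiE_def)
      with g show ?thesis by simp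
    next
      case 2
      then have "compose \<Omega> f g = f"
        using fE by (auto intro: compose_Id simp: PiE_def)
      with f show ?thesis by simp
    next
      case 3
      then have "compose \<Omega> f g = (\<lambda>x\<in>\<Omega>. c)"
        using gE by (auto simp: compose_def fun_eq_iff)
      with 3 show ?thesis by blast
    next
      case 4
      then have "compose \<Omega> f g = (\<lambda>x\<in>\<Omega>. f c)" "f c \<in> \<Omega>"
        using fE by (auto simp: compose_def fun_eq_iff)
      then show ?thesis by blast
    next
      case 5
      let ?h = "compose \<Omega> f g"
      have hE: "?h \<in> \<Omega> \<rightarrow>\<^sub>E \<Omega>"
        using fE gE by (auto simp: compose_def)
      have im: "?h ` \<Omega> = f ` (g ` \<Omega>)"
        by (auto simp: compose_def)
      from compat 5 have "(\<exists>b\<in>kernel_partition \<Omega> f. g ` \<Omega> \<subseteq> b) \<or>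
          (\<forall>b\<in>kernel_partition \<Omega> f. card (g ` \<Omega> \<inter> b) = 1)"
        unfolding J_minimal_compatible_def by blast
      then show ?thesis
      proof
        assume "\<exists>b\<in>kernel_partition \<Omega> f. g ` \<Omega> \<subseteq> b"
        then obtain c where c: "c \<in> f ` \<Omega>" "g ` \<Omega> \<subseteq> {x \<in> \<Omega>. f x = c}"
          by (auto simp: kernel_partition_def)
        then have "?h = (\<lambda>x\<in>\<Omega>. c)"
          by (auto simp: compose_def fun_eq_iff)
        moreover have "c \<in> \<Omega>" using c(1) fE by auto
        ultimately show ?thesis by blast
      next
        assume one: "\<forall>b\<in>kernel_partition \<Omega> f. card (g ` \<Omega> \<inter> b) = 1"
        have one': "\<exists>y. g ` \<Omega> \<inter> {x \<in> \<Omega>. f x = w} = {y}" if "w \<in> f ` \<Omega>" for w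
          using one that by (auto simp: kernel_partition_def card_1_singleton_iff)
        have inj: "inj_on f (g ` \<Omega>)"
        proof (rule inj_onI)
          fix x y assume x: "x \<in> g ` \<Omega>" and y: "y \<in> g ` \<Omega>" and xy: "f x = f y"
          have mem: "x \<in> \<Omega>" "y \<in> \<Omega>" using x y gE by auto
          then obtain z where "g ` \<Omega> \<inter> {v \<in> \<Omega>. f v = f x} = {z}" using one' by blast
          moreover have "x \<in> g ` \<Omega> \<inter> {v \<in> \<Omega>. f v = f x}" "y \<in> g ` \<Omega> \<inter> {v \<in> \<Omega>. f v = f x}"
            using x y xy mem by auto
          ultimately show "x = y" by (metis singletonD)
        qed
        have "f ` \<Omega> \<subseteq> f ` (g ` \<Omega>)"
        proof
          fix w assume "w \<in> f ` \<Omega>"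
          then obtain z where "g ` \<Omega> \<inter> {v \<in> \<Omega>. f v = w} = {z}" using one' by blast
          then have "z \<in> g ` \<Omega>" "f z = w" by blast+
          then show "w \<in> f ` (g ` \<Omega>)" by blast
        qed
        then have im': "?h ` \<Omega> = f ` \<Omega>"
          unfolding im using gE by auto
        have "{x \<in> \<Omega>. ?h x = f v} = {x \<in> \<Omega>. g x = v}" if "v \<in> g ` \<Omega>" for v
          using inj that by (auto simp: compose_def inj_on_def)
        then have "kernel_partition \<Omega> ?h = kernel_partition \<Omega> g"
          unfolding kernel_partition_def im image_image[of _ f "g ` \<Omega>"] by (intro image_cong) auto
        then show ?thesis using hE im' 5 by auto
      qed
    qed
  qed
  show ?thesis
  proof (rule monoidI)
    fix f g h
    assume "h \<in> carrier (trans_monoid \<Omega> \<B> \<I>)"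
    then have "h \<in> \<Omega> \<rightarrow> \<Omega>" using PiE[of h] by (auto simp: trans_monoid_def)
    then show "f \<otimes>\<^bsub>trans_monoid \<Omega> \<B> \<I>\<^esub> g \<otimes>\<^bsub>trans_monoid \<Omega> \<B> \<I>\<^esub> h =
        f \<otimes>\<^bsub>trans_monoid \<Omega> \<B> \<I>\<^esub> (g \<otimes>\<^bsub>trans_monoid \<Omega> \<B> \<I>\<^esub> h)"
      by (simp add: trans_monoid_def compose_assoc)
  next
    fix f assume "f \<in> carrier (trans_monoid \<Omega> \<B> \<I>)"
    then have "f \<in> \<Omega> \<rightarrow>\<^sub>E \<Omega>" using PiE[of f] by (simp add: trans_monoid_def)
    then show "\<one>\<^bsub>trans_monoid \<Omega> \<B> \<I>\<^esub> \<otimes>\<^bsub>trans_monoid \<Omega> \<B> \<I>\<^esub> f = f"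
      "f \<otimes>\<^bsub>trans_monoid \<Omega> \<B> \<I>\<^esub> \<one>\<^bsub>trans_monoid \<Omega> \<B> \<I>\<^esub> = f"
      by (auto simp: trans_monoid_def PiE_def intro: Id_compose compose_Id)
  qed (use closed in \<open>auto simp: trans_monoid_def\<close>)
qed


section \<open>The set and the families\<close>

datatype omega = J nat | P nat | C nat nat

text \<open>The representative of \<open>i\<close> modulo \<open>r\<close> in \<open>{1..r}\<close>; in particular \<open>idx r 0 = r\<close>.\<close>

definition idx :: "nat \<Rightarrow> nat \<Rightarrow> nat" where
  "idx r i = (if i mod r = 0 then r else i mod r)"

definition Omega :: "nat \<Rightarrow> omega set" where
  "Omega r = J ` {1..r} \<union> P ` {1..r} \<union> {C i s |i s. i \<in> {1..r} \<and> s \<in> {1..r-3}}"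

definition E_set :: "nat \<Rightarrow> nat \<Rightarrow> omega set" where
  "E_set r i = {J (idx r (i - 1)), P i, J i} \<union> {C i s |s. s \<in> {1..r-3}}"

definition C_set :: "nat \<Rightarrow> nat \<Rightarrow> omega set" where
  "C_set r s = {C i s |i. i \<in> {1..r}}"

definition I_fam :: "nat \<Rightarrow> omega set set" where
  "I_fam r = E_set r ` {1..r} \<union> C_set r ` {1..r-3}"

text \<open>The cell in row \<open>q\<close> and column \<open>t\<close> (\<open>1 \<le> q, t \<le> r - 1\<close>) of the table for \<open>j\<close>;
  \<^const>\<open>None\<close> is a blank cell.\<close>

definition cell :: "nat \<Rightarrow> nat \<Rightarrow> nat \<Rightarrow> nat \<Rightarrow> omega option" where
  "cell r j q t =
     (let i = idx r (j + t) in
      if q \<le> r - 3 then Some (C i q)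
      else if odd r then
        (if odd t then (if q = r - 2 then Some (P i) else Some (J i))
         else (if q = r - 2 then None else Some (P i)))
      else
        (if t = r - 1 then (if q = r - 2 then None else Some (P i))
         else if t = r - 2 then (if q = r - 2 then None else Some (J i))
         else if odd t then (if q = r - 2 then Some (P i) else Some (J i))
         else (if q = r - 2 then None else Some (P i))))"

definition diag_block :: "nat \<Rightarrow> nat \<Rightarrow> nat \<Rightarrow> omega set" where
  "diag_block r j d =
     {x. \<exists>q\<in>{1..r-1}. \<exists>t\<in>{1..r-1}. (q + t) mod (r - 1) = d \<and> cell r j q t = Some x}"

definition first_block :: "nat \<Rightarrow> nat \<Rightarrow> omega set" where
  "first_block r j =
     (if odd r then E_set r j \<union> {J (idx r (j + k)) |k. even k \<and> 2 \<le> k \<and> k \<le> r - 3}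
      else E_set r j \<union> {J (idx r (j + k)) |k. even k \<and> 2 \<le> k \<and> k \<le> r - 4}
             \<union> {P (idx r (j + (r - 2)))})"

definition B_part :: "nat \<Rightarrow> nat \<Rightarrow> omega set set" where
  "B_part r j = {first_block r j} \<union> diag_block r j ` {0..<r-1}"

definition B_star :: "nat \<Rightarrow> omega set set" where
  "B_star r = C_set r ` {1..r-3} \<union>
     (if odd r then
        {{J r, P (r - 1)} \<union> {J i |i. even i \<and> 2 \<le> i \<and> i \<le> r - 3},
         {P r} \<union> {J i |i. odd i \<and> 1 \<le> i \<and> i \<le> r - 2},
         {J (r - 1)} \<union> {P i |i. 1 \<le> i \<and> i \<le> r - 2}}
      else
        {{J 2, P 1, P 4} \<union> {J i |i. odd i \<and> 5 \<le> i \<and> i \<le> r - 1},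
         {J 3, P 2, P 5} \<union> {J i |i. even i \<and> 6 \<le> i \<and> i \<le> r},
         {J 1, J 4, P 3} \<union> {P i |i. 6 \<le> i \<and> i \<le> r}})"

definition B_fam :: "nat \<Rightarrow> omega set set set" where
  "B_fam r = B_part r ` {1..r-1} \<union> {B_star r}"

definition B_fam' :: "nat \<Rightarrow> omega set set set" where
  "B_fam' r = B_part r ` {1..r}"

end

theory Submission
  imports Defs
begin

text \<open>
  A vector is moved by a rank-\<open>r\<close> map only through its block sums. If some block sum of a vector of
  the augmentation is nonzero, then two block sums of the same partition differ, and exchanging two
  image points produces the difference of two basis vectors lying in a common member of the image
  family. As the sets \<open>E_set r i\<close> overlap in a chain, such differences span the augmentation. So the
  augmentation is simple iff the block sums separate its elements.

  Every block of every \<open>B_part r j\<close> meets each \<open>C_set r s\<close> exactly once, so the block sums of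
  \<open>B_fam' r\<close> do not separate \<open>C_set r 1\<close> from \<open>C_set r 2\<close>. For \<open>B_fam r\<close>, comparing
  the diagonal blocks of consecutive \<open>B_part r j\<close> yields linear recurrences: the coefficients at
  \<open>P 1, \<dots>, P (r - 1)\<close> deviate from a constant by a sequence \<open>h\<close> with \<open>h (i + 2) = - h i\<close>. The
  blocks of \<open>B_star r\<close> force \<open>h\<close> to vanish; then the coefficients at \<open>C i s\<close> are constant for
  \<open>i < r\<close>, and the remaining equations leave only the zero vector.
\<close>

section \<open>Partitions as fibres of a labelling\<close>

text \<open>Partitions are encoded by labelling functions: a block becomes a fibre, compatibility
  becomes a statement about the labels of an image set, and the parity-dependent tables become
  arithmetic in the offset of an index from \<open>j\<close> modulo \<open>r\<close>. Trading
  \<open>B_part r r\<close> for \<open>B_star r\<close> has a price: \<open>j\<close> stops at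
  \<open>r - 1\<close>, so the comparisons of consecutive tables do not close up cyclically. They
  control the coefficients whose index is below \<open>r\<close>; those with index \<open>r\<close>
  have to be recovered from individual block sums. The sign in \<open>h (i + 2) = - h i\<close>
  arises because two different comparisons express the coefficient at \<open>J i\<close> through
  those at \<open>P\<close>, once with the indices \<open>i\<close> and \<open>i + 2\<close>, once
  with \<open>i - 1\<close> and \<open>i + 1\<close>. A sequence of this kind has period 4 and two
  free parameters, so the equations that eliminate them have to be solved separately for each
  residue of \<open>r\<close> modulo 4.\<close>

definition fibres :: "'a set \<Rightarrow> nat \<Rightarrow> ('a \<Rightarrow> nat) \<Rightarrow> 'a set set" where
  "fibres \<Omega> n L = (\<lambda>l. {x \<in> \<Omega>. L x = l}) ` {..<n}"

text \<open>An injective relabelling merges no fibres, so the kernel does not depend on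
  \<open>\<sigma>\<close>. Hence one partition and one image set yield a monoid element for every
  bijection from blocks to image points.\<close>

lemma kernel_partition_label:
  assumes L: "L ` \<Omega> = {..<n}" and \<sigma>: "inj_on \<sigma> {..<n}"
  shows "kernel_partition \<Omega> (\<lambda>v\<in>\<Omega>. \<sigma> (L v)) = fibres \<Omega> n L"
    and "(\<lambda>v\<in>\<Omega>. \<sigma> (L v)) ` \<Omega> = \<sigma> ` {..<n}"
proof -
  show im: "(\<lambda>v\<in>\<Omega>. \<sigma> (L v)) ` \<Omega> = \<sigma> ` {..<n}"
    by (simp add: image_image flip: L)
  have "{x \<in> \<Omega>. \<sigma> (L x) = \<sigma> l} = {x \<in> \<Omega>. L x = l}" if "l < n" for l
    using that L inj_onD[OF \<sigma>] by (auto simp: set_eq_iff)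
  then show "kernel_partition \<Omega> (\<lambda>v\<in>\<Omega>. \<sigma> (L v)) = fibres \<Omega> n L"
    unfolding kernel_partition_def im fibres_def image_image by (intro image_cong) auto
qed

text \<open>Any bijection between the complements of the two pairs extends by the prescribed values.
  \<open>delta_in_orbit\<close> uses it to send two chosen blocks to two chosen points.\<close>

lemma bij_betw_prescribed:
  assumes "finite A" "finite B" "card A = card B"
    and "a \<in> A" "a' \<in> A" "a \<noteq> a'" "b \<in> B" "b' \<in> B" "b \<noteq> b'"
  obtains \<sigma> where "bij_betw \<sigma> A B" "\<sigma> a = b" "\<sigma> a' = b'"
proof -
  have "card (A - {a, a'}) = card (B - {b, b'})"
    using assms by (simp add: card_Diff_subset)
  then obtain \<tau> where \<tau>: "bij_betw \<tau> (A - {a, a'}) (B - {b, b'})"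
    using assms finite_same_card_bij by blast
  define \<sigma> where "\<sigma> = \<tau>(a := b, a' := b')"
  have "bij_betw \<sigma> (A - {a, a'}) (B - {b, b'})"
    using \<tau> by (subst bij_betw_cong[where g = \<tau>]) (auto simp: \<sigma>_def)
  moreover have "bij_betw \<sigma> {a, a'} {b, b'}"
    using assms by (auto simp: \<sigma>_def bij_betw_def)
  ultimately have "bij_betw \<sigma> ((A - {a, a'}) \<union> {a, a'}) ((B - {b, b'}) \<union> {b, b'})"
    by (rule bij_betw_combine) auto
  moreover have "(A - {a, a'}) \<union> {a, a'} = A" "(B - {b, b'}) \<union> {b, b'} = B"
    using assms by auto
  ultimately have "bij_betw \<sigma> A B"
    by simp
  then show thesis
    using that assms by (auto simp: \<sigma>_def)
qed

section \<open>Simplicity of the augmentation in terms of block sums\<close>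

definition delta :: "'a \<Rightarrow> 'a \<Rightarrow> 'a \<Rightarrow> complex" where
  "delta p q = (\<lambda>w. of_bool (w = p) - of_bool (w = q))"

text \<open>In \<open>compat\<close>, meeting all labels stands for being a transversal: as
  \<open>I\<close> has exactly \<open>n\<close> elements, a labelling that maps it onto
  \<open>n\<close> labels is injective on it. For concrete labellings only surjectivity has to be
  checked.\<close>

locale fibre_monoid =
  fixes \<Omega> :: "'a set" and n :: nat and \<L> :: "('a \<Rightarrow> nat) set" and \<I> :: "'a set set"
  assumes fin: "finite \<Omega>"
    and surj: "L \<in> \<L> \<Longrightarrow> L ` \<Omega> = {..<n}"
    and image_sub: "I \<in> \<I> \<Longrightarrow> I \<subseteq> \<Omega>"
    and image_card: "I \<in> \<I> \<Longrightarrow> card I = n"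
    and compat: "L \<in> \<L> \<Longrightarrow> I \<in> \<I> \<Longrightarrow> (\<exists>l<n. L ` I \<subseteq> {l}) \<or> {..<n} \<subseteq> L ` I"
begin

definition G :: "('a \<Rightarrow> 'a) monoid" where
  "G = trans_monoid \<Omega> (fibres \<Omega> n ` \<L>) \<I>"

abbreviation bsum :: "('a \<Rightarrow> nat) \<Rightarrow> ('a \<Rightarrow> complex) \<Rightarrow> nat \<Rightarrow> complex" where
  "bsum L x l \<equiv> \<Sum>v\<in>{v \<in> \<Omega>. L v = l}. x v"

lemma carrier_G: "carrier G = {f \<in> \<Omega> \<rightarrow>\<^sub>E \<Omega>. kernel_partition \<Omega> f \<in> fibres \<Omega> n ` \<L> \<and> f ` \<Omega> \<in> \<I>}
    \<union> {\<lambda>x\<in>\<Omega>. x} \<union> (\<lambda>c. \<lambda>x\<in>\<Omega>. c) ` \<Omega>"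
  by (simp add: G_def trans_monoid_def)

lemma G_maps: "carrier G \<subseteq> \<Omega> \<rightarrow>\<^sub>E \<Omega>"
  unfolding carrier_G by auto

lemma finite_G: "finite (carrier G)"
  using fin finite_PiE[of \<Omega> "\<lambda>_. \<Omega>"] G_maps finite_subset by blast

lemma transversal:
  assumes L: "L \<in> \<L>" and I: "I \<in> \<I>" and sub: "{..<n} \<subseteq> L ` I" and l: "l < n"
  shows "\<exists>x. I \<inter> {x \<in> \<Omega>. L x = l} = {x}"
proof -
  have "L ` I \<subseteq> {..<n}" using surj[OF L] image_sub[OF I] by blast
  with sub have eq: "L ` I = {..<n}" by blast
  have "finite I" using fin image_sub[OF I] finite_subset by blast
  then have inj: "inj_on L I"
    using eq image_card[OF I] by (intro eq_card_imp_inj_on) auto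
  obtain x where x: "x \<in> I" "L x = l" using eq l by (metis imageE lessThan_iff)
  have "I \<inter> {x \<in> \<Omega>. L x = l} = {x}"
    using x image_sub[OF I] inj by (auto dest: inj_onD)
  then show ?thesis by blast
qed

lemma J_minimal: "J_minimal_compatible (fibres \<Omega> n ` \<L>) \<I>"
  unfolding J_minimal_compatible_def
proof (intro ballI)
  fix \<pi> I assume "\<pi> \<in> fibres \<Omega> n ` \<L>" and I: "I \<in> \<I>"
  then obtain L where L: "L \<in> \<L>" and \<pi>: "\<pi> = fibres \<Omega> n L" by blast
  from compat[OF L I] show "(\<exists>b\<in>\<pi>. I \<subseteq> b) \<or> (\<forall>b\<in>\<pi>. card (I \<inter> b) = 1)"
  proof
    assume "\<exists>l<n. L ` I \<subseteq> {l}"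
    then obtain l where "l < n" "L ` I \<subseteq> {l}" by blast
    then have "I \<subseteq> {x \<in> \<Omega>. L x = l}" using image_sub[OF I] by auto
    then show ?thesis using \<open>l < n\<close> by (auto simp: \<pi> fibres_def)
  next
    assume "{..<n} \<subseteq> L ` I"
    from transversal[OF L I this] show ?thesis
      by (auto simp: \<pi> fibres_def card_1_singleton_iff)
  qed
qed

lemma monoid_G: "monoid G"
  unfolding G_def
proof (rule trans_monoid_is_monoid[OF _ image_sub J_minimal])
  fix \<pi> assume "\<pi> \<in> fibres \<Omega> n ` \<L>"
  then obtain L where "L \<in> \<L>" "\<pi> = fibres \<Omega> n L" by blast
  then show "\<Union>\<pi> = \<Omega>" using surj[of L] by (auto simp: fibres_def)
qed

lemma left_module_aug: "left_module (monoid_algebra G) (aug_module \<Omega> G)"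
  by (rule left_module_trans_module(3)[OF monoid_G finite_G fin G_maps])
     (auto simp: G_def trans_monoid_def)

lemma aug_sel:
  "carrier (aug_module \<Omega> G) = augmentation \<Omega>"
  "\<zero>\<^bsub>aug_module \<Omega> G\<^esub> = (\<lambda>_. 0)"
  "x \<oplus>\<^bsub>aug_module \<Omega> G\<^esub> y = (\<lambda>w. x w + y w)"
  "a \<odot>\<^bsub>aug_module \<Omega> G\<^esub> x = (\<lambda>w. \<Sum>f\<in>carrier G. a f * (\<Sum>v\<in>{v \<in> \<Omega>. f v = w}. x v))"
  by (simp_all add: aug_module_def trans_module_def)

lemma algebra_carrier: "carrier (monoid_algebra G) = lin_comb (carrier G)"
  by (simp add: monoid_algebra_def)

text \<open>The complex scalars sit in the monoid algebra as multiples of the identity map, so a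
  submodule over the algebra is a complex subspace.\<close>

lemma scalar_act:
  assumes "x \<in> lin_comb \<Omega>"
  shows "(\<lambda>g. if g = \<one>\<^bsub>G\<^esub> then c else 0) \<odot>\<^bsub>aug_module \<Omega> G\<^esub> x = (\<lambda>w. c * x w)"
proof -
  have one: "\<one>\<^bsub>G\<^esub> = (\<lambda>x\<in>\<Omega>. x)" "\<one>\<^bsub>G\<^esub> \<in> carrier G"
    by (auto simp: G_def trans_monoid_def)
  have id: "(\<Sum>v\<in>{v \<in> \<Omega>. (\<one>\<^bsub>G\<^esub>) v = w}. x v) = x w" for w
  proof (cases "w \<in> \<Omega>")
    case True
    then have "{v \<in> \<Omega>. (\<one>\<^bsub>G\<^esub>) v = w} = {w}" by (auto simp: one)
    then show ?thesis by simp
  next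
    case False
    then have "{v \<in> \<Omega>. (\<one>\<^bsub>G\<^esub>) v = w} = {}" "x w = 0" using assms by (auto simp: one lin_comb_def)
    then show ?thesis by (simp only: sum.empty)
  qed
  show ?thesis
    unfolding aug_sel using finite_G one(2) id
    by (simp add: if_distrib[where f = "\<lambda>a. a * _"] cong: if_cong)
qed

lemma delta_aug: "p \<in> \<Omega> \<Longrightarrow> q \<in> \<Omega> \<Longrightarrow> delta p q \<in> augmentation \<Omega>"
  using fin by (auto simp: augmentation_def lin_comb_def delta_def sum_subtractf of_bool_def)

lemma label_act:
  assumes L: "L \<in> \<L>" and \<sigma>: "inj_on \<sigma> {..<n}"
  shows "(\<Sum>v\<in>{v \<in> \<Omega>. (\<lambda>v\<in>\<Omega>. \<sigma> (L v)) v = w}. x v) = (\<Sum>l<n. of_bool (w = \<sigma> l) * bsum L x l)"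
proof -
  have "(\<Sum>v\<in>{v \<in> \<Omega>. (\<lambda>v\<in>\<Omega>. \<sigma> (L v)) v = w}. x v) = (\<Sum>v\<in>{v \<in> \<Omega>. \<sigma> (L v) = w}. x v)"
    by (intro sum.cong) auto
  also have "\<dots> = (\<Sum>l<n. \<Sum>v\<in>{v \<in> {v \<in> \<Omega>. \<sigma> (L v) = w}. L v = l}. x v)"
    using fin surj[OF L] by (intro sum.group[symmetric]) auto
  also have "\<dots> = (\<Sum>l<n. of_bool (w = \<sigma> l) * bsum L x l)"
  proof (rule sum.cong[OF refl])
    fix l
    have "{v \<in> {v \<in> \<Omega>. \<sigma> (L v) = w}. L v = l} = (if w = \<sigma> l then {v \<in> \<Omega>. L v = l} else {})"
      by auto
    then show "(\<Sum>v\<in>{v \<in> {v \<in> \<Omega>. \<sigma> (L v) = w}. L v = l}. x v) = of_bool (w = \<sigma> l) * bsum L x l"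
      by simp
  qed
  finally show ?thesis .
qed

text \<open>Take a map sending the blocks \<open>k, l\<close> to \<open>p, q\<close> and one sending them to \<open>q, p\<close> that agrees
  with it on the other blocks: the difference of the images of \<open>x\<close> is a nonzero multiple of
  \<open>delta p q\<close>.\<close>

lemma delta_in_orbit:
  assumes L: "L \<in> \<L>" and I: "I \<in> \<I>" and pq: "p \<in> I" "q \<in> I" "p \<noteq> q"
    and kl: "k < n" "l < n" "bsum L x k \<noteq> bsum L x l"
  obtains a where "a \<in> carrier (monoid_algebra G)" "a \<odot>\<^bsub>aug_module \<Omega> G\<^esub> x = delta p q"
proof -
  have finI: "finite I" using fin image_sub[OF I] finite_subset by blast
  have "k \<noteq> l" using kl by auto
  then obtain \<sigma> where \<sigma>: "bij_betw \<sigma> {..<n} I" "\<sigma> k = p" "\<sigma> l = q"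
    using bij_betw_prescribed[of "{..<n}" I k l p q] finI image_card[OF I] kl pq by auto
  define \<tau> where "\<tau> = \<sigma>(k := q, l := p)"
  have \<tau>: "\<tau> ` {..<n} = I"
    using \<sigma> kl pq \<open>k \<noteq> l\<close> by (auto simp: \<tau>_def bij_betw_def image_def)
  then have \<tau>: "inj_on \<tau> {..<n}" "\<tau> ` {..<n} = I"
    using image_card[OF I] by (auto intro: eq_card_imp_inj_on)
  have \<sigma>': "inj_on \<sigma> {..<n}" "\<sigma> ` {..<n} = I" using \<sigma>(1) by (auto simp: bij_betw_def)
  define f where "f \<rho> = (\<lambda>v\<in>\<Omega>. \<rho> (L v))" for \<rho> :: "nat \<Rightarrow> 'a"
  have mem: "f \<rho> \<in> carrier G" if "inj_on \<rho> {..<n}" "\<rho> ` {..<n} = I" for \<rho>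
  proof -
    have "f \<rho> ` \<Omega> = I" "kernel_partition \<Omega> (f \<rho>) = fibres \<Omega> n L"
      unfolding f_def using kernel_partition_label[OF surj[OF L] that(1)] that(2) by simp_all
    moreover have "f \<rho> \<in> \<Omega> \<rightarrow>\<^sub>E \<Omega>"
      using \<open>f \<rho> ` \<Omega> = I\<close> image_sub[OF I] by (auto simp: f_def)
    ultimately show ?thesis using L I by (simp add: carrier_G)
  qed
  obtain v where v: "v \<in> \<Omega>" "L v = k" using surj[OF L] kl(1) by (metis imageE lessThan_iff)
  have ne: "f \<sigma> \<noteq> f \<tau>"
  proof
    assume "f \<sigma> = f \<tau>"
    then have "f \<sigma> v = f \<tau> v" by simp
    then show False using v \<sigma> pq \<open>k \<noteq> l\<close> by (simp add: f_def \<tau>_def)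
  qed
  \<comment> \<open>The two images of \<open>x\<close> differ by
    \<open>bsum L x k - bsum L x l\<close> times \<open>delta p q\<close>; \<open>c\<close>
    normalises this factor to 1.\<close>
  define c where "c = 1 / (bsum L x k - bsum L x l)"
  define a where "a g = (if g = f \<sigma> then c else 0) + (if g = f \<tau> then - c else 0)" for g
  have "a \<in> carrier (monoid_algebra G)"
    using mem[OF \<sigma>'] mem[OF \<tau>] by (auto simp: algebra_carrier lin_comb_def a_def)
  moreover have "a \<odot>\<^bsub>aug_module \<Omega> G\<^esub> x = delta p q"
  proof
    fix w
    have "(a \<odot>\<^bsub>aug_module \<Omega> G\<^esub> x) w =
       c * (\<Sum>v\<in>{v \<in> \<Omega>. f \<sigma> v = w}. x v) - c * (\<Sum>v\<in>{v \<in> \<Omega>. f \<tau> v = w}. x v)"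
      unfolding aug_sel a_def using finite_G mem[OF \<sigma>'] mem[OF \<tau>]
      by (simp add: distrib_right sum.distrib if_distrib[where f = "\<lambda>a. a * _"] cong: if_cong)
    also have "\<dots> = c * (\<Sum>m<n. (of_bool (w = \<sigma> m) - of_bool (w = \<tau> m)) * bsum L x m)"
      unfolding f_def label_act[OF L \<sigma>'(1)] label_act[OF L \<tau>(1)]
      by (simp add: sum_subtractf left_diff_distrib right_diff_distrib)
    \<comment> \<open>\<open>\<sigma>\<close> and \<open>\<tau>\<close> agree outside
      \<open>k\<close> and \<open>l\<close>, so all other blocks cancel.\<close>
    also have "(\<Sum>m<n. (of_bool (w = \<sigma> m) - of_bool (w = \<tau> m)) * bsum L x m) =
       (\<Sum>m\<in>{k, l}. (of_bool (w = \<sigma> m) - of_bool (w = \<tau> m)) * bsum L x m)"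
      using kl by (intro sum.mono_neutral_right) (auto simp: \<tau>_def)
    also have "\<dots> = delta p q w * (bsum L x k - bsum L x l)"
      using \<open>k \<noteq> l\<close> \<sigma> by (simp add: \<tau>_def delta_def algebra_simps)
    finally show "(a \<odot>\<^bsub>aug_module \<Omega> G\<^esub> x) w = delta p q w"
      using kl by (simp add: c_def)
  qed
  ultimately show thesis by (rule that)
qed

lemma bsum_total:
  assumes "L \<in> \<L>"
  shows "(\<Sum>l<n. bsum L x l) = (\<Sum>v\<in>\<Omega>. x v)"
  using fin surj[OF assms] by (intro sum.group) auto

lemma simple_aug:
  assumes nontriv: "p0 \<in> \<Omega>" "q0 \<in> \<Omega>" "p0 \<noteq> q0"
    and sep: "\<And>x. x \<in> augmentation \<Omega> \<Longrightarrow> (\<And>L l. L \<in> \<L> \<Longrightarrow> l < n \<Longrightarrow> bsum L x l = 0) \<Longrightarrow>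
      x = (\<lambda>_. 0)"
    and conn: "\<And>w. w \<in> \<Omega> \<Longrightarrow> (p0, w) \<in> {(p, q). \<exists>I\<in>\<I>. p \<in> I \<and> q \<in> I}\<^sup>*"
  shows "simple_left_module (monoid_algebra G) (aug_module \<Omega> G)"
  unfolding simple_left_module_def
proof (intro conjI allI impI left_module_aug)
  have "delta p0 q0 \<noteq> (\<lambda>_. 0)"
    using nontriv by (auto simp: delta_def fun_eq_iff intro!: exI[of _ p0])
  then show "carrier (aug_module \<Omega> G) \<noteq> {\<zero>\<^bsub>aug_module \<Omega> G\<^esub>}"
    using delta_aug[OF nontriv(1,2)] unfolding aug_sel by blast
next
  fix N assume "submodule N (monoid_algebra G) (aug_module \<Omega> G)"
  then interpret N: submodule N "monoid_algebra G" "aug_module \<Omega> G" .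
  have sub: "N \<subseteq> augmentation \<Omega>" using N.subset by (simp add: aug_sel)
  have zero: "(\<lambda>_. 0) \<in> N"
    using N.one_closed by (simp add: aug_module_def trans_module_def)
  have add: "(\<lambda>w. x w + y w) \<in> N" if "x \<in> N" "y \<in> N" for x y
    using N.m_closed[OF that] by (simp add: aug_module_def trans_module_def)
  have scale: "(\<lambda>w. c * x w) \<in> N" if "x \<in> N" for c x
  proof -
    have "x \<in> lin_comb \<Omega>" using that sub by (auto simp: augmentation_def)
    moreover have "(\<lambda>g. if g = \<one>\<^bsub>G\<^esub> then c else 0) \<in> carrier (monoid_algebra G)"
      using monoid.one_closed[OF monoid_G] by (auto simp: algebra_carrier lin_comb_def)
    ultimately show ?thesis using N.smult_closed[OF _ that] scalar_act by metis
  qed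
  show "N = {\<zero>\<^bsub>aug_module \<Omega> G\<^esub>} \<or> N = carrier (aug_module \<Omega> G)"
  proof (cases "\<exists>x\<in>N. x \<noteq> (\<lambda>_. 0)")
    case False
    then have "N = {\<lambda>_. 0}" using zero by blast
    then show ?thesis by (simp add: aug_sel)
  next
    case True
    then obtain x where x: "x \<in> N" "x \<noteq> (\<lambda>_. 0)" by blast
    then obtain L k where L: "L \<in> \<L>" and k: "k < n" "bsum L x k \<noteq> 0"
      using sep[of x] sub by blast
    \<comment> \<open>If all block sums agreed, their total would be \<open>n\<close> times the
      nonzero \<open>bsum L x k\<close>; but the total is the coefficient sum, which vanishes on the
      augmentation.\<close>
    have "\<exists>l<n. bsum L x k \<noteq> bsum L x l"
    proof (rule ccontr)
      assume "\<not> ?thesis"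
      then have "\<And>l. l < n \<Longrightarrow> bsum L x l = bsum L x k" by simp
      then have "(\<Sum>l<n. bsum L x l) = (\<Sum>l<n. bsum L x k)" by simp
      then have "(\<Sum>l<n. bsum L x l) = of_nat n * bsum L x k" by simp
      moreover have "(\<Sum>l<n. bsum L x l) = 0"
        unfolding bsum_total[OF L] using x sub by (auto simp: augmentation_def)
      ultimately show False using k by simp
    qed
    then obtain l where l: "l < n" "bsum L x k \<noteq> bsum L x l" by blast
    have swap: "delta p q \<in> N" if "I \<in> \<I>" "p \<in> I" "q \<in> I" for I p q
    proof (cases "p = q")
      case True
      then show ?thesis using zero by (simp add: delta_def)
    next
      case False
      then show ?thesis using delta_in_orbit[OF L that False k(1) l] N.smult_closed[OF _ x(1)] by metis
    qed
    \<comment> \<open>Along a path of overlapping image sets the differences telescope: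
      \<open>delta w u\<close> plus \<open>delta u p0\<close> is \<open>delta w p0\<close>.\<close>
    have reach: "delta w p0 \<in> N" if "w \<in> \<Omega>" for w
      using conn[OF that]
    proof induction
      case base
      show ?case using zero by (simp add: delta_def)
    next
      case (step u w)
      then have "delta w u \<in> N" using swap by blast
      from add[OF this step.IH] show ?case by (simp add: delta_def)
    qed
    have "y \<in> N" if y: "y \<in> augmentation \<Omega>" for y
    proof -
      have "(\<lambda>w. \<Sum>u\<in>A. y u * delta u p0 w) \<in> N" if "A \<subseteq> \<Omega>" "finite A" for A
        using that(2,1)
      proof induction
        case empty
        then show ?case using zero by simp
      next
        case (insert u A)
        then show ?case using add[OF scale[OF reach[of u], of "y u"]] by simp
      qed
      then have "(\<lambda>w. \<Sum>u\<in>\<Omega>. y u * delta u p0 w) \<in> N" using fin by blast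
      \<comment> \<open>The copies of the basis vector at \<open>p0\<close> that are subtracted
        cancel in total, because the coefficients of \<open>y\<close> sum to zero.\<close>
      moreover have "(\<lambda>w. \<Sum>u\<in>\<Omega>. y u * delta u p0 w) = y"
      proof
        fix w
        have "(\<Sum>u\<in>\<Omega>. y u * delta u p0 w) =
            (\<Sum>u\<in>\<Omega>. if w = u then y u else 0) - (\<Sum>u\<in>\<Omega>. y u) * of_bool (w = p0)"
          by (simp add: delta_def right_diff_distrib sum_subtractf sum_distrib_right of_bool_def
              if_distrib[where f = "\<lambda>a. _ * a"] cong: if_cong)
        also have "\<dots> = y w"
          using y fin by (auto simp: augmentation_def lin_comb_def)
        finally show "(\<Sum>u\<in>\<Omega>. y u * delta u p0 w) = y w" .
      qed
      ultimately show ?thesis by simp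
    qed
    then show ?thesis using sub by (auto simp: aug_sel)
  qed
qed

text \<open>An element other than the identity either has its kernel among the given partitions or
  is constant. The coefficients of the image are block sums in the first case and the total
  coefficient sum in the second, apart from zeros.\<close>

lemma rank_act_zero:
  assumes "f \<in> carrier G" "f \<noteq> \<one>\<^bsub>G\<^esub>" "x \<in> augmentation \<Omega>"
    and null: "\<And>L l. L \<in> \<L> \<Longrightarrow> l < n \<Longrightarrow> bsum L x l = 0"
  shows "(\<Sum>v\<in>{v \<in> \<Omega>. f v = w}. x v) = 0"
proof -
  consider L where "L \<in> \<L>" "kernel_partition \<Omega> f = fibres \<Omega> n L" | c where "f = (\<lambda>x\<in>\<Omega>. c)"
  proof -
    have "\<one>\<^bsub>G\<^esub> = (\<lambda>x\<in>\<Omega>. x)" by (simp add: G_def trans_monoid_def)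
    moreover consider "kernel_partition \<Omega> f \<in> fibres \<Omega> n ` \<L>" | "f = (\<lambda>x\<in>\<Omega>. x)" | c where "f = (\<lambda>x\<in>\<Omega>. c)"
      using assms(1) unfolding carrier_G by blast
    ultimately show thesis using assms(2) that by cases auto
  qed
  then show ?thesis
  proof cases
    case 1
    show ?thesis
    proof (cases "w \<in> f ` \<Omega>")
      case True
      then have "{v \<in> \<Omega>. f v = w} \<in> fibres \<Omega> n L"
        unfolding 1(2)[symmetric] kernel_partition_def by blast
      then show ?thesis using null[OF 1(1)] by (auto simp: fibres_def)
    next
      case False
      then have "{v \<in> \<Omega>. f v = w} = {}" by auto
      then show ?thesis by (simp only: sum.empty)
    qed
  next
    case 2
    then have "{v \<in> \<Omega>. f v = w} = (if w = c then \<Omega> else {})" by auto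
    then show ?thesis using assms(3) by (simp add: augmentation_def)
  qed
qed

text \<open>The elements of the augmentation with vanishing block sums are killed by all maps other than
  the identity, so they form a submodule.\<close>

lemma not_simple_aug:
  assumes z: "z \<in> augmentation \<Omega>" "z \<noteq> (\<lambda>_. 0)"
    and null: "\<And>L l. L \<in> \<L> \<Longrightarrow> l < n \<Longrightarrow> bsum L z l = 0"
    and y: "y \<in> augmentation \<Omega>" "L0 \<in> \<L>" "l0 < n" "bsum L0 y l0 \<noteq> 0"
  shows "\<not> simple_left_module (monoid_algebra G) (aug_module \<Omega> G)"
proof
  assume simple: "simple_left_module (monoid_algebra G) (aug_module \<Omega> G)"
  define N where "N = {x \<in> augmentation \<Omega>. \<forall>L\<in>\<L>. \<forall>l<n. bsum L x l = 0}"
  interpret V: left_module "monoid_algebra G" "aug_module \<Omega> G" by (rule left_module_aug)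
  have minus: "\<ominus>\<^bsub>aug_module \<Omega> G\<^esub> x = (\<lambda>w. - x w)" if "x \<in> augmentation \<Omega>" for x
    using that
    by (intro V.minus_equality) (auto simp: aug_sel augmentation_def lin_comb_def sum_negf)
  have "submodule N (monoid_algebra G) (aug_module \<Omega> G)"
  proof (intro submodule.intro submodule_axioms.intro group.subgroupI[OF V.a_group])
    show "N \<subseteq> carrier (add_monoid (aug_module \<Omega> G))"
      by (auto simp: N_def aug_sel)
    show "N \<noteq> {}" using z null by (auto simp: N_def)
    fix x assume x: "x \<in> N"
    then show "inv\<^bsub>add_monoid (aug_module \<Omega> G)\<^esub> x \<in> N"
      using minus[of x]
      by (auto simp: a_inv_def[symmetric] N_def augmentation_def lin_comb_def sum_negf)
    show "x \<otimes>\<^bsub>add_monoid (aug_module \<Omega> G)\<^esub> y \<in> N" if "y \<in> N" for y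
      using x that by (auto simp: N_def augmentation_def lin_comb_def aug_sel sum.distrib)
    fix a assume a: "a \<in> carrier (monoid_algebra G)"
    \<comment> \<open>All maps but the identity annihilate \<open>x\<close>, so \<open>a\<close>
      acts through its single coefficient at the identity.\<close>
    have "a \<odot>\<^bsub>aug_module \<Omega> G\<^esub> x = (\<lambda>g. if g = \<one>\<^bsub>G\<^esub> then a \<one>\<^bsub>G\<^esub> else 0) \<odot>\<^bsub>aug_module \<Omega> G\<^esub> x"
      unfolding aug_sel
    proof (intro ext sum.cong refl)
      fix w f assume "f \<in> carrier G"
      then show "a f * (\<Sum>v | v \<in> \<Omega> \<and> f v = w. x v) =
          (if f = \<one>\<^bsub>G\<^esub> then a \<one>\<^bsub>G\<^esub> else 0) * (\<Sum>v | v \<in> \<Omega> \<and> f v = w. x v)"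
        using rank_act_zero[of f x w] x by (auto simp: N_def)
    qed
    also have "\<dots> = (\<lambda>w. a \<one>\<^bsub>G\<^esub> * x w)"
      using x by (intro scalar_act) (auto simp: N_def augmentation_def)
    finally show "a \<odot>\<^bsub>aug_module \<Omega> G\<^esub> x \<in> N"
      using x by (auto simp: N_def augmentation_def lin_comb_def simp flip: sum_distrib_left)
  qed
  then have "N = {\<lambda>_. 0} \<or> N = augmentation \<Omega>"
    using simple by (auto simp: simple_left_module_def aug_sel)
  moreover have "z \<in> N" using z null by (auto simp: N_def)
  moreover have "y \<notin> N" using y by (auto simp: N_def)
  ultimately show False using z y by auto
qed

end

section \<open>Labels for the blocks\<close>

text \<open>For indices in \<open>{1..r}\<close> this is the residue of \<open>i - j\<close> modulo
  \<open>r\<close> in \<open>{0..<r}\<close>, by cases because subtraction of naturals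
  truncates.\<close>

definition off :: "nat \<Rightarrow> nat \<Rightarrow> nat \<Rightarrow> nat" where
  "off r j i = (if j \<le> i then i - j else i + r - j)"

text \<open>For an element whose index lies in column \<open>t\<close> of the table for \<open>j\<close> (where \<open>t = 0\<close> means the
  index \<open>j\<close> itself), the label is \<open>d\<close> for the diagonal block \<open>d\<close> and \<open>r - 1\<close> for the first block.\<close>

definition labC :: "nat \<Rightarrow> nat \<Rightarrow> nat \<Rightarrow> nat" where
  "labC r q t = (if t = 0 then r - 1 else if q + t < r - 1 then q + t else q + t - (r - 1))"

text \<open>Modulo \<open>r - 1\<close>, the cell of column \<open>t\<close> in row
  \<open>r - 2\<close> lies on diagonal \<open>t - 1\<close> and the one in row \<open>r - 1\<close>
  on diagonal \<open>t\<close>, which means 0 for \<open>t = r - 1\<close>. The exception at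
  \<open>t = r - 2\<close> for even \<open>r\<close> is the additional \<open>P\<close> of the first
  block.\<close>

definition labP :: "nat \<Rightarrow> nat \<Rightarrow> nat" where
  "labP r t = (if t = 0 then r - 1 else if t = r - 1 then 0
     else if even r \<and> t = r - 2 then r - 1 else if odd t then t - 1 else t)"

definition labJ :: "nat \<Rightarrow> nat \<Rightarrow> nat" where
  "labJ r t = (if t < r - 1 \<and> (odd t \<or> even r \<and> t = r - 2) then t else r - 1)"

primrec lab :: "nat \<Rightarrow> nat \<Rightarrow> omega \<Rightarrow> nat" where
  "lab r j (C i q) = labC r q (off r j i)"
| "lab r j (P i) = labP r (off r j i)"
| "lab r j (J i) = labJ r (off r j i)"

lemma mod_upto_double:
  "0 < m \<Longrightarrow> a \<le> 2 * m \<Longrightarrow> a mod m = (if a < m then a else if a < 2 * m then a - m else 0)" for a m :: nat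
  by (auto simp: le_mod_geq)

lemma idx_add:
  "1 \<le> j \<Longrightarrow> j \<le> r \<Longrightarrow> t < r \<Longrightarrow> idx r (j + t) = (if j + t \<le> r then j + t else j + t - r)"
  by (auto simp: idx_def mod_upto_double)

lemma idx_self: "1 \<le> i \<Longrightarrow> i \<le> r \<Longrightarrow> idx r i = i"
  by (cases "i = r") (auto simp: idx_def)

lemma idx_pred: "1 \<le> i \<Longrightarrow> i \<le> r \<Longrightarrow> idx r (i - 1) = (if i = 1 then r else i - 1)"
  by (auto simp: idx_def)

lemma idx_range: "1 \<le> r \<Longrightarrow> 1 \<le> idx r i \<and> idx r i \<le> r"
  by (auto simp: idx_def Suc_le_eq less_imp_le)

lemma off_idx: "1 \<le> j \<Longrightarrow> j \<le> r \<Longrightarrow> t < r \<Longrightarrow> off r j (idx r (j + t)) = t"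
  by (auto simp: idx_add off_def)

lemma idx_off: "1 \<le> j \<Longrightarrow> j \<le> r \<Longrightarrow> 1 \<le> i \<Longrightarrow> i \<le> r \<Longrightarrow> idx r (j + off r j i) = i"
  using idx_self[of i r] by (auto simp: off_def idx_def)

lemma idx_eq_iff:
  assumes "1 \<le> j" "j \<le> r" "k < r"
  shows "i = idx r (j + k) \<longleftrightarrow> 1 \<le> i \<and> i \<le> r \<and> off r j i = k"
proof
  assume "i = idx r (j + k)"
  then show "1 \<le> i \<and> i \<le> r \<and> off r j i = k"
    using assms off_idx[OF assms] idx_range[of r "j + k"] by simp
next
  assume "1 \<le> i \<and> i \<le> r \<and> off r j i = k"
  then show "i = idx r (j + k)"
    using idx_off[OF assms(1,2), of i] by simp
qed

lemma off_less: "1 \<le> j \<Longrightarrow> j \<le> r \<Longrightarrow> 1 \<le> i \<Longrightarrow> i \<le> r \<Longrightarrow> off r j i < r"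
  by (auto simp: off_def)

lemma in_Omega [simp]:
  "J i \<in> Omega r \<longleftrightarrow> 1 \<le> i \<and> i \<le> r"
  "P i \<in> Omega r \<longleftrightarrow> 1 \<le> i \<and> i \<le> r"
  "C i s \<in> Omega r \<longleftrightarrow> 1 \<le> i \<and> i \<le> r \<and> 1 \<le> s \<and> s \<le> r - 3"
  by (auto simp: Omega_def)

lemma finite_Omega: "finite (Omega r)"
proof -
  have "{C i s |i s. i \<in> {1..r} \<and> s \<in> {1..r-3}} = (\<lambda>(i, s). C i s) ` ({1..r} \<times> {1..r-3})"
    by auto
  then show ?thesis by (simp add: Omega_def)
qed

text \<open>Merges the two parities of \<open>r\<close>. For odd \<open>r\<close> the last column is
  even, so it looks like the specially treated last column of the even case; only column
  \<open>r - 2\<close> remains sensitive to the parity.\<close>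

lemma cell_SomeD:
  assumes "4 < r" "q \<le> r - 1" "t \<le> r - 1" "cell r j q t = Some x"
  shows "q \<le> r - 3 \<and> x = C (idx r (j + t)) q \<or>
    q = r - 2 \<and> odd t \<and> t < r - 1 \<and> x = P (idx r (j + t)) \<or>
    q = r - 1 \<and> x = P (idx r (j + t)) \<and> (t = r - 1 \<or> even t \<and> \<not> (even r \<and> t = r - 2)) \<or>
    q = r - 1 \<and> x = J (idx r (j + t)) \<and> t < r - 1 \<and> (odd t \<or> even r \<and> t = r - 2)"
proof -
  have "odd r \<Longrightarrow> odd t \<Longrightarrow> t < r - 1" using assms by (cases "t = r - 1") auto
  moreover have "q \<le> r - 3 \<or> q = r - 2 \<or> q = r - 1" using assms by auto
  ultimately show ?thesis
    using assms by (auto simp: cell_def Let_def split: if_splits)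
qed

lemma cell_lab:
  assumes r: "4 < r" and j: "1 \<le> j" "j \<le> r" and q: "1 \<le> q" "q \<le> r - 1" and t: "1 \<le> t" "t \<le> r - 1"
    and c: "cell r j q t = Some x"
  shows "x \<in> Omega r \<and> lab r j x = (q + t) mod (r - 1)"
proof -
  have off: "off r j (idx r (j + t)) = t" using off_idx[OF j, of t] t r by simp
  have idx: "1 \<le> idx r (j + t)" "idx r (j + t) \<le> r" using idx_range[of r] r by auto
  \<comment> \<open>The sum \<open>q + t\<close> reaches \<open>2 * (r - 1)\<close> only in the
    corner cell, where one subtraction of \<open>r - 1\<close> does not yet give the
    residue.\<close>
  have mod: "(q + t) mod (r - 1) =
      (if q + t < r - 1 then q + t else if q = r - 1 \<and> t = r - 1 then 0 else q + t - (r - 1))"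
    using q t r by (subst mod_upto_double) auto
  from cell_SomeD[OF r q(2) t(2) c] show ?thesis
    unfolding mod
  proof (elim disjE conjE)
    assume "q = r - 2" "odd t" "t < r - 1" "x = P (idx r (j + t))"
    moreover from this have "\<not> (even r \<and> t = r - 2)" using r by auto
    ultimately show "x \<in> Omega r \<and> lab r j x =
       (if q + t < r - 1 then q + t else if q = r - 1 \<and> t = r - 1 then 0 else q + t - (r - 1))"
      using r t idx off by (auto simp: labP_def)
  qed (use r q t idx off in \<open>auto simp: labC_def labP_def labJ_def\<close>)
qed

text \<open>Existence of some cell is enough: \<open>cell_lab\<close> then forces it onto the
  diagonal named by the label. This makes the diagonal blocks full fibres.\<close>

lemma lab_cell:
  assumes r: "4 < r" and j: "1 \<le> j" "j \<le> r" and x: "x \<in> Omega r" and d: "lab r j x < r - 1"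
  shows "\<exists>q\<in>{1..r-1}. \<exists>t\<in>{1..r-1}. cell r j q t = Some x"
proof -
  have rs: "\<not> r - 2 \<le> r - 3" "\<not> r - 1 \<le> r - 3" "r - 1 \<noteq> r - 2"
    "\<not> r - Suc 0 \<le> r - 3" "r - Suc 0 \<noteq> r - 2" using r by auto
  have ex: ?thesis if "cell r j q t = Some x" "q \<in> {1..r-1}" "t \<in> {1..r-1}" for q t
    using that by blast
  show ?thesis
  proof (cases x)
    case (C i q)
    have "off r j i \<noteq> 0" using d by (intro notI) (simp add: C labC_def)
    moreover have "off r j i < r" "cell r j q (off r j i) = Some x"
      using x off_less[OF j, of i] idx_off[OF j, of i] by (simp_all add: C cell_def)
    ultimately show ?thesis
      by (intro ex[of q "off r j i"]) (use x in \<open>auto simp: C\<close>)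
  next
    case (P i)
    define t where "t = off r j i"
    have "labP r t < r - 1" using d by (simp add: P t_def)
    then have t: "t \<noteq> 0" "\<not> (even r \<and> t = r - 2)"
      using r by (auto simp: labP_def split: if_splits)
    have i: "t < r" "idx r (j + t) = i"
      using x off_less[OF j, of i] idx_off[OF j, of i] by (auto simp: t_def P)
    show ?thesis
    proof (cases "odd t \<and> t \<noteq> r - 1")
      case True
      then have "cell r j (r - 2) t = Some x"
        using t i r by (simp add: P cell_def rs)
      then show ?thesis
        by (intro ex[of "r - 2" t]) (use t i(1) r in auto)
    next
      case False
      then have "cell r j (r - 1) t = Some x"
        using t i r by (cases "t = r - 1") (simp_all add: P cell_def rs)
      then show ?thesis
        by (intro ex[of "r - 1" t]) (use t i(1) r in auto)
    qed
  next
    case (J i)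
    define t where "t = off r j i"
    have "labJ r t < r - 1" using d by (simp add: J t_def)
    then have t: "t < r - 1" "odd t \<or> even r \<and> t = r - 2"
      using r by (auto simp: labJ_def split: if_splits)
    then have "t \<noteq> 0" using r by (intro notI) auto
    moreover have "idx r (j + t) = i"
      using x idx_off[OF j, of i] by (auto simp: t_def J)
    moreover from this have "cell r j (r - 1) t = Some x"
      using t(2) r \<open>t < r - 1\<close> by (cases "odd t") (simp_all add: J cell_def rs)
    ultimately show ?thesis
      by (intro ex[of "r - 1" t]) (use t r in auto)
  qed
qed

lemma diag_block_eq:
  assumes "4 < r" "1 \<le> j" "j \<le> r" "d < r - 1"
  shows "diag_block r j d = {x \<in> Omega r. lab r j x = d}"
proof (intro Set.set_eqI iffI)
  fix x assume "x \<in> diag_block r j d"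
  then show "x \<in> {x \<in> Omega r. lab r j x = d}"
    using cell_lab[OF assms(1-3)] by (auto simp: diag_block_def)
next
  fix x assume x: "x \<in> {x \<in> Omega r. lab r j x = d}"
  then obtain q t where qt: "q \<in> {1..r-1}" "t \<in> {1..r-1}" "cell r j q t = Some x"
    using lab_cell[OF assms(1-3), of x] assms(4) by auto
  then have "(q + t) mod (r - 1) = d"
    using cell_lab[OF assms(1-3), of q t x] x by simp
  then show "x \<in> diag_block r j d"
    unfolding diag_block_def using qt by blast
qed

lemma labC_less: "0 < t \<Longrightarrow> t < r \<Longrightarrow> 1 \<le> q \<Longrightarrow> q \<le> r - 3 \<Longrightarrow> labC r q t < r - 1"
  by (auto simp: labC_def)

text \<open>Measured from \<open>j\<close>, the set \<open>E_set r j\<close> has its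
  \<open>J\<close>-elements at the offsets 0 and \<open>r - 1\<close>, and the additional ones fill
  even offsets in between. Together these are exactly the offsets at which the table has no
  \<open>J\<close>.\<close>

lemma first_block_eq:
  assumes r: "4 < r" and j: "1 \<le> j" "j \<le> r"
  shows "first_block r j = {x \<in> Omega r. lab r j x = r - 1}"
proof (rule Set.set_eqI)
  fix x
  show "x \<in> first_block r j \<longleftrightarrow> x \<in> {x \<in> Omega r. lab r j x = r - 1}"
  proof (cases x)
    case (C i s)
    have "x \<in> first_block r j \<longleftrightarrow> i = j \<and> 1 \<le> s \<and> s \<le> r - 3"
      by (auto simp: C first_block_def E_set_def)
    also have "\<dots> \<longleftrightarrow> x \<in> Omega r \<and> labC r s (off r j i) = r - 1"
    proof (cases "i = j")
      case True
      then show ?thesis using j by (simp add: C labC_def off_def)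
    next
      case False
      then have "labC r s (off r j i) < r - 1" if "x \<in> Omega r"
        using that j by (intro labC_less) (auto simp: C off_def)
      then show ?thesis using False by auto
    qed
    finally show ?thesis by (simp add: C)
  next
    case (P i)
    define t where "t = off r j i"
    have "x \<in> first_block r j \<longleftrightarrow> i = j \<or> even r \<and> i = idx r (j + (r - 2))"
      by (auto simp: P first_block_def E_set_def)
    also have "\<dots> \<longleftrightarrow> 1 \<le> i \<and> i \<le> r \<and> (t = 0 \<or> even r \<and> t = r - 2)"
      using r j idx_eq_iff[OF j, of "r - 2" i] by (auto simp: t_def off_def)
    also have "\<dots> \<longleftrightarrow> x \<in> {x \<in> Omega r. lab r j x = r - 1}"
    proof -
      have "labP r t = r - 1 \<longleftrightarrow> t = 0 \<or> even r \<and> t = r - 2" if "t < r"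
        using that r by (auto simp: labP_def)
      then show ?thesis
        using off_less[OF j, of i] by (auto simp: P t_def)
    qed
    finally show ?thesis .
  next
    case (J i)
    define t where "t = off r j i"
    have ex: "(\<exists>k. i = idx r (j + k) \<and> even k \<and> 2 \<le> k \<and> k \<le> m) \<longleftrightarrow>
        1 \<le> i \<and> i \<le> r \<and> even t \<and> 2 \<le> t \<and> t \<le> m" if "m < r" for m
    proof
      assume "\<exists>k. i = idx r (j + k) \<and> even k \<and> 2 \<le> k \<and> k \<le> m"
      then obtain k where k: "i = idx r (j + k)" "even k" "2 \<le> k" "k \<le> m" by blast
      then have "t = k" using off_idx[OF j, of k] that by (simp add: t_def)
      then show "1 \<le> i \<and> i \<le> r \<and> even t \<and> 2 \<le> t \<and> t \<le> m"
        using k idx_range[of r "j + k"] r by simp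
    next
      assume "1 \<le> i \<and> i \<le> r \<and> even t \<and> 2 \<le> t \<and> t \<le> m"
      then show "\<exists>k. i = idx r (j + k) \<and> even k \<and> 2 \<le> k \<and> k \<le> m"
        using idx_off[OF j, of i] by (intro exI[of _ t]) (simp add: t_def)
    qed
    have pred: "i = idx r (j - 1) \<longleftrightarrow> 1 \<le> i \<and> i \<le> r \<and> t = r - 1"
      using r j unfolding idx_pred[OF j] t_def off_def by (cases "j = 1"; cases "j \<le> i"; simp; arith)
    have self: "i = j \<longleftrightarrow> 1 \<le> i \<and> i \<le> r \<and> t = 0"
      using r j unfolding t_def off_def by (cases "j \<le> i"; simp; arith)
    have "x \<in> first_block r j \<longleftrightarrow> i = idx r (j - 1) \<or> i = j \<or>
        (\<exists>k. i = idx r (j + k) \<and> even k \<and> 2 \<le> k \<and> k \<le> (if odd r then r - 3 else r - 4))"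
      by (auto simp: J first_block_def E_set_def)
    also have "\<dots> \<longleftrightarrow> 1 \<le> i \<and> i \<le> r \<and>
        (t = r - 1 \<or> t = 0 \<or> even t \<and> 2 \<le> t \<and> t \<le> (if odd r then r - 3 else r - 4))"
    proof -
      have "(if odd r then r - 3 else r - 4) < r" using r by simp
      from ex[OF this] show ?thesis unfolding pred self by blast
    qed
    also have "\<dots> \<longleftrightarrow> 1 \<le> i \<and> i \<le> r \<and> labJ r t = r - 1"
    proof (intro conj_cong refl)
      assume "1 \<le> i" "i \<le> r"
      then have "t < r" using off_less[OF j] by (simp add: t_def)
      then show "(t = r - 1 \<or> t = 0 \<or> even t \<and> 2 \<le> t \<and> t \<le> (if odd r then r - 3 else r - 4)) \<longleftrightarrow>
          labJ r t = r - 1"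
      proof (cases "odd r")
        case True
        then have "(t = r - 1 \<or> t = 0 \<or> even t \<and> 2 \<le> t \<and> t \<le> r - 3) \<longleftrightarrow> \<not> (t < r - 1 \<and> odd t)"
          using r \<open>t < r\<close> by presburger
        with True show ?thesis by (simp add: labJ_def)
      next
        case False
        then have "(t = r - 1 \<or> t = 0 \<or> even t \<and> 2 \<le> t \<and> t \<le> r - 4) \<longleftrightarrow>
            \<not> (t < r - 1 \<and> (odd t \<or> t = r - 2))"
          using r \<open>t < r\<close> by presburger
        with False show ?thesis by (simp add: labJ_def)
      qed
    qed
    finally show ?thesis by (simp add: J t_def)
  qed
qed

lemma B_part_fibres:
  assumes "4 < r" "1 \<le> j" "j \<le> r"
  shows "B_part r j = fibres (Omega r) r (lab r j)"
proof -
  have "{..<r} = insert (r - 1) {0..<r-1}" using assms by auto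
  then show ?thesis
    unfolding B_part_def fibres_def using first_block_eq[OF assms] diag_block_eq[OF assms] by simp
qed

text \<open>\<open>C_set r s\<close> has the label \<open>s - 1\<close>; the other three blocks of \<open>B_star r\<close> are labelled
  \<open>r - 3, r - 2, r - 1\<close> in the order in which they are listed.\<close>

primrec star_lab :: "nat \<Rightarrow> omega \<Rightarrow> nat" where
  "star_lab r (C i s) = s - 1"
| "star_lab r (P i) =
     (if odd r then (if i = r - 1 then r - 3 else if i = r then r - 2 else r - 1)
      else (if i = 1 \<or> i = 4 then r - 3 else if i = 2 \<or> i = 5 then r - 2 else r - 1))"
| "star_lab r (J i) =
     (if odd r then (if i = r - 1 then r - 1 else if i = r \<or> even i then r - 3 else r - 2)
      else (if i = 2 \<or> odd i \<and> 5 \<le> i then r - 3 else if i = 3 \<or> even i \<and> 6 \<le> i then r - 2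
        else r - 1))"

lemma star_lab_ge: "r - 3 \<le> star_lab r (P i)" "r - 3 \<le> star_lab r (J i)"
proof -
  show "r - 3 \<le> star_lab r (P i)"
    by (simp only: star_lab.simps split: if_split) (intro conjI impI; linarith)
  show "r - 3 \<le> star_lab r (J i)"
    by (simp only: star_lab.simps split: if_split) (intro conjI impI; linarith)
qed

lemma if3_eq_iff:
  assumes "a \<noteq> b" "a \<noteq> c" "b \<noteq> c"
  shows "(if X then a else if Y then b else c) = a \<longleftrightarrow> X"
    "(if X then a else if Y then b else c) = b \<longleftrightarrow> \<not> X \<and> Y"
    "(if X then a else if Y then b else c) = c \<longleftrightarrow> \<not> X \<and> \<not> Y"
  using assms by auto

text \<open>For \<open>r > 4\<close> the labels \<open>r - 3\<close>, \<open>r - 2\<close>,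
  \<open>r - 1\<close> are distinct, which dissolves the nested conditionals into parity and order
  conditions on \<open>i\<close>, a form that Presburger arithmetic decides.\<close>

lemma star_lab_eq_iff:
  assumes "4 < r"
  shows "star_lab r (P i) = r - 3 \<longleftrightarrow> (if odd r then i = r - 1 else i = 1 \<or> i = 4)"
    "star_lab r (P i) = r - 2 \<longleftrightarrow>
      (if odd r then i \<noteq> r - 1 \<and> i = r else \<not> (i = 1 \<or> i = 4) \<and> (i = 2 \<or> i = 5))"
    "star_lab r (P i) = r - 1 \<longleftrightarrow>
      (if odd r then i \<noteq> r - 1 \<and> i \<noteq> r else \<not> (i = 1 \<or> i = 4) \<and> \<not> (i = 2 \<or> i = 5))"
    "star_lab r (J i) = r - 3 \<longleftrightarrow>
      (if odd r then i \<noteq> r - 1 \<and> (i = r \<or> even i) else i = 2 \<or> odd i \<and> 5 \<le> i)"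
    "star_lab r (J i) = r - 2 \<longleftrightarrow>
      (if odd r then i \<noteq> r - 1 \<and> \<not> (i = r \<or> even i)
       else \<not> (i = 2 \<or> odd i \<and> 5 \<le> i) \<and> (i = 3 \<or> even i \<and> 6 \<le> i))"
    "star_lab r (J i) = r - 1 \<longleftrightarrow>
      (if odd r then i = r - 1
       else \<not> (i = 2 \<or> odd i \<and> 5 \<le> i) \<and> \<not> (i = 3 \<or> even i \<and> 6 \<le> i))"
proof -
  have ne: "r - 3 \<noteq> r - 2" "r - 3 \<noteq> r - 1" "r - 2 \<noteq> r - 1"
    "r - 2 \<noteq> r - 3" "r - 1 \<noteq> r - 3" "r - 1 \<noteq> r - 2" using assms by auto
  note rules = star_lab.simps if3_eq_iff[OF ne(1-3)] if3_eq_iff[OF ne(5,6,1)]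
  show "star_lab r (P i) = r - 3 \<longleftrightarrow> (if odd r then i = r - 1 else i = 1 \<or> i = 4)"
    by (cases "even r") (simp_all only: rules not_not not_True_eq_False not_False_eq_True if_True if_False)
  show "star_lab r (P i) = r - 2 \<longleftrightarrow>
      (if odd r then i \<noteq> r - 1 \<and> i = r else \<not> (i = 1 \<or> i = 4) \<and> (i = 2 \<or> i = 5))"
    by (cases "even r") (simp_all only: rules not_not not_True_eq_False not_False_eq_True if_True if_False)
  show "star_lab r (P i) = r - 1 \<longleftrightarrow>
      (if odd r then i \<noteq> r - 1 \<and> i \<noteq> r else \<not> (i = 1 \<or> i = 4) \<and> \<not> (i = 2 \<or> i = 5))"
    by (cases "even r") (simp_all only: rules not_not not_True_eq_False not_False_eq_True if_True if_False)
  show "star_lab r (J i) = r - 3 \<longleftrightarrow>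
      (if odd r then i \<noteq> r - 1 \<and> (i = r \<or> even i) else i = 2 \<or> odd i \<and> 5 \<le> i)"
    by (cases "even r") (simp_all only: rules not_not not_True_eq_False not_False_eq_True if_True if_False)
  show "star_lab r (J i) = r - 2 \<longleftrightarrow>
      (if odd r then i \<noteq> r - 1 \<and> \<not> (i = r \<or> even i)
       else \<not> (i = 2 \<or> odd i \<and> 5 \<le> i) \<and> (i = 3 \<or> even i \<and> 6 \<le> i))"
    by (cases "even r") (simp_all only: rules not_not not_True_eq_False not_False_eq_True if_True if_False)
  show "star_lab r (J i) = r - 1 \<longleftrightarrow>
      (if odd r then i = r - 1
       else \<not> (i = 2 \<or> odd i \<and> 5 \<le> i) \<and> \<not> (i = 3 \<or> even i \<and> 6 \<le> i))"
    by (cases "even r") (simp_all only: rules not_not not_True_eq_False not_False_eq_True if_True if_False)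
qed

declare star_lab.simps(2,3) [simp del]

lemma C_set_star: "1 \<le> s \<Longrightarrow> s \<le> r - 3 \<Longrightarrow> C_set r s = {x \<in> Omega r. star_lab r x = s - 1}"
proof (intro Set.set_eqI, rename_tac x)
  fix x assume s: "1 \<le> s" "s \<le> r - 3"
  have ge: "s - 1 < star_lab r (P i)" "s - 1 < star_lab r (J i)" for i
    using s star_lab_ge[of r i] by linarith+
  show "x \<in> C_set r s \<longleftrightarrow> x \<in> {x \<in> Omega r. star_lab r x = s - 1}"
  proof (cases x)
    case (J i)
    then show ?thesis using ge(2)[of i] by (simp add: C_set_def)
  next
    case (P i)
    then show ?thesis using ge(1)[of i] by (simp add: C_set_def)
  next
    case (C i q)
    have "q - 1 = s - 1 \<and> 1 \<le> q \<longleftrightarrow> q = s" using s by arith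
    then show ?thesis using s by (auto simp: C_set_def C)
  qed
qed

lemma star_blocks_odd:
  assumes r: "4 < r" "odd r"
  shows "{J r, P (r - 1)} \<union> {J i |i. even i \<and> 2 \<le> i \<and> i \<le> r - 3} = {x \<in> Omega r. star_lab r x = r - 3}"
    (is "?X = _")
    and "{P r} \<union> {J i |i. odd i \<and> 1 \<le> i \<and> i \<le> r - 2} = {x \<in> Omega r. star_lab r x = r - 2}"
    (is "?Y = _")
    and "{J (r - 1)} \<union> {P i |i. 1 \<le> i \<and> i \<le> r - 2} = {x \<in> Omega r. star_lab r x = r - 1}"
    (is "?Z = _")
proof -
  show "?X = {x \<in> Omega r. star_lab r x = r - 3}"
  proof (rule Set.set_eqI)
    fix x show "x \<in> ?X \<longleftrightarrow> x \<in> {x \<in> Omega r. star_lab r x = r - 3}"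
    proof (cases x)
      case (J i)
      have "x \<in> ?X \<longleftrightarrow> i = r \<or> even i \<and> 2 \<le> i \<and> i \<le> r - 3"
        by (auto simp: J)
      also have "\<dots> \<longleftrightarrow> 1 \<le> i \<and> i \<le> r \<and> (i \<noteq> r - 1 \<and> (i = r \<or> even i))"
        using r by presburger
      finally show ?thesis using r star_lab_eq_iff[OF r(1), of i] by (simp add: J)
    next
      case (P i)
      have "x \<in> ?X \<longleftrightarrow> i = r - 1"
        by (auto simp: P)
      also have "\<dots> \<longleftrightarrow> 1 \<le> i \<and> i \<le> r \<and> i = r - 1"
        using r by presburger
      finally show ?thesis using r star_lab_eq_iff[OF r(1), of i] by (simp add: P)
    next
      case (C i s)
      have "s - 1 < r - 3" if "1 \<le> s" "s \<le> r - 3" using that by linarith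
      then show ?thesis by (auto simp: C)
    qed
  qed
  show "?Y = {x \<in> Omega r. star_lab r x = r - 2}"
  proof (rule Set.set_eqI)
    fix x show "x \<in> ?Y \<longleftrightarrow> x \<in> {x \<in> Omega r. star_lab r x = r - 2}"
    proof (cases x)
      case (J i)
      have "x \<in> ?Y \<longleftrightarrow> odd i \<and> 1 \<le> i \<and> i \<le> r - 2"
        by (auto simp: J)
      also have "\<dots> \<longleftrightarrow> 1 \<le> i \<and> i \<le> r \<and> (i \<noteq> r - 1 \<and> \<not> (i = r \<or> even i))"
        using r by presburger
      finally show ?thesis using r star_lab_eq_iff[OF r(1), of i] by (simp add: J)
    next
      case (P i)
      have "x \<in> ?Y \<longleftrightarrow> i = r"
        by (auto simp: P)
      also have "\<dots> \<longleftrightarrow> 1 \<le> i \<and> i \<le> r \<and> (i \<noteq> r - 1 \<and> i = r)"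
        using r by presburger
      finally show ?thesis using r star_lab_eq_iff[OF r(1), of i] by (simp add: P)
    next
      case (C i s)
      have "s - 1 < r - 2" if "1 \<le> s" "s \<le> r - 3" using that by linarith
      then show ?thesis by (auto simp: C)
    qed
  qed
  show "?Z = {x \<in> Omega r. star_lab r x = r - 1}"
  proof (rule Set.set_eqI)
    fix x show "x \<in> ?Z \<longleftrightarrow> x \<in> {x \<in> Omega r. star_lab r x = r - 1}"
    proof (cases x)
      case (J i)
      have "x \<in> ?Z \<longleftrightarrow> i = r - 1"
        by (auto simp: J)
      also have "\<dots> \<longleftrightarrow> 1 \<le> i \<and> i \<le> r \<and> i = r - 1"
        using r by presburger
      finally show ?thesis using r star_lab_eq_iff[OF r(1), of i] by (simp add: J)
    next
      case (P i)
      have "x \<in> ?Z \<longleftrightarrow> 1 \<le> i \<and> i \<le> r - 2"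
        by (auto simp: P)
      also have "\<dots> \<longleftrightarrow> 1 \<le> i \<and> i \<le> r \<and> (i \<noteq> r - 1 \<and> i \<noteq> r)"
        using r by presburger
      finally show ?thesis using r star_lab_eq_iff[OF r(1), of i] by (simp add: P)
    next
      case (C i s)
      have "s - 1 < r - 1" if "1 \<le> s" "s \<le> r - 3" using that by linarith
      then show ?thesis by (auto simp: C)
    qed
  qed
qed

lemma star_blocks_even:
  assumes r: "4 < r" "even r"
  shows "{J 2, P 1, P 4} \<union> {J i |i. odd i \<and> 5 \<le> i \<and> i \<le> r - 1} = {x \<in> Omega r. star_lab r x = r - 3}"
    (is "?X = _")
    and "{J 3, P 2, P 5} \<union> {J i |i. even i \<and> 6 \<le> i \<and> i \<le> r} = {x \<in> Omega r. star_lab r x = r - 2}"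
    (is "?Y = _")
    and "{J 1, J 4, P 3} \<union> {P i |i. 6 \<le> i \<and> i \<le> r} = {x \<in> Omega r. star_lab r x = r - 1}"
    (is "?Z = _")
proof -
  show "?X = {x \<in> Omega r. star_lab r x = r - 3}"
  proof (rule Set.set_eqI)
    fix x show "x \<in> ?X \<longleftrightarrow> x \<in> {x \<in> Omega r. star_lab r x = r - 3}"
    proof (cases x)
      case (J i)
      have "x \<in> ?X \<longleftrightarrow> i = 2 \<or> odd i \<and> 5 \<le> i \<and> i \<le> r - 1"
        by (auto simp: J)
      also have "\<dots> \<longleftrightarrow> 1 \<le> i \<and> i \<le> r \<and> (i = 2 \<or> odd i \<and> 5 \<le> i)"
        using r by presburger
      finally show ?thesis using r star_lab_eq_iff[OF r(1), of i] by (simp add: J)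
    next
      case (P i)
      have "x \<in> ?X \<longleftrightarrow> i = 1 \<or> i = 4"
        by (auto simp: P)
      also have "\<dots> \<longleftrightarrow> 1 \<le> i \<and> i \<le> r \<and> (i = 1 \<or> i = 4)"
        using r by presburger
      finally show ?thesis using r star_lab_eq_iff[OF r(1), of i] by (simp add: P)
    next
      case (C i s)
      have "s - 1 < r - 3" if "1 \<le> s" "s \<le> r - 3" using that by linarith
      then show ?thesis by (auto simp: C)
    qed
  qed
  show "?Y = {x \<in> Omega r. star_lab r x = r - 2}"
  proof (rule Set.set_eqI)
    fix x show "x \<in> ?Y \<longleftrightarrow> x \<in> {x \<in> Omega r. star_lab r x = r - 2}"
    proof (cases x)
      case (J i)
      have "x \<in> ?Y \<longleftrightarrow> i = 3 \<or> even i \<and> 6 \<le> i \<and> i \<le> r"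
        by (auto simp: J)
      also have "\<dots> \<longleftrightarrow> 1 \<le> i \<and> i \<le> r \<and> (\<not> (i = 2 \<or> odd i \<and> 5 \<le> i) \<and> (i = 3 \<or> even i \<and> 6 \<le> i))"
        using r by presburger
      finally show ?thesis using r star_lab_eq_iff[OF r(1), of i] by (simp add: J)
    next
      case (P i)
      have "x \<in> ?Y \<longleftrightarrow> i = 2 \<or> i = 5"
        by (auto simp: P)
      also have "\<dots> \<longleftrightarrow> 1 \<le> i \<and> i \<le> r \<and> (\<not> (i = 1 \<or> i = 4) \<and> (i = 2 \<or> i = 5))"
        using r by presburger
      finally show ?thesis using r star_lab_eq_iff[OF r(1), of i] by (simp add: P)
    next
      case (C i s)
      have "s - 1 < r - 2" if "1 \<le> s" "s \<le> r - 3" using that by linarith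
      then show ?thesis by (auto simp: C)
    qed
  qed
  show "?Z = {x \<in> Omega r. star_lab r x = r - 1}"
  proof (rule Set.set_eqI)
    fix x show "x \<in> ?Z \<longleftrightarrow> x \<in> {x \<in> Omega r. star_lab r x = r - 1}"
    proof (cases x)
      case (J i)
      have "x \<in> ?Z \<longleftrightarrow> i = 1 \<or> i = 4"
        by (auto simp: J)
      also have "\<dots> \<longleftrightarrow> 1 \<le> i \<and> i \<le> r \<and> (\<not> (i = 2 \<or> odd i \<and> 5 \<le> i) \<and> \<not> (i = 3 \<or> even i \<and> 6 \<le> i))"
        using r by presburger
      finally show ?thesis using r star_lab_eq_iff[OF r(1), of i] by (simp add: J)
    next
      case (P i)
      have "x \<in> ?Z \<longleftrightarrow> i = 3 \<or> 6 \<le> i \<and> i \<le> r"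
        by (auto simp: P)
      also have "\<dots> \<longleftrightarrow> 1 \<le> i \<and> i \<le> r \<and> (\<not> (i = 1 \<or> i = 4) \<and> \<not> (i = 2 \<or> i = 5))"
        using r by presburger
      finally show ?thesis using r star_lab_eq_iff[OF r(1), of i] by (simp add: P)
    next
      case (C i s)
      have "s - 1 < r - 1" if "1 \<le> s" "s \<le> r - 3" using that by linarith
      then show ?thesis by (auto simp: C)
    qed
  qed
qed

lemma B_star_fibres:
  assumes r: "4 < r"
  shows "B_star r = fibres (Omega r) r (star_lab r)"
proof -
  let ?F = "\<lambda>l. {x \<in> Omega r. star_lab r x = l}"
  have *: "{..<r} = (\<lambda>s. s - 1) ` {1..r-3} \<union> {r - 3, r - 2, r - 1}"
  proof (intro Set.set_eqI iffI)
    fix l assume "l \<in> {..<r}"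
    then show "l \<in> (\<lambda>s. s - 1) ` {1..r-3} \<union> {r - 3, r - 2, r - 1}"
      by (cases "l < r - 3") (auto intro!: image_eqI[of _ _ "Suc l"])
  qed (use r in auto)
  have "C_set r ` {1..r-3} = ?F ` (\<lambda>s. s - 1) ` {1..r-3}"
    unfolding image_image by (intro image_cong refl C_set_star) auto
  moreover have "fibres (Omega r) r (star_lab r) =
      ?F ` (\<lambda>s. s - 1) ` {1..r-3} \<union> {?F (r - 3), ?F (r - 2), ?F (r - 1)}"
    unfolding fibres_def * image_Un by simp
  ultimately show ?thesis
    unfolding B_star_def using star_blocks_odd[OF r] star_blocks_even[OF r] by (cases "odd r") simp_all
qed

section \<open>Compatibility\<close>

lemma card_E_set:
  assumes "4 < r" "1 \<le> i" "i \<le> r"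
  shows "card (E_set r i) = r"
proof -
  have "E_set r i = {J (idx r (i - 1)), P i, J i} \<union> C i ` {1..r-3}"
    by (auto simp: E_set_def)
  moreover have "card {J (idx r (i - 1)), P i, J i} = 3"
    using assms unfolding idx_pred[OF assms(2,3)] by (auto simp: card_insert_if)
  moreover have "card (C i ` {1..r-3}) = r - 3"
    by (subst card_image) (auto simp: inj_on_def)
  moreover have "{J (idx r (i - 1)), P i, J i} \<inter> C i ` {1..r-3} = {}"
    by auto
  ultimately have "card (E_set r i) = 3 + (r - 3)"
    by (metis card_Un_disjoint finite_atLeastAtMost finite_imageI finite.intros)
  then show ?thesis using assms by simp
qed

lemma card_C_set: "card (C_set r s) = r"
proof -
  have "C_set r s = (\<lambda>i. C i s) ` {1..r}"
    by (auto simp: C_set_def)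
  then show ?thesis by (simp add: card_image inj_on_def)
qed

lemma E_set_sub: "1 \<le> i \<Longrightarrow> i \<le> r \<Longrightarrow> E_set r i \<subseteq> Omega r"
  using idx_range[of r "i - 1"] by (auto simp: E_set_def)

lemma C_set_sub: "1 \<le> s \<Longrightarrow> s \<le> r - 3 \<Longrightarrow> C_set r s \<subseteq> Omega r"
  by (auto simp: C_set_def)

lemma lab_first_E:
  assumes "4 < r" "1 \<le> j" "j \<le> r"
  shows "lab r j ` E_set r j \<subseteq> {r - 1}"
proof -
  have "E_set r j \<subseteq> first_block r j" by (auto simp: first_block_def)
  then show ?thesis unfolding first_block_eq[OF assms] by auto
qed

text \<open>Along row \<open>s\<close> the diagonal is \<open>s + t\<close> modulo
  \<open>r - 1\<close>, so the \<open>r - 1\<close> columns run through all diagonals, and the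
  element with index \<open>j\<close> itself lies in the first block.\<close>

lemma lab_transversal_C:
  assumes r: "4 < r" and j: "1 \<le> j" "j \<le> r" and s: "1 \<le> s" "s \<le> r - 3"
  shows "{..<r} \<subseteq> lab r j ` C_set r s"
proof
  fix l assume "l \<in> {..<r}"
  then have l: "l < r" by simp
  have wit: "l \<in> lab r j ` C_set r s" if "t < r" "labC r s t = l" for t
  proof (rule image_eqI)
    show "l = lab r j (C (idx r (j + t)) s)"
      using that off_idx[OF j, of t] by simp
    show "C (idx r (j + t)) s \<in> C_set r s"
      using idx_range[of r "j + t"] r by (auto simp: C_set_def)
  qed
  consider "l = r - 1" | "s < l" "l < r - 1" | "l \<le> s" "l < r - 1" using l by linarith
  then show "l \<in> lab r j ` C_set r s"
  proof cases
    case 1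
    then show ?thesis using wit[of 0] r by (simp add: labC_def)
  next
    case 2
    then show ?thesis using wit[of "l - s"] by (auto simp: labC_def)
  next
    case 3
    then have "l + (r - 1) - s < r" "labC r s (l + (r - 1) - s) = l"
      using s r by (auto simp: labC_def)
    then show ?thesis by (rule wit)
  qed
qed

text \<open>In column \<open>t\<close> the rows 1 to \<open>r - 3\<close> occupy the diagonals from
  \<open>t + 1\<close> to \<open>t + r - 3\<close> modulo \<open>r - 1\<close>. Missing are the
  diagonals \<open>t - 1\<close> and \<open>t\<close> and the first block. The three other elements
  of an \<open>E_set\<close> supply exactly these; which element supplies which label depends on the
  parities.\<close>

lemma labPJ:
  assumes "4 < r" "1 \<le> t" "t < r"
  shows "{labP r t, labJ r t, labJ r (t - 1)} = {r - 1, t - 1, if t = r - 1 then 0 else t}"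
proof -
  consider "t = r - 1" | "t < r - 1" "even r" "t = r - 2" | "t < r - 1" "odd t" "\<not> (even r \<and> t = r - 2)"
    | "t < r - 1" "even t" "\<not> (even r \<and> t = r - 2)"
    using assms by linarith
  then show ?thesis
  proof cases
    case 1
    have "labJ r (t - 1) = t - 1"
      using 1 assms unfolding labJ_def by (cases "even r") auto
    moreover have "labP r t = 0" "labJ r t = r - 1"
      using 1 assms by (auto simp: labP_def labJ_def)
    ultimately show ?thesis using 1 by auto
  next
    case 2
    then have "odd (t - 1)" using assms by simp
    then have "labJ r (t - 1) = t - 1" "labP r t = r - 1" "labJ r t = t"
      using 2 assms by (auto simp: labP_def labJ_def)
    then show ?thesis using 2 by auto
  next
    case 3
    have "even (t - 1)" "t - 1 \<noteq> r - 2" using 3(1,2) assms by auto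
    then have "labJ r (t - 1) = r - 1"
      unfolding labJ_def by simp
    moreover have "labP r t = t - 1" "labJ r t = t"
      using 3 assms by (auto simp: labP_def labJ_def)
    ultimately show ?thesis using 3 by auto
  next
    case 4
    then have "odd (t - 1)" using assms by simp
    then have "labJ r (t - 1) = t - 1" "labP r t = t" "labJ r t = r - 1"
      using 4 assms by (auto simp: labP_def labJ_def)
    then show ?thesis using 4 by auto
  qed
qed

lemma lab_transversal_E:
  assumes r: "4 < r" and j: "1 \<le> j" "j \<le> r" and k: "1 \<le> k" "k \<le> r" "k \<noteq> j"
  shows "{..<r} \<subseteq> lab r j ` E_set r k"
proof
  fix l assume "l \<in> {..<r}"
  then have l: "l < r" by simp
  define t where "t = off r j k"
  have t: "1 \<le> t" "t < r" using j k by (auto simp: t_def off_def)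
  have pred: "off r j (idx r (k - 1)) = t - 1"
    using j k unfolding idx_pred[OF k(1,2)] t_def off_def by (auto split: if_splits)
  have PJ: "{labP r t, labJ r t, labJ r (t - 1)} \<subseteq> lab r j ` E_set r k"
    using pred by (auto simp: E_set_def t_def image_iff)
  have C: "labC r s t \<in> lab r j ` E_set r k" if "1 \<le> s" "s \<le> r - 3" for s
    using that by (intro image_eqI[of _ _ "C k s"]) (auto simp: E_set_def t_def)
  show "l \<in> lab r j ` E_set r k"
  proof (cases "l \<in> {r - 1, t - 1, if t = r - 1 then 0 else t}")
    case True
    then show ?thesis using PJ unfolding labPJ[OF r t] by blast
  next
    case False
    \<comment> \<open>A remaining label \<open>l\<close> comes from row \<open>l - t\<close>, or
      from row \<open>l + (r - 1) - t\<close> after wrapping around. The diagonal labels excluded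
      above are those for which this row falls outside \<open>1..r-3\<close>.\<close>
    then consider "t < l" "l < r - 1" | "l + 2 \<le> t" "l < r - 1" "t < r - 1 \<or> 0 < l"
    proof -
      from False have "l \<noteq> r - 1" "l \<noteq> t - 1" "l \<noteq> (if t = r - 1 then 0 else t)" by auto
      then have "t < l \<and> l < r - 1 \<or> l + 2 \<le> t \<and> l < r - 1 \<and> (t < r - 1 \<or> 0 < l)"
        using l t by (cases "t = r - 1") auto
      then show thesis using that by blast
    qed
    then show ?thesis
    proof cases
      case 1
      then have "labC r (l - t) t = l" using t by (simp add: labC_def)
      then show ?thesis using C[of "l - t"] 1 t by simp
    next
      case 2
      then have "labC r (l + (r - 1) - t) t = l" using t by (simp add: labC_def)
      moreover have "1 \<le> l + (r - 1) - t" "l + (r - 1) - t \<le> r - 3"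
        using 2 t by linarith+
      ultimately show ?thesis using C[of "l + (r - 1) - t"] by simp
    qed
  qed
qed

lemma star_C: "star_lab r ` C_set r s \<subseteq> {s - 1}"
  by (auto simp: C_set_def)

text \<open>The elements \<open>C k s\<close> account for the first \<open>r - 3\<close> labels. The
  three other blocks are arranged so that \<open>P k\<close>, \<open>J k\<close> and the cyclic
  predecessor of \<open>J k\<close> always lie in different ones.\<close>

lemma star_transversal_E:
  assumes r: "4 < r" and k: "1 \<le> k" "k \<le> r"
  shows "{..<r} \<subseteq> star_lab r ` E_set r k"
proof
  fix l assume "l \<in> {..<r}"
  then consider "l < r - 3" | "l = r - 3 \<or> l = r - 2 \<or> l = r - 1" by force
  then show "l \<in> star_lab r ` E_set r k"
  proof cases
    case 1
    then show ?thesis by (intro image_eqI[of _ _ "C k (Suc l)"]) (auto simp: E_set_def)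
  next
    case 2
    define i where "i = (if k = 1 then r else k - 1)"
    \<comment> \<open>The cyclic predecessor as a linear disjunction, so that the wrap-around at 1
      stays within Presburger arithmetic.\<close>
    have i: "k = 1 \<and> i = r \<or> 1 < k \<and> k = i + 1" using k by (auto simp: i_def)
    have mem: "star_lab r (P k) \<in> star_lab r ` E_set r k" "star_lab r (J k) \<in> star_lab r ` E_set r k"
      "star_lab r (J i) \<in> star_lab r ` E_set r k"
      unfolding E_set_def idx_pred[OF k] i_def by blast+
    have "star_lab r (P k) = l \<or> star_lab r (J k) = l \<or> star_lab r (J i) = l"
    proof (cases "odd r")
      case True
      show ?thesis
        using 2
      proof (elim disjE)
        assume "l = r - 3"
        then show ?thesis
          by (simp only: star_lab_eq_iff[OF r] True if_True not_True_eq_False not_False_eq_True, insert True r k i, presburger)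
      next
        assume "l = r - 2"
        then show ?thesis
          by (simp only: star_lab_eq_iff[OF r] True if_True not_True_eq_False not_False_eq_True, insert True r k i, presburger)
      next
        assume "l = r - 1"
        then show ?thesis
          by (simp only: star_lab_eq_iff[OF r] True if_True not_True_eq_False not_False_eq_True, insert True r k i, presburger)
      qed
    next
      case False
      show ?thesis
        using 2
      proof (elim disjE)
        assume "l = r - 3"
        then show ?thesis
          by (simp only: star_lab_eq_iff[OF r] False if_False not_True_eq_False not_False_eq_True, insert False r k i, presburger)
      next
        assume "l = r - 2"
        then show ?thesis
          by (simp only: star_lab_eq_iff[OF r] False if_False not_True_eq_False not_False_eq_True, insert False r k i, presburger)
      next
        assume "l = r - 1"
        then show ?thesis
          by (simp only: star_lab_eq_iff[OF r] False if_False not_True_eq_False not_False_eq_True, insert False r k i, presburger)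
      qed
    qed
    then show ?thesis using mem by metis
  qed
qed

lemma lab_range:
  assumes "4 < r" "1 \<le> j" "j \<le> r" "x \<in> Omega r"
  shows "lab r j x < r"
proof (cases x)
  case (C i q)
  then show ?thesis using assms off_less[OF assms(2,3), of i] by (auto simp: labC_def)
next
  case (P i)
  then show ?thesis using assms off_less[OF assms(2,3), of i] by (auto simp: labP_def)
next
  case (J i)
  then show ?thesis using assms off_less[OF assms(2,3), of i] by (simp add: labJ_def)
qed

lemma star_lab_range:
  assumes "4 < r" "x \<in> Omega r"
  shows "star_lab r x < r"
proof (cases x)
  case (P i)
  show ?thesis using assms(1) unfolding P star_lab.simps by (simp only: split: if_split) (intro conjI impI; linarith)
next
  case (J i)
  show ?thesis using assms(1) unfolding J star_lab.simps by (simp only: split: if_split) (intro conjI impI; linarith)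
qed (use assms in auto)

text \<open>Only two kinds of pairs are non-transversal: \<open>E_set r j\<close> lies inside the
  first block of \<open>B_part r j\<close>, and \<open>C_set r s\<close> is itself a block of
  \<open>B_star r\<close>. Allowing any subset of the labellings serves both families at
  once.\<close>

lemma fibre_monoid_lab:
  assumes r: "4 < r" and \<L>: "\<L> \<subseteq> lab r ` {1..r} \<union> {star_lab r}"
  shows "fibre_monoid (Omega r) r \<L> (I_fam r)"
proof
  show "finite (Omega r)" by (rule finite_Omega)
  show "L ` Omega r = {..<r}" if "L \<in> \<L>" for L
  proof
    have cases: "L = star_lab r \<or> (\<exists>j\<in>{1..r}. L = lab r j)" using that \<L> by blast
    then show "L ` Omega r \<subseteq> {..<r}"
      using lab_range[OF r] star_lab_range[OF r] by auto
    have "{..<r} \<subseteq> L ` E_set r 1 \<or> {..<r} \<subseteq> L ` C_set r 1"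
      using cases
    proof (elim disjE bexE)
      fix j assume "j \<in> {1..r}" "L = lab r j"
      then show ?thesis using lab_transversal_C[OF r, of j 1] r by simp
    qed (use star_transversal_E[OF r, of 1] r in simp)
    moreover have "E_set r 1 \<subseteq> Omega r" "C_set r 1 \<subseteq> Omega r"
      using E_set_sub[of 1 r] C_set_sub[of 1 r] r by simp_all
    ultimately show "{..<r} \<subseteq> L ` Omega r"
      by (meson image_mono order_trans)
  qed
  fix I assume I: "I \<in> I_fam r"
  then have I_cases: "(\<exists>k\<in>{1..r}. I = E_set r k) \<or> (\<exists>s\<in>{1..r-3}. I = C_set r s)"
    by (auto simp: I_fam_def)
  then show "I \<subseteq> Omega r"
    by (elim disjE bexE) (use E_set_sub C_set_sub in auto)
  from I_cases show "card I = r"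
    by (elim disjE bexE) (simp_all add: card_E_set[OF r] card_C_set)
  fix L assume "L \<in> \<L>"
  then have "L = star_lab r \<or> (\<exists>j\<in>{1..r}. L = lab r j)"
    using \<L> by auto
  with I_cases show "(\<exists>l<r. L ` I \<subseteq> {l}) \<or> {..<r} \<subseteq> L ` I"
  proof (elim disjE bexE)
    fix k assume "L = star_lab r" "k \<in> {1..r}" "I = E_set r k"
    then show ?thesis using star_transversal_E[OF r] by auto
  next
    fix s assume "L = star_lab r" "s \<in> {1..r-3}" "I = C_set r s"
    then show ?thesis using star_C[of r s] r by (intro disjI1 exI[of _ "s - 1"]) auto
  next
    fix j k assume "j \<in> {1..r}" "L = lab r j" "k \<in> {1..r}" "I = E_set r k"
    then show ?thesis
      using lab_first_E[OF r, of j] lab_transversal_E[OF r, of j k] r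
      by (cases "k = j") (auto intro!: exI[of _ "r - 1"])
  next
    fix j s assume "j \<in> {1..r}" "L = lab r j" "s \<in> {1..r-3}" "I = C_set r s"
    then show ?thesis using lab_transversal_C[OF r, of j s] by simp
  qed
qed

text \<open>The sets \<open>E_set r i\<close> and \<open>E_set r (i + 1)\<close> share
  \<open>J i\<close>, which links all \<open>J\<close>-elements, starting from \<open>J r\<close> in
  \<open>E_set r 1\<close>. Every element lies in the \<open>E_set\<close> of its own index.\<close>

lemma Omega_connected:
  assumes r: "4 < r" and w: "w \<in> Omega r"
  shows "(J r, w) \<in> {(p, q). \<exists>I\<in>I_fam r. p \<in> I \<and> q \<in> I}\<^sup>*" (is "_ \<in> ?R\<^sup>*")
proof -
  have E: "(p, q) \<in> ?R" if "1 \<le> i" "i \<le> r" "p \<in> E_set r i" "q \<in> E_set r i" for p q i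
    using that by (auto simp: I_fam_def)
  have edge: "(J (if i = 1 then r else i - 1), x) \<in> ?R" if "1 \<le> i" "i \<le> r" "x \<in> E_set r i" for i x
    using that by (intro E[of i]) (simp_all add: E_set_def idx_pred[OF that(1,2), unfolded One_nat_def])
  have chain: "(J r, J i) \<in> ?R\<^sup>*" if "1 \<le> i" "i \<le> r" for i
    using that
  proof (induction i rule: dec_induct)
    case base
    have "(J r, J 1) \<in> ?R" using edge[of 1 "J 1"] r by (simp add: E_set_def)
    then show ?case by blast
  next
    case (step i)
    have "(J i, J (Suc i)) \<in> ?R"
      using edge[of "Suc i" "J (Suc i)"] step by (simp add: E_set_def)
    then show ?case using step by (auto intro: rtrancl_into_rtrancl)
  qed
  have "\<exists>i. 1 \<le> i \<and> i \<le> r \<and> w \<in> E_set r i"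
    using w by (cases w) (auto simp: E_set_def)
  then obtain i where i: "1 \<le> i" "i \<le> r" "w \<in> E_set r i" by blast
  have "(J r, J i) \<in> ?R\<^sup>*" using chain i by blast
  moreover have "(J i, w) \<in> ?R" using i by (intro E[of i]) (auto simp: E_set_def)
  ultimately show ?thesis by (rule rtrancl_into_rtrancl)
qed

section \<open>The cyclic family: a proper nonzero submodule\<close>

lemma not_simple_cyclic:
  assumes r: "4 < r"
  defines "M \<equiv> trans_monoid (Omega r) (B_fam' r) (I_fam r)"
  shows "left_module (monoid_algebra M) (aug_module (Omega r) M)"
    and "\<not> simple_left_module (monoid_algebra M) (aug_module (Omega r) M)"
proof -
  interpret fibre_monoid "Omega r" r "lab r ` {1..r}" "I_fam r"
    by (rule fibre_monoid_lab[OF r]) blast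
  have fam: "B_fam' r = fibres (Omega r) r ` lab r ` {1..r}"
    unfolding B_fam'_def image_image using B_part_fibres[OF r] by (intro image_cong) auto
  have M: "M = G" unfolding M_def G_def fam by (rule refl)
  show "left_module (monoid_algebra M) (aug_module (Omega r) M)"
    unfolding M by (rule left_module_aug)
  \<comment> \<open>Both indicator functions have all block sums equal to 1. The second set requires
    \<open>2 \<le> r - 3\<close>, that is, \<open>r > 4\<close>.\<close>
  define z :: "omega \<Rightarrow> complex" where
    "z = (\<lambda>w. of_bool (w \<in> C_set r 1) - of_bool (w \<in> C_set r 2))"
  have one: "bsum L (\<lambda>w. of_bool (w \<in> C_set r s)) l = 1"
    if L: "L \<in> lab r ` {1..r}" and "l < r" "1 \<le> s" "s \<le> r - 3" for L l s
  proof -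
    have I: "C_set r s \<in> I_fam r" using that by (simp add: I_fam_def)
    obtain j where j: "1 \<le> j" "j \<le> r" "L = lab r j" using L by auto
    have sub: "{..<r} \<subseteq> L ` C_set r s"
      unfolding j(3) using that by (intro lab_transversal_C[OF r j(1,2)])
    obtain x where "C_set r s \<inter> {x \<in> Omega r. L x = l} = {x}"
      using transversal[OF L I sub \<open>l < r\<close>] by blast
    then have "{v \<in> Omega r. L v = l} \<inter> {v. v \<in> C_set r s} = {x}" by blast
    then show ?thesis by (simp add: finite_Omega of_bool_def sum.If_cases)
  qed
  have null: "bsum L z l = 0" if "L \<in> lab r ` {1..r}" "l < r" for L l
    using one[OF that, of 1] one[OF that, of 2] r by (simp add: z_def sum_subtractf)
  have in1: "lab r 1 \<in> lab r ` {1..r}" using r by auto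
  show "\<not> simple_left_module (monoid_algebra M) (aug_module (Omega r) M)"
    unfolding M
  proof (rule not_simple_aug[OF _ _ null])
    have "(\<Sum>v\<in>Omega r. z v) = 0"
      using bsum_total[OF in1, of z] null[OF in1] by simp
    then show "z \<in> augmentation (Omega r)"
      using C_set_sub[of 1 r] C_set_sub[of 2 r] r
      by (auto simp: augmentation_def lin_comb_def z_def of_bool_def subset_iff)
    have "z (C 1 1) = 1" using r by (simp add: z_def C_set_def)
    then show "z \<noteq> (\<lambda>_. 0)" by auto
    \<comment> \<open>\<open>C 1 1\<close> lies in the first block of \<open>B_part r 1\<close> and
      \<open>C 2 1\<close> does not, so this vector has a nonzero block sum and keeps the submodule
      proper.\<close>
    show "delta (C 1 1) (C 2 1) \<in> augmentation (Omega r)"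
      using r by (intro delta_aug) auto
    show "lab r 1 \<in> lab r ` {1..r}" by (rule in1)
    show "r - 1 < r" using r by simp
    have "lab r 1 (C 1 1) = r - 1" "lab r 1 (C 2 1) \<noteq> r - 1"
      using r by (auto simp: labC_def off_def)
    then show "bsum (lab r 1) (delta (C 1 1) (C 2 1)) (r - 1) \<noteq> 0"
      using r by (simp add: delta_def sum_subtractf of_bool_def finite_Omega)
  qed
qed

section \<open>Vectors with vanishing block sums\<close>

text \<open>Diagonal \<open>d\<close> meets row \<open>q\<close> in column \<open>tau r d q\<close>; its entries in the last two rows form
  \<open>tail r j d\<close>.\<close>

definition tau :: "nat \<Rightarrow> nat \<Rightarrow> nat \<Rightarrow> nat" where
  "tau r d q = (if q < d then d - q else d + (r - 1) - q)"

definition tail :: "nat \<Rightarrow> nat \<Rightarrow> nat \<Rightarrow> omega set" where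
  "tail r j d = (if d = 0 then {P (idx r (j + 1)), P (idx r (j + (r - 1)))}
     else if even d \<and> d \<noteq> r - 2 then {P (idx r (j + d)), P (idx r (j + (d + 1)))}
     else {J (idx r (j + d))})"

lemma labC_eq_iff:
  "4 < r \<Longrightarrow> t < r \<Longrightarrow> d < r - 1 \<Longrightarrow> 1 \<le> q \<Longrightarrow> q \<le> r - 3 \<Longrightarrow> labC r q t = d \<longleftrightarrow> t = tau r d q"
  unfolding labC_def tau_def by auto

text \<open>Diagonal \<open>d > 0\<close> meets row \<open>r - 1\<close> in column \<open>d\<close>
  and row \<open>r - 2\<close> in column \<open>d + 1\<close>. For even \<open>d\<close> other than
  \<open>r - 2\<close> both cells hold a \<open>P\<close>; otherwise the first holds a
  \<open>J\<close> and the second is blank. Diagonal 0 meets the two rows in the columns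
  \<open>r - 1\<close> and 1.\<close>

lemma labP_eq_iff:
  assumes "4 < r" "t < r" "d < r - 1"
  shows "labP r t = d \<longleftrightarrow>
    (if d = 0 then t = 1 \<or> t = r - 1 else even d \<and> d \<noteq> r - 2 \<and> (t = d \<or> t = d + 1))"
proof -
  consider "t = 0" | "t = r - 1" | "0 < t" "t < r - 1" "even r \<and> t = r - 2"
    | "0 < t" "t < r - 1" "\<not> (even r \<and> t = r - 2)" "odd t"
    | "0 < t" "t < r - 1" "\<not> (even r \<and> t = r - 2)" "even t"
    using assms by linarith
  then show ?thesis
  proof cases
    case 1
    have L: "labP r t = r - 1" unfolding labP_def if_P[OF 1] ..
    show ?thesis
    proof (cases "d = 0")
      case True
      show ?thesis unfolding L if_P[OF True] using 1 True assms by auto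
    next
      case False
      show ?thesis unfolding L if_not_P[OF False] using 1 False assms by auto
    qed
  next
    case 2
    have L: "labP r t = 0" unfolding labP_def using 2 assms by simp
    show ?thesis
    proof (cases "d = 0")
      case True
      show ?thesis unfolding L if_P[OF True] using 2 True by auto
    next
      case False
      have "r - 1 = d + 1 \<Longrightarrow> d = r - 2" by simp
      then show ?thesis unfolding L if_not_P[OF False] using 2 False assms(3) by auto
    qed
  next
    case 3
    have L: "labP r t = r - 1" unfolding labP_def if_P[OF 3(3)] using 3(1,2) by simp
    show ?thesis
    proof (cases "d = 0")
      case True
      show ?thesis unfolding L if_P[OF True] using 3(1-3) True assms(1) by auto
    next
      case False
      have "even t" using 3(3) assms by simp
      then have "even d \<Longrightarrow> t \<noteq> d + 1" by auto
      moreover have "r - 1 \<noteq> d" using assms(3) by simp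
      ultimately show ?thesis unfolding L if_not_P[OF False] using 3(3) by blast
    qed
  next
    case 4
    have L: "labP r t = t - 1" unfolding labP_def if_not_P[OF 4(3)] using 4(1,2,4) by simp
    show ?thesis
    proof (cases "d = 0")
      case True
      show ?thesis unfolding L if_P[OF True] using 4(1,2) True by auto
    next
      case False
      obtain k where k: "t = Suc k" using 4(1) by (cases t) auto
      have "even k" "k \<noteq> r - 2" using 4(2,4) by (auto simp: k)
      then show ?thesis unfolding L if_not_P[OF False] unfolding k by (cases "k = d") auto
    qed
  next
    case 5
    have L: "labP r t = t" unfolding labP_def if_not_P[OF 5(3)] using 5(1,2,4) by simp
    show ?thesis
    proof (cases "d = 0")
      case True
      show ?thesis unfolding L if_P[OF True] using 5(1,2,4) True by auto
    next
      case False
      have "even (r - 2) \<Longrightarrow> even r" using assms(1) by simp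
      then have "t \<noteq> r - 2" using 5(3,4) by blast
      with 5(4) show ?thesis unfolding L if_not_P[OF False] by (cases "t = d") auto
    qed
  qed
qed

lemma labJ_eq_iff:
  assumes "4 < r" "t < r" "d < r - 1"
  shows "labJ r t = d \<longleftrightarrow> d \<noteq> 0 \<and> \<not> (even d \<and> d \<noteq> r - 2) \<and> t = d"
proof -
  have "odd t \<or> even r \<and> t = r - 2 \<longleftrightarrow> t \<noteq> 0 \<and> \<not> (even t \<and> t \<noteq> r - 2)"
    using assms by presburger
  then show ?thesis using assms by (auto simp: labJ_def)
qed

lemma lab_fibre:
  assumes r: "4 < r" and j: "1 \<le> j" "j \<le> r" and d: "d < r - 1"
  shows "{x \<in> Omega r. lab r j x = d} =
    (\<lambda>q. C (idx r (j + tau r d q)) q) ` {1..r-3} \<union> tail r j d"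
proof (rule Set.set_eqI)
  fix x
  show "x \<in> {x \<in> Omega r. lab r j x = d} \<longleftrightarrow>
    x \<in> (\<lambda>q. C (idx r (j + tau r d q)) q) ` {1..r-3} \<union> tail r j d"
  proof (cases x)
    case (C i q)
    have tau: "tau r d q < r" if "1 \<le> q" "q \<le> r - 3"
      using that d by (auto simp: tau_def)
    have "x \<in> {x \<in> Omega r. lab r j x = d} \<longleftrightarrow>
        (1 \<le> q \<and> q \<le> r - 3) \<and> 1 \<le> i \<and> i \<le> r \<and> off r j i = tau r d q"
      proof (cases "x \<in> Omega r")
      case True
      then show ?thesis using labC_eq_iff[OF r off_less[OF j] d, of i q] by (simp add: C)
    next
      case False
      then show ?thesis by (auto simp: C)
    qed
    also have "\<dots> \<longleftrightarrow> (1 \<le> q \<and> q \<le> r - 3) \<and> i = idx r (j + tau r d q)"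
      using idx_eq_iff[OF j tau] by blast
    finally show ?thesis by (auto simp: C tail_def)
  next
    case (P i)
    have "x \<in> {x \<in> Omega r. lab r j x = d} \<longleftrightarrow> 1 \<le> i \<and> i \<le> r \<and>
        (if d = 0 then off r j i = 1 \<or> off r j i = r - 1
         else even d \<and> d \<noteq> r - 2 \<and> (off r j i = d \<or> off r j i = d + 1))"
      proof (cases "x \<in> Omega r")
      case True
      then show ?thesis using labP_eq_iff[OF r off_less[OF j] d, of i] by (simp add: P)
    next
      case False
      then show ?thesis by (auto simp: P)
    qed
    also have "\<dots> \<longleftrightarrow> (if d = 0 then i = idx r (j + 1) \<or> i = idx r (j + (r - 1))
         else even d \<and> d \<noteq> r - 2 \<and> (i = idx r (j + d) \<or> i = idx r (j + (d + 1))))"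
      using idx_eq_iff[OF j, of 1 i] idx_eq_iff[OF j, of "r - 1" i] idx_eq_iff[OF j, of d i]
        idx_eq_iff[OF j, of "d + 1" i] r d by auto
    finally show ?thesis by (auto simp: P tail_def)
  next
    case (J i)
    have "x \<in> {x \<in> Omega r. lab r j x = d} \<longleftrightarrow> 
        (d \<noteq> 0 \<and> \<not> (even d \<and> d \<noteq> r - 2)) \<and> (1 \<le> i \<and> i \<le> r \<and> off r j i = d)"
      proof (cases "x \<in> Omega r")
      case True
      then show ?thesis using labJ_eq_iff[OF r off_less[OF j] d, of i] by (simp add: J)
    next
      case False
      then show ?thesis by (auto simp: J)
    qed
    also have "\<dots> \<longleftrightarrow> (d \<noteq> 0 \<and> \<not> (even d \<and> d \<noteq> r - 2)) \<and> i = idx r (j + d)"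
      using idx_eq_iff[OF j, of d i] d by auto
    finally show ?thesis by (auto simp: J tail_def)
  qed
qed

lemma idx_add_r: "1 \<le> i \<Longrightarrow> i \<le> r \<Longrightarrow> idx r (i + r) = i"
  by (cases "i = r") (auto simp: idx_def)

lemma idx_inj:
  "1 \<le> j \<Longrightarrow> j \<le> r \<Longrightarrow> k < r \<Longrightarrow> l < r \<Longrightarrow> idx r (j + k) = idx r (j + l) \<longleftrightarrow> k = l"
  by (metis off_idx)

lemma sum_lab_fibre:
  fixes x :: "omega \<Rightarrow> complex"
  assumes r: "4 < r" and j: "1 \<le> j" "j \<le> r" and d: "d < r - 1"
  shows "(\<Sum>v\<in>{v \<in> Omega r. lab r j v = d}. x v) =
    (\<Sum>q=1..r-3. x (C (idx r (j + tau r d q)) q)) + (\<Sum>v\<in>tail r j d. x v)"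
proof -
  have "(\<Sum>v\<in>{v \<in> Omega r. lab r j v = d}. x v) =
      (\<Sum>v\<in>(\<lambda>q. C (idx r (j + tau r d q)) q) ` {1..r-3}. x v) + (\<Sum>v\<in>tail r j d. x v)"
    unfolding lab_fibre[OF assms] by (intro sum.union_disjoint) (auto simp: tail_def)
  also have "(\<Sum>v\<in>(\<lambda>q. C (idx r (j + tau r d q)) q) ` {1..r-3}. x v) =
      (\<Sum>q=1..r-3. x (C (idx r (j + tau r d q)) q))"
    by (subst sum.reindex) (auto simp: inj_on_def)
  finally show ?thesis .
qed

lemma sum_tail:
  fixes x :: "omega \<Rightarrow> complex"
  assumes r: "4 < r" and j: "1 \<le> j" "j \<le> r" and d: "d < r - 1"
  shows "(\<Sum>v\<in>tail r j d. x v) =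
    (if d = 0 then x (P (idx r (j + 1))) + x (P (idx r (j + (r - 1))))
     else if even d \<and> d \<noteq> r - 2 then x (P (idx r (j + d))) + x (P (idx r (j + (d + 1))))
     else x (J (idx r (j + d))))"
  using idx_inj[OF j, of 1 "r - 1"] idx_inj[OF j, of d "d + 1"] r d
  by (simp add: tail_def)

lemma alternating_sum_zero: "(\<Sum>q=1..2*n. if odd q then g else - g) = 0" for n :: nat and g :: complex
  by (induction n) simp_all

lemma cancel_common:
  fixes X Y :: complex
  assumes "A = B" "A + X = 0" "B + Y = 0"
  shows "X = Y"
  using assms by (metis add_left_cancel)

lemma cancel_remainder:
  fixes X Y :: complex
  assumes "A = a + R" "B = b + S" "R = S" "A + X = 0" "B + Y = 0"
  shows "a + X = b + Y"
proof -
  have "R + (a + X) = 0" "R + (b + Y) = 0"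
    using assms by (simp_all add: add_ac)
  then show ?thesis by (metis add_left_cancel)
qed

text \<open>The bound \<open>j \<le> r - 1\<close> reflects the absence of
  \<open>B_part r r\<close>. Relations between the tables for \<open>j\<close> and
  \<open>j + 1\<close> are therefore available only while \<open>j + 1 \<le> r - 1\<close>.\<close>

locale null_vector =
  fixes r :: nat and x :: "omega \<Rightarrow> complex"
  assumes r: "4 < r"
    and null_lab: "1 \<le> j \<Longrightarrow> j \<le> r - 1 \<Longrightarrow> l < r \<Longrightarrow> (\<Sum>v\<in>{v \<in> Omega r. lab r j v = l}. x v) = 0"
    and null_star: "l < r \<Longrightarrow> (\<Sum>v\<in>{v \<in> Omega r. star_lab r v = l}. x v) = 0"
begin

abbreviation p :: "nat \<Rightarrow> complex" where "p i \<equiv> x (P i)"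
abbreviation m :: "nat \<Rightarrow> complex" where "m i \<equiv> x (J i)"
abbreviation c :: "nat \<Rightarrow> nat \<Rightarrow> complex" where "c i q \<equiv> x (C i q)"

text \<open>The contribution of \<open>tail r j d\<close> to the sum over diagonal \<open>d\<close>,
  that is, what remains beside the \<open>C\<close>-entries.\<close>

definition T :: "nat \<Rightarrow> nat \<Rightarrow> complex" where
  "T j d = (if d = 0 then p (idx r (j + 1)) + p (idx r (j + (r - 1)))
     else if even d \<and> d \<noteq> r - 2 then p (idx r (j + d)) + p (idx r (j + (d + 1)))
     else m (idx r (j + d)))"

lemma diag_zero:
  assumes "1 \<le> j" "j \<le> r - 1" "d < r - 1"
  shows "(\<Sum>q=1..r-3. c (idx r (j + tau r d q)) q) + T j d = 0"
  using sum_lab_fibre[OF r, of j d x] sum_tail[OF r, of j d x] null_lab[of j d] assms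
  by (simp add: T_def)

text \<open>In rows 1 to \<open>r - 3\<close>, diagonal 0 avoids column 1, and diagonal
  \<open>r - 2\<close> of the next table avoids its last column. So no \<open>C\<close>-entry leaves
  or enters, the two blocks have the same \<open>C\<close>-elements, and their tails have equal
  sums. \<open>T_one_zero\<close> works in the same way.\<close>

lemma T_zero_last:
  assumes "1 \<le> j" "j + 1 \<le> r - 1"
  shows "T j 0 = T (j + 1) (r - 2)"
proof -
  have "(\<Sum>q=1..r-3. c (idx r (j + tau r 0 q)) q) = (\<Sum>q=1..r-3. c (idx r (j + 1 + tau r (r - 2) q)) q)"
  proof (rule sum.cong[OF refl])
    fix q assume "q \<in> {1..r-3}"
    then have "j + tau r 0 q = j + 1 + tau r (r - 2) q" using r by (auto simp: tau_def)
    then show "c (idx r (j + tau r 0 q)) q = c (idx r (j + 1 + tau r (r - 2) q)) q" by simp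
  qed
  moreover have "(\<Sum>q=1..r-3. c (idx r (j + tau r 0 q)) q) + T j 0 = 0"
    using assms r by (intro diag_zero) auto
  moreover have "(\<Sum>q=1..r-3. c (idx r (j + 1 + tau r (r - 2) q)) q) + T (j + 1) (r - 2) = 0"
    using assms r by (intro diag_zero) auto
  ultimately show ?thesis by (rule cancel_common)
qed

lemma T_one_zero:
  assumes "1 \<le> j" "j + 1 \<le> r - 1"
  shows "T j 1 = T (j + 1) 0"
proof -
  have "(\<Sum>q=1..r-3. c (idx r (j + tau r 1 q)) q) = (\<Sum>q=1..r-3. c (idx r (j + 1 + tau r 0 q)) q)"
  proof (rule sum.cong[OF refl])
    fix q assume "q \<in> {1..r-3}"
    then have "j + tau r 1 q = j + 1 + tau r 0 q" using r by (auto simp: tau_def)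
    then show "c (idx r (j + tau r 1 q)) q = c (idx r (j + 1 + tau r 0 q)) q" by simp
  qed
  moreover have "(\<Sum>q=1..r-3. c (idx r (j + tau r 1 q)) q) + T j 1 = 0"
    using assms r by (intro diag_zero) auto
  moreover have "(\<Sum>q=1..r-3. c (idx r (j + 1 + tau r 0 q)) q) + T (j + 1) 0 = 0"
    using assms r by (intro diag_zero) auto
  ultimately show ?thesis by (rule cancel_common)
qed

text \<open>Passing from \<open>B_part r j\<close> to \<open>B_part r (j + 1)\<close> shifts every diagonal by one column, so
  the corresponding blocks share all \<open>C\<close>-elements except the one that leaves and the one that
  enters the table.\<close>

lemma c_step:
  assumes "1 \<le> j" "j + 1 \<le> r - 1" and s: "1 \<le> s" "s \<le> r - 3"
  shows "c (j + 1) s + T j (s + 1) = c j s + T (j + 1) s"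
proof -
  let ?A = "{1..r-3} - {s}"
  have "(\<Sum>q=1..r-3. c (idx r (j + tau r (s + 1) q)) q) =
      c (idx r (j + tau r (s + 1) s)) s + (\<Sum>q\<in>?A. c (idx r (j + tau r (s + 1) q)) q)"
    using s by (intro sum.remove) auto
  moreover have "(\<Sum>q=1..r-3. c (idx r (j + 1 + tau r s q)) q) =
      c (idx r (j + 1 + tau r s s)) s + (\<Sum>q\<in>?A. c (idx r (j + 1 + tau r s q)) q)"
    using s by (intro sum.remove) auto
  moreover have "(\<Sum>q\<in>?A. c (idx r (j + tau r (s + 1) q)) q) = (\<Sum>q\<in>?A. c (idx r (j + 1 + tau r s q)) q)"
  proof (rule sum.cong[OF refl])
    fix q assume "q \<in> ?A"
    then have "j + tau r (s + 1) q = j + 1 + tau r s q" using r by (auto simp: tau_def)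
    then show "c (idx r (j + tau r (s + 1) q)) q = c (idx r (j + 1 + tau r s q)) q" by simp
  qed
  moreover have "(\<Sum>q=1..r-3. c (idx r (j + tau r (s + 1) q)) q) + T j (s + 1) = 0"
    using assms r by (intro diag_zero) auto
  moreover have "(\<Sum>q=1..r-3. c (idx r (j + 1 + tau r s q)) q) + T (j + 1) s = 0"
    using assms r by (intro diag_zero) auto
  ultimately have "c (idx r (j + tau r (s + 1) s)) s + T j (s + 1) =
      c (idx r (j + 1 + tau r s s)) s + T (j + 1) s"
    by (rule cancel_remainder)
  \<comment> \<open>In row \<open>s\<close>, diagonal \<open>s + 1\<close> of the table for
    \<open>j\<close> is in column 1, hence at index \<open>j + 1\<close>; diagonal \<open>s\<close>
    of the table for \<open>j + 1\<close> is in column \<open>r - 1\<close>, hence at index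
    \<open>j\<close>.\<close>
  moreover have "idx r (j + tau r (s + 1) s) = j + 1" "idx r (j + 1 + tau r s s) = j"
    using assms r by (auto simp: tau_def idx_def)
  ultimately show ?thesis by simp
qed

text \<open>The instance \<open>j = 1\<close> of \<open>T_zero_last\<close>, where the index
  \<open>j - 1\<close> wraps to \<open>r\<close>. The instances with larger \<open>j\<close> give
  \<open>m_up\<close>.\<close>

lemma m_r: "m r = p 2 + p r"
proof -
  have "T 1 0 = p 2 + p r" using r by (simp add: T_def idx_def numeral_2_eq_2)
  moreover have "2 + (r - 2) = r" using r by simp
  then have "T 2 (r - 2) = m r" using r idx_self[of r r] by (simp add: T_def)
  moreover have "T 1 0 = T (1 + 1) (r - 2)" using r by (intro T_zero_last) auto
  ultimately show ?thesis by (simp only: one_add_one)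
qed

lemma m_up:
  assumes "1 \<le> i" "i \<le> r - 3"
  shows "m i = p i + p (i + 2)"
proof -
  have eqs: "i + 1 + 1 = i + 2" "i + 1 + (r - 1) = i + r" "i + 2 + (r - 2) = i + r"
    using r by simp_all
  have idx: "idx r (i + 2) = i + 2" "idx r (i + r) = i"
    using assms r by (auto intro: idx_self idx_add_r)
  have "T (i + 1) 0 = p i + p (i + 2)"
    unfolding T_def eqs idx by (simp only: add.commute if_True refl)
  moreover have "T (i + 2) (r - 2) = m i"
    unfolding T_def eqs idx using r by simp
  moreover have "T (i + 1) 0 = T (i + 1 + 1) (r - 2)"
    using assms r by (intro T_zero_last) linarith+
  ultimately show ?thesis by (simp only: eqs)
qed

text \<open>A second expression for the same coefficient, from \<open>T_one_zero\<close>. On the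
  common range it can be equated with \<open>m_up\<close>, which is the source of the recurrence for
  \<open>p\<close>.\<close>

lemma m_down:
  assumes "2 \<le> i" "i \<le> r - 1"
  shows "m i = p (i + 1) + p (i - 1)"
proof -
  define j where "j = i - 1"
  have j: "i = j + 1" "i - 1 = j" "i + 1 = j + 2" "1 \<le> j" "j + 2 \<le> r"
    using assms by (simp_all add: j_def)
  have "idx r (j + 1) = j + 1" using j by (intro idx_self) auto
  then have T1: "T j 1 = m (j + 1)" by (simp add: T_def)
  have "j + 1 + 1 = j + 2" "j + 1 + (r - 1) = j + r" using r by simp_all
  moreover have "idx r (j + 2) = j + 2" using j by (intro idx_self) auto
  moreover have "idx r (j + r) = j" using j by (intro idx_add_r) auto
  ultimately have T0: "T (j + 1) 0 = p (j + 2) + p j"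
    unfolding T_def by (simp only: if_True refl)
  have "T j 1 = T (j + 1) 0" using j by (intro T_one_zero) auto
  then show ?thesis unfolding j(2,3) unfolding j(1) T1 T0 .
qed

text \<open>In row \<open>q\<close>, the diagonals 0 and \<open>r - 2\<close> of the first table
  have their \<open>C\<close>-entries at the indices \<open>r - q\<close> and
  \<open>r - 1 - q\<close>. By \<open>c_step\<close> each difference is \<open>g\<close>,
  \<open>- g\<close> or 0, and the differences sum to zero, so \<open>T 1 0 = T 1 (r - 2)\<close>.
  The result ties the start of the antiperiodic sequence to its end.\<close>

lemma p_2: "p 2 = p (r - 2)"
proof -
  \<comment> \<open>The steps are taken where both tails begin at index \<open>r\<close>, whose
    successor is 1, so only \<open>m r\<close> and \<open>p r + p 1\<close> can occur.\<close>
  define g where "g = m r - (p r + p 1)"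
  have diff: "c (r - q) q - c (r - 1 - q) q = (if odd q then if q = r - 3 then 0 else g else - g)"
    if q: "q \<in> {1..r-3}" for q
  proof -
    define j where "j = r - 1 - q"
    have j: "1 \<le> j" "j + 1 \<le> r - 1" "j + 1 = r - q" "j + (q + 1) = r" "j + (q + 2) = r + 1"
      using q r by (auto simp: j_def)
    have idx: "idx r r = r" "idx r (r + 1) = 1"
      using r idx_self[of r r] idx_add_r[of 1 r] by (simp_all add: add.commute)
    have "q + 1 \<noteq> r - 2 \<longleftrightarrow> q \<noteq> r - 3" using r by arith
    moreover have j5: "j + (q + 1 + 1) = r + 1" using j(4) by simp
    ultimately have "T j (q + 1) = (if odd q \<and> q \<noteq> r - 3 then p r + p 1 else m r)"
      unfolding T_def j(4) j5 idx by simp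
    moreover have "T (j + 1) q = (if even q then p r + p 1 else m r)"
    proof -
      have *: "j + 1 + q = r" "j + 1 + (q + 1) = r + 1" using j by simp_all
      show ?thesis unfolding T_def * idx using q r by auto
    qed
    ultimately have "c (r - q) q - c j q =
       (if even q then p r + p 1 else m r) - (if odd q \<and> q \<noteq> r - 3 then p r + p 1 else m r)"
      using c_step[OF j(1,2), of q] q j(3) by (simp add: algebra_simps)
    then show ?thesis unfolding j_def[symmetric] g_def by auto
  qed
  \<comment> \<open>Consecutive terms cancel in pairs. For even \<open>r\<close> the number of terms
    is odd, and the unpaired last one is zero by the exceptional diagonal
    \<open>r - 2\<close>.\<close>
  have zero: "(\<Sum>q=1..r-3. if odd q then if q = r - 3 then 0 else g else - g) = 0"
  proof (cases "odd r")
    case True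
    then have "even (r - 3)" by simp
    then obtain n where n: "r - 3 = 2 * n" by (elim evenE)
    have "(\<Sum>q=1..r-3. if odd q then if q = r - 3 then 0 else g else - g) =
        (\<Sum>q=1..2*n. if odd q then g else - g)"
      unfolding n by (intro sum.cong refl) auto
    then show ?thesis by (simp only: alternating_sum_zero)
  next
    case False
    then have "odd (r - 3)" using r by simp
    then obtain n where "r - 3 = 2 * n + 1" by (elim oddE)
    then have n: "r - 3 = Suc (2 * n)" by simp
    have "(\<Sum>q=1..r-3. if odd q then if q = r - 3 then 0 else g else - g) =
        (\<Sum>q=1..2*n. if odd q then g else - g)"
      unfolding n by (simp, intro sum.cong refl) auto
    then show ?thesis by (simp only: alternating_sum_zero)
  qed
  have S0: "(\<Sum>q=1..r-3. c (idx r (1 + tau r 0 q)) q) = (\<Sum>q=1..r-3. c (r - q) q)"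
  proof (rule sum.cong[OF refl])
    fix q assume "q \<in> {1..r-3}"
    then have "1 + tau r 0 q = r - q" "1 \<le> r - q" using r by (auto simp: tau_def)
    then show "c (idx r (1 + tau r 0 q)) q = c (r - q) q" by (simp add: idx_self)
  qed
  have S1: "(\<Sum>q=1..r-3. c (idx r (1 + tau r (r - 2) q)) q) = (\<Sum>q=1..r-3. c (r - 1 - q) q)"
  proof (rule sum.cong[OF refl])
    fix q assume "q \<in> {1..r-3}"
    then have "1 + tau r (r - 2) q = r - 1 - q" "1 \<le> r - 1 - q" using r by (auto simp: tau_def)
    then show "c (idx r (1 + tau r (r - 2) q)) q = c (r - 1 - q) q" by (simp add: idx_self)
  qed
  have S01: "(\<Sum>q=1..r-3. c (r - q) q) - (\<Sum>q=1..r-3. c (r - 1 - q) q) = 0"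
    unfolding sum_subtractf[symmetric] by (rule trans[OF sum.cong[OF refl diff] zero])
  have "1 + (r - 2) = r - 1" using r by simp
  then have T: "T 1 0 = p 2 + p r" "T 1 (r - 2) = m (r - 1)"
    using r by (simp_all add: T_def idx_def numeral_2_eq_2)
  have mr: "m (r - 1) = p r + p (r - 2)"
  proof -
    have "r - 1 + 1 = r" "r - 1 - 1 = r - 2" using r by auto
    then show ?thesis using m_down[of "r - 1"] r by simp
  qed
  have "p 2 + p r = p r + p (r - 2)"
  proof (rule cancel_common)
    show "(\<Sum>q=1..r-3. c (r - q) q) = (\<Sum>q=1..r-3. c (r - 1 - q) q)" using S01 by simp
    show "(\<Sum>q=1..r-3. c (r - q) q) + (p 2 + p r) = 0"
      unfolding S0[symmetric] T(1)[symmetric] using r by (intro diag_zero) auto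
    show "(\<Sum>q=1..r-3. c (r - 1 - q) q) + (p r + p (r - 2)) = 0"
      unfolding S1[symmetric] mr[symmetric] T(2)[symmetric] using r by (intro diag_zero) auto
  qed
  then show ?thesis by simp
qed

lemma star_sum:
  assumes "{v \<in> Omega r. star_lab r v = l} = A" "l < r"
  shows "(\<Sum>v\<in>A. x v) = 0"
  using null_star[of l] assms by simp

lemma star_C_sum:
  assumes "1 \<le> s" "s \<le> r - 3"
  shows "(\<Sum>i=1..r. c i s) = 0"
proof -
  have "(\<Sum>v\<in>C_set r s. x v) = 0"
    using assms by (intro star_sum[of "s - 1"]) (auto simp: C_set_star)
  moreover have "C_set r s = (\<lambda>i. C i s) ` {1..r}" by (auto simp: C_set_def)
  ultimately show ?thesis by (simp add: sum.reindex inj_on_def)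
qed

end

text \<open>The solution of \<open>h (i + 2) = - h i\<close> with the values \<open>A\<close> at 1
  and \<open>B\<close> at 2.\<close>

definition per4 :: "complex \<Rightarrow> complex \<Rightarrow> nat \<Rightarrow> complex" where
  "per4 A B i = (if i mod 4 = 1 then A else if i mod 4 = 2 then B else if i mod 4 = 3 then - A else - B)"

lemma per4_add_2: "per4 A B (i + 2) = - per4 A B i"
proof -
  have "i mod 4 = 0 \<and> (i + 2) mod 4 = 2 \<or> i mod 4 = 1 \<and> (i + 2) mod 4 = 3 \<or>
      i mod 4 = 2 \<and> (i + 2) mod 4 = 0 \<or> i mod 4 = 3 \<and> (i + 2) mod 4 = 1"
    by presburger
  then show ?thesis by (auto simp: per4_def)
qed

lemma sum_per4:
  "(\<Sum>i=1..n. per4 A B i) =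
    (if n mod 4 = 1 then A else if n mod 4 = 2 then A + B else if n mod 4 = 3 then B else 0)"
proof (induction n)
  case (Suc n)
  have "n mod 4 = 0 \<and> Suc n mod 4 = 1 \<or> n mod 4 = 1 \<and> Suc n mod 4 = 2 \<or>
      n mod 4 = 2 \<and> Suc n mod 4 = 3 \<or> n mod 4 = 3 \<and> Suc n mod 4 = 0"
    by presburger
  then show ?case using Suc by (auto simp: per4_def)
qed simp

lemma antiperiodic_eq_per4:
  assumes step: "\<And>i. 1 \<le> i \<Longrightarrow> i + 2 \<le> n \<Longrightarrow> h (i + 2) = - h i"
  shows "1 \<le> i \<Longrightarrow> i \<le> n \<Longrightarrow> h i = per4 (h 1) (h 2) i"
proof (induction i rule: less_induct)
  case (less i)
  consider "i = 1" | "i = 2" | k where "i = k + 2" "1 \<le> k"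
    using less.prems(1) by (metis One_nat_def Suc_1 add_2_eq_Suc' le_SucE le_add_diff_inverse2 not_less_eq_eq)
  then show ?case
  proof cases
    case 3
    then have "h (k + 2) = - per4 (h 1) (h 2) k"
      using step[of k] less.IH[of k] less.prems by simp
    then show ?thesis unfolding 3(1) per4_add_2 .
  qed (simp_all add: per4_def)
qed

text \<open>Solves a linear equation by rearrangement: the second premise becomes a polynomial
  identity that normalisation verifies.\<close>

lemma eq_if_diff: "E = 0 \<Longrightarrow> X - Y = E \<Longrightarrow> X = Y" for X Y E :: complex
  by simp

lemma eq_if_diff_uminus: "E = 0 \<Longrightarrow> X - Y = - E \<Longrightarrow> X = Y" for X Y E :: complex
  by simp

lemma sum_even_const:
  assumes "\<And>i. even i \<Longrightarrow> 2 * a \<le> i \<Longrightarrow> i \<le> 2 * b \<Longrightarrow> f i = (z :: complex)"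
  shows "(\<Sum>i | even i \<and> 2 * a \<le> i \<and> i \<le> 2 * b. f i) = of_nat (Suc b - a) * z"
proof -
  have "(\<Sum>i | even i \<and> 2 * a \<le> i \<and> i \<le> 2 * b. f i) = (\<Sum>i | even i \<and> 2 * a \<le> i \<and> i \<le> 2 * b. z)"
    using assms by (intro sum.cong) auto
  moreover have "{i. even i \<and> 2 * a \<le> i \<and> i \<le> 2 * b} = (\<lambda>k. 2 * k) ` {a..b}"
    by (auto elim!: evenE)
  then have "card {i. even i \<and> 2 * a \<le> i \<and> i \<le> 2 * b} = Suc b - a"
    by (simp add: card_image inj_on_def)
  ultimately show ?thesis by simp
qed

lemma sum_odd_const:
  assumes "\<And>i. odd i \<Longrightarrow> 2 * a + 1 \<le> i \<Longrightarrow> i \<le> 2 * b + 1 \<Longrightarrow> f i = (z :: complex)"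
  shows "(\<Sum>i | odd i \<and> 2 * a + 1 \<le> i \<and> i \<le> 2 * b + 1. f i) = of_nat (Suc b - a) * z"
proof -
  have "(\<Sum>i | odd i \<and> 2 * a + 1 \<le> i \<and> i \<le> 2 * b + 1. f i) =
      (\<Sum>i | odd i \<and> 2 * a + 1 \<le> i \<and> i \<le> 2 * b + 1. z)"
    using assms by (intro sum.cong) auto
  moreover have "{i. odd i \<and> 2 * a + 1 \<le> i \<and> i \<le> 2 * b + 1} = (\<lambda>k. 2 * k + 1) ` {a..b}"
    by (auto elim!: oddE)
  then have "card {i. odd i \<and> 2 * a + 1 \<le> i \<and> i \<le> 2 * b + 1} = Suc b - a"
    by (simp add: card_image inj_on_def)
  ultimately show ?thesis by simp
qed

lemma sum_Un_image:
  fixes x :: "omega \<Rightarrow> complex"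
  assumes "finite X" "finite {i. Q i}" "inj F" "\<And>i. Q i \<Longrightarrow> F i \<notin> X"
  shows "(\<Sum>v\<in>X \<union> {F i |i. Q i}. x v) = (\<Sum>v\<in>X. x v) + (\<Sum>i | Q i. x (F i))"
proof -
  have "{F i |i. Q i} = F ` {i. Q i}" by auto
  moreover have "(\<Sum>v\<in>F ` {i. Q i}. x v) = (\<Sum>i | Q i. x (F i))"
    using assms(3) by (subst sum.reindex) (auto intro: inj_on_subset)
  moreover have "X \<inter> F ` {i. Q i} = {}" using assms(4) by auto
  ultimately show ?thesis using assms(1,2) by (simp add: sum.union_disjoint)
qed

lemma inj_omega: "inj J" "inj P"
  by (auto simp: inj_def)

lemma diff_mod_4:
  fixes r :: nat
  assumes "4 < r"
  shows "(r - 2) mod 4 = (r mod 4 + 2) mod 4" "(r - 1) mod 4 = (r mod 4 + 3) mod 4"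
proof -
  have "r - 2 + 4 = r + 2" "r - 1 + 4 = r + 3" using assms by simp_all
  then show "(r - 2) mod 4 = (r mod 4 + 2) mod 4" "(r - 1) mod 4 = (r mod 4 + 3) mod 4"
    by (metis mod_add_self2 mod_add_left_eq)+
qed

section \<open>Solving the linear system\<close>

context null_vector
begin

definition \<alpha> :: complex where "\<alpha> = (p 1 + p 3) / 2"

text \<open>Equating \<open>m_up\<close> and \<open>m_down\<close> at \<open>i + 1\<close> shows
  that \<open>p i + p (i + 2)\<close> does not change with \<open>i\<close>; \<open>\<alpha>\<close>
  is half the common value, so \<open>p i - \<alpha>\<close> changes sign under a shift by
  2.\<close>

lemma p_pair: "1 \<le> i \<Longrightarrow> i \<le> r - 3 \<Longrightarrow> p i + p (i + 2) = 2 * \<alpha>"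
proof (induction i rule: dec_induct)
  case base
  show ?case by (simp add: \<alpha>_def numeral_3_eq_3)
next
  case (step i)
  have "m (Suc i) = p (Suc i) + p (Suc i + 2)" using step by (intro m_up) auto
  moreover have "m (Suc i) = p (Suc i + 1) + p (Suc i - 1)" using step by (intro m_down) auto
  ultimately show ?case using step by (simp add: add.commute)
qed

lemma m_const:
  assumes "1 \<le> i" "i \<le> r - 2"
  shows "m i = 2 * \<alpha>"
proof (cases "i = r - 2")
  \<comment> \<open>This index is beyond the range of \<open>m_up\<close>, so \<open>m_down\<close>
    takes over.\<close>
  case True
  have "i + 1 = r - 1" "i - 1 = r - 3" "r - 3 + 2 = r - 1" using True r by auto
  then have "m i = p (r - 1) + p (r - 3)" using m_down[of i] True r by simp
  moreover have "p (r - 3) + p (r - 1) = 2 * \<alpha>"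
    using p_pair[of "r - 3"] r \<open>r - 3 + 2 = r - 1\<close> by simp
  ultimately show ?thesis by (simp add: add.commute)
next
  case False
  then show ?thesis using m_up[of i] p_pair[of i] assms by simp
qed

definition h1 :: complex where "h1 = p 1 - \<alpha>"
definition h2 :: complex where "h2 = p 2 - \<alpha>"

lemma p_eq:
  assumes "1 \<le> i" "i \<le> r - 1"
  shows "p i = \<alpha> + per4 h1 h2 i"
proof -
  have "p i - \<alpha> = per4 (p 1 - \<alpha>) (p 2 - \<alpha>) i"
  proof (rule antiperiodic_eq_per4[where h = "\<lambda>i. p i - \<alpha>"])
    fix i assume "1 \<le> i" "i + 2 \<le> r - 1"
    then have "p i + p (i + 2) = 2 * \<alpha>" by (intro p_pair) auto
    then show "p (i + 2) - \<alpha> = - (p i - \<alpha>)" by (simp add: algebra_simps)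
  qed (use assms in auto)
  then show ?thesis by (simp add: h1_def h2_def algebra_simps)
qed

lemma sum_p:
  assumes "n \<le> r - 1"
  shows "(\<Sum>i=1..n. p i) = of_nat n * \<alpha> +
    (if n mod 4 = 1 then h1 else if n mod 4 = 2 then h1 + h2 else if n mod 4 = 3 then h2 else 0)"
proof -
  have "(\<Sum>i=1..n. p i) = (\<Sum>i=1..n. \<alpha> + per4 h1 h2 i)"
    using assms by (intro sum.cong refl p_eq) auto
  then show ?thesis unfolding sum.distrib sum_per4 by simp
qed

lemma m_pred_r: "m (r - 1) = p r + p (r - 2)"
proof -
  have "r - 1 + 1 = r" "r - 1 - 1 = r - 2" using r by auto
  then show ?thesis using m_down[of "r - 1"] r by simp
qed

text \<open>The three blocks of \<open>B_star r\<close> without \<open>C\<close>-elements give the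
  equations \<open>X\<close>, \<open>Y\<close> and \<open>Z\<close>. Here \<open>Y\<close>
  determines \<open>p r\<close>; the others, together with \<open>p_2\<close> where needed,
  determine \<open>h1\<close> and \<open>h2\<close>. The residue of \<open>r\<close> modulo 4
  decides which of the two parameters appears at \<open>r - 2\<close> and \<open>r - 1\<close>, and
  with which sign.\<close>

lemma constant_odd:
  assumes "odd r"
  shows "h1 = 0 \<and> h2 = 0 \<and> p r = - (of_nat r - 1) * \<alpha>"
proof -
  obtain n where n: "r = 2 * n + 1" using assms by (elim oddE)
  have n2: "2 \<le> n" using r n by simp
  have X: "p 2 + p r + p (r - 1) + of_nat (n - 1) * (2 * \<alpha>) = 0"
  proof -
    have "(\<Sum>v\<in>{J r, P (r - 1)} \<union> {J i |i. even i \<and> 2 \<le> i \<and> i \<le> r - 3}. x v) = 0"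
      by (rule star_sum[OF star_blocks_odd(1)[OF r assms, symmetric]]) (use r in simp)
    moreover have "(\<Sum>v\<in>{J r, P (r - 1)} \<union> {J i |i. even i \<and> 2 \<le> i \<and> i \<le> r - 3}. x v) =
        (\<Sum>v\<in>{J r, P (r - 1)}. x v) + (\<Sum>i | even i \<and> 2 \<le> i \<and> i \<le> r - 3. m i)"
      using r by (intro sum_Un_image inj_omega) auto
    moreover have "(\<Sum>i | even i \<and> 2 * 1 \<le> i \<and> i \<le> 2 * (n - 1). m i) = of_nat (Suc (n - 1) - 1) * (2 * \<alpha>)"
      using n by (intro sum_even_const m_const) auto
    moreover have "2 * (n - 1) = r - 3" using n by simp
    ultimately show ?thesis by (simp add: m_r)
  qed
  have Y: "p r + of_nat n * (2 * \<alpha>) = 0"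
  proof -
    have "(\<Sum>v\<in>{P r} \<union> {J i |i. odd i \<and> 1 \<le> i \<and> i \<le> r - 2}. x v) = 0"
      by (rule star_sum[OF star_blocks_odd(2)[OF r assms, symmetric]]) (use r in simp)
    moreover have "(\<Sum>v\<in>{P r} \<union> {J i |i. odd i \<and> 1 \<le> i \<and> i \<le> r - 2}. x v) =
        (\<Sum>v\<in>{P r}. x v) + (\<Sum>i | odd i \<and> 1 \<le> i \<and> i \<le> r - 2. m i)"
      using r by (intro sum_Un_image inj_omega) auto
    moreover have "(\<Sum>i | odd i \<and> 2 * 0 + 1 \<le> i \<and> i \<le> 2 * (n - 1) + 1. m i) = of_nat (Suc (n - 1) - 0) * (2 * \<alpha>)"
      using n n2 by (intro sum_odd_const m_const) auto
    moreover have "2 * (n - 1) + 1 = r - 2" "Suc (n - 1) = n" using n n2 by simp_all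
    ultimately show ?thesis by simp
  qed
  have Z: "p r + p (r - 2) + (\<Sum>i=1..r-2. p i) = 0"
  proof -
    have "(\<Sum>v\<in>{J (r - 1)} \<union> {P i |i. 1 \<le> i \<and> i \<le> r - 2}. x v) = 0"
      by (rule star_sum[OF star_blocks_odd(3)[OF r assms, symmetric]]) (use r in simp)
    moreover have "(\<Sum>v\<in>{J (r - 1)} \<union> {P i |i. 1 \<le> i \<and> i \<le> r - 2}. x v) =
        (\<Sum>v\<in>{J (r - 1)}. x v) + (\<Sum>i | 1 \<le> i \<and> i \<le> r - 2. p i)"
      using r by (intro sum_Un_image inj_omega) auto
    moreover have "{i. 1 \<le> i \<and> i \<le> r - 2} = {1..r-2}" by auto
    ultimately show ?thesis by (simp add: m_pred_r[unfolded One_nat_def])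
  qed
  \<comment> \<open>Treating the multiple of \<open>\<alpha>\<close> as an atom leaves equations
    with numerical coefficients.\<close>
  define N where "N = of_nat n * \<alpha>"
  have N: "of_nat (r - 2) * \<alpha> = 2 * N - \<alpha>" "of_nat (n - 1) * (2 * \<alpha>) = 2 * N - 2 * \<alpha>"
    "of_nat n * (2 * \<alpha>) = 2 * N"
    using n n2 by (simp_all add: N_def of_nat_diff algebra_simps)
  have pr: "p r = - 2 * N" using Y N by (simp add: eq_neg_iff_add_eq_0)
  have p2: "p 2 = \<alpha> + h2" by (simp add: h2_def)
  have "r mod 4 = 1 \<or> r mod 4 = 3" using assms by presburger
  then have "h1 = 0 \<and> h2 = 0"
  proof (elim disjE)
    \<comment> \<open>Here \<open>p_2\<close> gives \<open>h2 = - h1\<close>, while \<open>Z\<close>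
      reduces to \<open>h2 = h1\<close>.\<close>
    assume "r mod 4 = 1"
    then have mods: "(r - 2) mod 4 = 3" by (simp add: diff_mod_4[OF r])
    then have "p (r - 2) = \<alpha> - h1" using p_eq[of "r - 2"] r by (simp add: per4_def)
    moreover from this have "h2 = - h1" using p_2 p2 by simp
    moreover have "(\<Sum>i=1..r-2. p i) = 2 * N - \<alpha> + h2" using sum_p[of "r - 2"] mods N by simp
    ultimately show ?thesis using Z pr by simp
  next
    \<comment> \<open>Here \<open>Z\<close> reduces to \<open>2 * h1 = 0\<close> and
      \<open>X\<close> to \<open>2 * h2 = 0\<close>.\<close>
    assume "r mod 4 = 3"
    then have mods: "(r - 2) mod 4 = 1" "(r - 1) mod 4 = 2" by (simp_all add: diff_mod_4[OF r, unfolded One_nat_def])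
    then have "p (r - 2) = \<alpha> + h1" "p (r - 1) = \<alpha> + h2"
      using p_eq[of "r - 2"] p_eq[of "r - 1"] r by (simp_all add: per4_def)
    moreover have "(\<Sum>i=1..r-2. p i) = 2 * N - \<alpha> + h1" using sum_p[of "r - 2"] mods N by simp
    ultimately show ?thesis using X Z pr p2 N by simp
  qed
  moreover have "- 2 * N = - (of_nat r - 1) * \<alpha>" using n by (simp add: N_def)
  ultimately show ?thesis using pr by simp
qed

lemma constant_even:
  assumes "even r"
  shows "h1 = 0 \<and> h2 = 0 \<and> p r = - (of_nat r - 1) * \<alpha>"
proof -
  obtain n where n: "r = 2 * n" using assms by (elim evenE)
  have n3: "3 \<le> n" using r n by simp
  have X: "m 2 + p 1 + p 4 + (p r + p (r - 2) + of_nat (n - 3) * (2 * \<alpha>)) = 0"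
  proof -
    have "(\<Sum>v\<in>{J 2, P 1, P 4} \<union> {J i |i. odd i \<and> 5 \<le> i \<and> i \<le> r - 1}. x v) = 0"
      by (rule star_sum[OF star_blocks_even(1)[OF r assms, symmetric]]) (use r in simp)
    moreover have "(\<Sum>v\<in>{J 2, P 1, P 4} \<union> {J i |i. odd i \<and> 5 \<le> i \<and> i \<le> r - 1}. x v) =
        (\<Sum>v\<in>{J 2, P 1, P 4}. x v) + (\<Sum>i | odd i \<and> 5 \<le> i \<and> i \<le> r - 1. m i)"
      by (intro sum_Un_image inj_omega) auto
    \<comment> \<open>The index \<open>r - 1\<close> is split off because \<open>m_const\<close>
      does not cover it; the index \<open>r\<close> is split off in \<open>Y\<close> and
      \<open>Z\<close> for a similar reason.\<close>
    moreover have "{i. odd i \<and> 5 \<le> i \<and> i \<le> r - 1} =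
        insert (r - 1) {i. odd i \<and> 2 * 2 + 1 \<le> i \<and> i \<le> 2 * (n - 2) + 1}"
      unfolding n
      by (intro Set.set_eqI, simp only: mem_Collect_eq insert_iff) (use n3 in presburger)
    moreover have "(\<Sum>i\<in>insert (r - 1) {i. odd i \<and> 2 * 2 + 1 \<le> i \<and> i \<le> 2 * (n - 2) + 1}. m i) =
        m (r - 1) + (\<Sum>i | odd i \<and> 2 * 2 + 1 \<le> i \<and> i \<le> 2 * (n - 2) + 1. m i)"
      using n n3 by (intro sum.insert) auto
    moreover have "(\<Sum>i | odd i \<and> 2 * 2 + 1 \<le> i \<and> i \<le> 2 * (n - 2) + 1. m i) =
        of_nat (Suc (n - 2) - 2) * (2 * \<alpha>)"
      using n by (intro sum_odd_const m_const) auto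
    moreover have "Suc (n - 2) - 2 = n - 3" by simp
    moreover have "(\<Sum>v\<in>{J 2, P 1, P 4}. x v) = m 2 + p 1 + p 4" by simp
    ultimately show ?thesis by (simp only: m_pred_r)
  qed
  have Y: "m 3 + p 2 + p 5 + (p 2 + p r + of_nat (n - 3) * (2 * \<alpha>)) = 0"
  proof -
    have "(\<Sum>v\<in>{J 3, P 2, P 5} \<union> {J i |i. even i \<and> 6 \<le> i \<and> i \<le> r}. x v) = 0"
      by (rule star_sum[OF star_blocks_even(2)[OF r assms, symmetric]]) (use r in simp)
    moreover have "(\<Sum>v\<in>{J 3, P 2, P 5} \<union> {J i |i. even i \<and> 6 \<le> i \<and> i \<le> r}. x v) =
        (\<Sum>v\<in>{J 3, P 2, P 5}. x v) + (\<Sum>i | even i \<and> 6 \<le> i \<and> i \<le> r. m i)"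
      by (intro sum_Un_image inj_omega) auto
    moreover have "{i. even i \<and> 6 \<le> i \<and> i \<le> r} =
        insert r {i. even i \<and> 2 * 3 \<le> i \<and> i \<le> 2 * (n - 1)}"
      unfolding n
      by (intro Set.set_eqI, simp only: mem_Collect_eq insert_iff) (use n3 in presburger)
    moreover have "(\<Sum>i\<in>insert r {i. even i \<and> 2 * 3 \<le> i \<and> i \<le> 2 * (n - 1)}. m i) =
        m r + (\<Sum>i | even i \<and> 2 * 3 \<le> i \<and> i \<le> 2 * (n - 1). m i)"
      using n n3 by (intro sum.insert) auto
    moreover have "(\<Sum>i | even i \<and> 2 * 3 \<le> i \<and> i \<le> 2 * (n - 1). m i) =
        of_nat (Suc (n - 1) - 3) * (2 * \<alpha>)"
      using n by (intro sum_even_const m_const) auto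
    moreover have "Suc (n - 1) - 3 = n - 3" by simp
    moreover have "(\<Sum>v\<in>{J 3, P 2, P 5}. x v) = m 3 + p 2 + p 5" by simp
    ultimately show ?thesis by (simp only: m_r)
  qed
  have Z: "m 1 + m 4 + p 3 + (p r + ((\<Sum>i=1..r-1. p i) - (\<Sum>i=1..5. p i))) = 0"
  proof -
    have "(\<Sum>v\<in>{J 1, J 4, P 3} \<union> {P i |i. 6 \<le> i \<and> i \<le> r}. x v) = 0"
      by (rule star_sum[OF star_blocks_even(3)[OF r assms, symmetric]]) (use r in simp)
    moreover have "(\<Sum>v\<in>{J 1, J 4, P 3} \<union> {P i |i. 6 \<le> i \<and> i \<le> r}. x v) =
        (\<Sum>v\<in>{J 1, J 4, P 3}. x v) + (\<Sum>i | 6 \<le> i \<and> i \<le> r. p i)"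
      by (intro sum_Un_image inj_omega) auto
    moreover have "{i. 6 \<le> i \<and> i \<le> r} = insert r {6..r-1}" using n n3 by auto
    moreover have "(\<Sum>i\<in>insert r {6..r-1}. p i) = p r + (\<Sum>i\<in>{6..r-1}. p i)"
      using n n3 by (intro sum.insert) auto
    moreover have "(\<Sum>i\<in>{6..r-1}. p i) = (\<Sum>i=1..r-1. p i) - (\<Sum>i=1..5. p i)"
    proof -
      have "{1..r-1} = {1..5} \<union> {6..r-1}" using n n3 by auto
      then have "(\<Sum>i=1..r-1. p i) = (\<Sum>i=1..5. p i) + (\<Sum>i\<in>{6..r-1}. p i)"
        by (simp only:) (intro sum.union_disjoint, auto)
      then show ?thesis by simp
    qed
    moreover have "(\<Sum>v\<in>{J 1, J 4, P 3}. x v) = m 1 + m 4 + p 3" by simp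
    ultimately show ?thesis by (simp only:)
  qed
  define N where "N = of_nat n * \<alpha>"
  have N: "of_nat (n - 3) * (2 * \<alpha>) = 2 * N - 6 * \<alpha>" "of_nat (r - 1) * \<alpha> = 2 * N - \<alpha>"
    using n n3 by (simp_all add: N_def of_nat_diff algebra_simps)
  have ms: "m 1 = 2 * \<alpha>" "m 2 = 2 * \<alpha>" "m 3 = 2 * \<alpha>" "m 4 = 2 * \<alpha>"
    using n n3 by (auto intro: m_const)
  have ps: "p 1 = \<alpha> + h1" "p 2 = \<alpha> + h2" "p 3 = \<alpha> - h1" "p 4 = \<alpha> - h2" "p 5 = \<alpha> + h1"
    using p_eq[of 1] p_eq[of 2] p_eq[of 3] p_eq[of 4] p_eq[of 5] n n3 by (simp_all add: per4_def)
  have s5: "(\<Sum>i=1..5. p i) = 5 * \<alpha> + h1" using sum_p[of 5] n n3 by simp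
  have "r mod 4 = 0 \<or> r mod 4 = 2" using assms by presburger
  then have "h1 = 0 \<and> h2 = 0 \<and> p r = \<alpha> - 2 * N"
  proof (elim disjE)
    \<comment> \<open>\<open>X\<close> expresses \<open>p r\<close> through \<open>h1\<close>; then
      \<open>Y\<close> leaves \<open>2 * h2 = 0\<close> and \<open>Z\<close> leaves
      \<open>3 * h1 = 0\<close>.\<close>
    assume "r mod 4 = 0"
    then have mods: "(r - 2) mod 4 = 2" "(r - 1) mod 4 = 3" by (simp_all add: diff_mod_4[OF r, unfolded One_nat_def])
    have "p (r - 2) = \<alpha> + h2"
      using p_eq[of "r - 2"] mods r by (simp add: per4_def)
    then have "2 * \<alpha> + (\<alpha> + h1) + (\<alpha> - h2) + (p r + (\<alpha> + h2) + (2 * N - 6 * \<alpha>)) = 0"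
      using X by (simp only: ms ps N)
    then have X': "p r = \<alpha> - 2 * N - h1" by (rule eq_if_diff) (simp add: algebra_simps)
    have "2 * \<alpha> + (\<alpha> + h2) + (\<alpha> + h1) + (\<alpha> + h2 + p r + (2 * N - 6 * \<alpha>)) = 0"
      using Y by (simp only: ms ps N)
    then have "2 * h2 = 0" unfolding X' by (rule eq_if_diff) (simp add: algebra_simps)
    then have h2: "h2 = 0" by simp
    have "(\<Sum>i=1..r-1. p i) = 2 * N - \<alpha> + h2"
      using sum_p[of "r - 1"] mods N by simp
    then have "2 * \<alpha> + 2 * \<alpha> + (\<alpha> - h1) + (p r + ((2 * N - \<alpha> + h2) - (5 * \<alpha> + h1))) = 0"
      using Z by (simp only: ms ps s5)
    then have "3 * h1 = 0" unfolding X' h2 by (rule eq_if_diff_uminus) (simp add: algebra_simps)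
    then show ?thesis using h2 X' by simp
  next
    \<comment> \<open>Now \<open>p_2\<close> compares \<open>\<alpha> + h2\<close> with
      \<open>\<alpha> - h2\<close> and kills \<open>h2\<close> at once; \<open>X\<close> and
      \<open>Z\<close> then settle \<open>p r\<close> and \<open>h1\<close>.\<close>
    assume "r mod 4 = 2"
    then have mods: "(r - 2) mod 4 = 0" "(r - 1) mod 4 = 1" by (simp_all add: diff_mod_4[OF r, unfolded One_nat_def])
    have pr2: "p (r - 2) = \<alpha> - h2"
      using p_eq[of "r - 2"] mods r by (simp add: per4_def)
    then have "2 * h2 = 0" using p_2 ps(2) by (simp add: eq_neg_iff_add_eq_0)
    then have h2: "h2 = 0" by simp
    have "2 * \<alpha> + (\<alpha> + h1) + (\<alpha> - h2) + (p r + (\<alpha> - h2) + (2 * N - 6 * \<alpha>)) = 0"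
      using X by (simp only: ms ps N pr2)
    then have X': "p r = \<alpha> - 2 * N - h1" unfolding h2 by (rule eq_if_diff) (simp add: algebra_simps)
    have "(\<Sum>i=1..r-1. p i) = 2 * N - \<alpha> + h1"
      using sum_p[of "r - 1"] mods N by simp
    then have "2 * \<alpha> + 2 * \<alpha> + (\<alpha> - h1) + (p r + ((2 * N - \<alpha> + h1) - (5 * \<alpha> + h1))) = 0"
      using Z by (simp only: ms ps s5)
    then have "2 * h1 = 0" unfolding X' by (rule eq_if_diff_uminus) (simp add: algebra_simps)
    then show ?thesis using h2 X' by simp
  qed
  moreover have "\<alpha> - 2 * N = - (of_nat r - 1) * \<alpha>" using n by (simp add: N_def algebra_simps)
  ultimately show ?thesis by simp
qed

lemma h_zero: "h1 = 0" "h2 = 0"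
  and p_r: "p r = - (of_nat r - 1) * \<alpha>"
  using constant_odd constant_even by (cases "odd r"; simp)+

lemma p_const: "1 \<le> i \<Longrightarrow> i \<le> r - 1 \<Longrightarrow> p i = \<alpha>"
  using p_eq[of i] by (simp add: h_zero per4_def)

text \<open>With the \<open>p i\<close> constant below \<open>r\<close>, the identity
  \<open>m k = p k + p (k + 1)\<close> holds for every \<open>k\<close>, cyclically. So both kinds
  of tail have the same sum, depending only on \<open>j + d\<close>, and the tails in
  \<open>c_step\<close> cancel.\<close>

lemma T_eq_m:
  assumes "1 \<le> j" "j \<le> r - 1" "1 \<le> d" "d \<le> r - 2"
  shows "T j d = m (idx r (j + d))"
proof -
  define k where "k = idx r (j + d)"
  have k: "1 \<le> k" "k \<le> r" using idx_range[of r "j + d"] r by (auto simp: k_def)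
  have "idx r (j + (d + 1)) = (if k = r then 1 else k + 1)"
    using assms r idx_add[of j r d] idx_add[of j r "d + 1"] by (auto simp: k_def)
  moreover have "m k = p k + p (if k = r then 1 else k + 1)"
  proof -
    consider "k = r" | "k = r - 1" | "k \<le> r - 2" using k by linarith
    then show ?thesis
    proof cases
      case 1
      then show ?thesis using m_r p_const[of 1] p_const[of 2] r by simp
    next
      case 2
      then have "k + 1 = r" "k \<noteq> r" using r by auto
      then show ?thesis
        using 2 m_pred_r p_const[of "r - 2"] p_const[of "r - 1"] r by (simp add: add.commute)
    next
      case 3
      then have "k \<noteq> r" using r by auto
      then show ?thesis using 3 m_const[of k] p_const[of k] p_const[of "k + 1"] k r by simp
    qed
  qed
  ultimately show ?thesis using assms by (simp add: T_def k_def)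
qed

lemma c_const:
  assumes s: "1 \<le> s" "s \<le> r - 3"
  shows "1 \<le> j \<Longrightarrow> j \<le> r - 1 \<Longrightarrow> c j s = c 1 s"
proof (induction j rule: dec_induct)
  case (step j)
  have "T j (s + 1) = m (idx r (j + (s + 1)))" using step s r by (intro T_eq_m) auto
  moreover have "T (j + 1) s = m (idx r (j + 1 + s))" using step s r by (intro T_eq_m) auto
  moreover have "j + (s + 1) = j + 1 + s" by simp
  ultimately have "c (j + 1) s = c j s" using c_step[of j s] step s by (metis add_right_cancel Suc_eq_plus1)
  then show ?case using step by simp
qed simp

text \<open>\<open>c_const\<close> does not reach index \<open>r\<close>; the block
  \<open>C_set r s\<close> of \<open>B_star r\<close> does. Its sum is the one that a difference of
  two \<open>C\<close>-sets fails to annihilate.\<close>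

lemma c_r:
  assumes s: "1 \<le> s" "s \<le> r - 3"
  shows "c r s = - (of_nat r - 1) * c 1 s"
proof -
  have "{1..r} = insert r {1..r-1}" using r by auto
  then have "(\<Sum>i=1..r. c i s) = c r s + (\<Sum>i=1..r-1. c i s)"
    using r by simp
  also have "(\<Sum>i=1..r-1. c i s) = (\<Sum>i=1..r-1. c 1 s)"
    by (intro sum.cong refl c_const[OF s]) auto
  finally have "c r s + (of_nat r - 1) * c 1 s = 0"
    using star_C_sum[OF s] r by (simp add: of_nat_diff)
  then show ?thesis
    by (rule eq_if_diff) (simp add: algebra_simps)
qed

definition S :: complex where "S = (\<Sum>q=1..r-3. c 1 q)"

text \<open>Diagonal 0 of the first table has its \<open>C\<close>-entries at indices below
  \<open>r\<close>, so their sum is \<open>S\<close>.\<close>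

lemma S_eq: "S = (of_nat r - 2) * \<alpha>"
proof -
  have "(\<Sum>q=1..r-3. c (idx r (1 + tau r 0 q)) q) = S"
    unfolding S_def
  proof (rule sum.cong[OF refl])
    fix q assume q: "q \<in> {1..r-3}"
    then have "1 + tau r 0 q = r - q" "1 \<le> r - q" "r - q \<le> r - 1" using r by (auto simp: tau_def)
    then show "c (idx r (1 + tau r 0 q)) q = c 1 q"
      using c_const[of q "r - q"] q by (simp add: idx_self)
  qed
  moreover have "T 1 0 = \<alpha> + p r"
    using r p_const[of 2] by (simp add: T_def idx_def numeral_2_eq_2)
  ultimately have "S + (\<alpha> + p r) = 0"
    using diag_zero[of 1 0] r by simp
  then show ?thesis unfolding p_r by (rule eq_if_diff) (simp add: algebra_simps)
qed

text \<open>For these \<open>d\<close>, diagonal \<open>d\<close> of the first table meets index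
  \<open>r\<close> in row \<open>d\<close> only. Its sum is thus \<open>S\<close> with
  \<open>c 1 d\<close> replaced by \<open>c r d\<close>, plus the tail, and \<open>c_r\<close> turns
  this into \<open>r\<close> times \<open>\<alpha> - c 1 d\<close>.\<close>

lemma c_eq_\<alpha>:
  assumes d: "1 \<le> d" "d \<le> r - 3"
  shows "c 1 d = \<alpha>"
proof -
  let ?A = "{1..r-3} - {d}"
  have "(\<Sum>q=1..r-3. c (idx r (1 + tau r d q)) q) =
      c (idx r (1 + tau r d d)) d + (\<Sum>q\<in>?A. c (idx r (1 + tau r d q)) q)"
    using d by (intro sum.remove) auto
  moreover have "1 + tau r d d = r" using r by (simp add: tau_def)
  moreover have "(\<Sum>q\<in>?A. c (idx r (1 + tau r d q)) q) = (\<Sum>q\<in>?A. c 1 q)"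
  proof (rule sum.cong[OF refl])
    fix q assume q: "q \<in> ?A"
    then have "1 + tau r d q \<le> r - 1" using r d by (auto simp: tau_def)
    then show "c (idx r (1 + tau r d q)) q = c 1 q"
      using c_const[of q "1 + tau r d q"] q by (simp add: idx_self)
  qed
  moreover have "S = c 1 d + (\<Sum>q\<in>?A. c 1 q)"
    unfolding S_def using d by (intro sum.remove) auto
  moreover have "(\<Sum>q=1..r-3. c (idx r (1 + tau r d q)) q) + T 1 d = 0"
    using d r by (intro diag_zero) auto
  moreover have "T 1 d = 2 * \<alpha>"
    using T_eq_m[of 1 d] m_const[of "1 + d"] d r by (simp add: idx_self)
  moreover have "idx r r = r" by (simp add: idx_def)
  ultimately have "c r d + (S - c 1 d) + 2 * \<alpha> = 0"
    by (simp add: add_diff_eq)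
  then have "of_nat r * (c 1 d - \<alpha>) = 0"
    unfolding c_r[OF d] S_eq by (rule eq_if_diff_uminus) (simp add: algebra_simps)
  then show ?thesis using r by simp
qed

text \<open>\<open>S\<close> has \<open>r - 3\<close> summands, each equal to
  \<open>\<alpha>\<close>, whereas \<open>S_eq\<close> gives \<open>r - 2\<close> times
  \<open>\<alpha>\<close>.\<close>

lemma \<alpha>_zero: "\<alpha> = 0"
proof -
  have "S = (\<Sum>q=1..r-3. \<alpha>)"
    unfolding S_def by (intro sum.cong refl c_eq_\<alpha>) auto
  then have "S = (of_nat r - 3) * \<alpha>" using r by (simp add: of_nat_diff)
  then have "(of_nat r - 3) * \<alpha> - (of_nat r - 2) * \<alpha> = 0" using S_eq by simp
  then show ?thesis by (rule eq_if_diff_uminus) (simp add: algebra_simps)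
qed

lemma vector_zero:
  assumes "w \<in> Omega r"
  shows "x w = 0"
proof (cases w)
  case (J i)
  have "i \<le> r - 2 \<or> i = r - 1 \<or> i = r" using assms by (auto simp: J)
  then show ?thesis
    using assms m_const[of i] m_pred_r m_r p_const[of 2] p_const[of "r - 2"] r
    by (auto simp: J \<alpha>_zero p_r)
next
  case (P i)
  then have "i = r \<or> 1 \<le> i \<and> i \<le> r - 1" using assms by auto
  then show ?thesis using p_const[of i] by (auto simp: P \<alpha>_zero p_r)
next
  case (C i q)
  then have "i = r \<or> 1 \<le> i \<and> i \<le> r - 1" "1 \<le> q" "q \<le> r - 3" using assms by auto
  then show ?thesis
    using c_const[of q i] c_r[of q] c_eq_\<alpha>[of q] by (auto simp: C \<alpha>_zero)
qed

end

section \<open>Simplicity for the modified family and the conclusion\<close>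

lemma simple_star:
  assumes r: "4 < r"
  defines "M \<equiv> trans_monoid (Omega r) (B_fam r) (I_fam r)"
  shows "simple_left_module (monoid_algebra M) (aug_module (Omega r) M)"
proof -
  define \<L> where "\<L> = lab r ` {1..r-1} \<union> {star_lab r}"
  interpret fibre_monoid "Omega r" r \<L> "I_fam r"
    by (rule fibre_monoid_lab[OF r]) (auto simp: \<L>_def)
  have "B_part r ` {1..r-1} = fibres (Omega r) r ` lab r ` {1..r-1}"
    unfolding image_image using B_part_fibres[OF r] by (intro image_cong) auto
  then have fam: "B_fam r = fibres (Omega r) r ` \<L>"
    unfolding B_fam_def \<L>_def image_Un B_star_fibres[OF r] by simp
  have M: "M = G" unfolding M_def G_def fam by (rule refl)
  show ?thesis
    unfolding M
  proof (rule simple_aug)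
    show "J r \<in> Omega r" "P r \<in> Omega r" "J r \<noteq> P r" using r by auto
    show "(J r, w) \<in> {(p, q). \<exists>I\<in>I_fam r. p \<in> I \<and> q \<in> I}\<^sup>*" if "w \<in> Omega r" for w
      using Omega_connected[OF r that] .
    fix x assume x: "x \<in> augmentation (Omega r)"
      and null: "\<And>L l. L \<in> \<L> \<Longrightarrow> l < r \<Longrightarrow> bsum L x l = 0"
    interpret null_vector r x
      by standard (auto simp: r \<L>_def intro: null)
    show "x = (\<lambda>_. 0)"
      using x vector_zero by (auto simp: fun_eq_iff augmentation_def lin_comb_def)
  qed
qed

theorem theorem4p3:
  fixes r :: nat
  assumes "r > 4"
  defines "M \<equiv> trans_monoid (Omega r) (B_fam r) (I_fam r)"
      and "M' \<equiv> trans_monoid (Omega r) (B_fam' r) (I_fam r)"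
  shows "simple_left_module (monoid_algebra M) (aug_module (Omega r) M) \<and>
         (left_module (monoid_algebra M') (aug_module (Omega r) M') \<and>
          \<not> simple_left_module (monoid_algebra M') (aug_module (Omega r) M'))"
  unfolding M_def M'_def
  using simple_star[OF assms(1)] not_simple_cyclic[OF assms(1)] by blast

end
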